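(* Let $G=(V,E)$ be an $\mathcal{M}_{2,2}^*$-circuit, let $(G,p)$ be a generic framework on the unit cylinder $\mathcal{Y}$, and let $v\in V$. Then $(G,p)$ is $v$-free infinitesimally rigid.
   Context: All graphs finite and simple. $G=(V,E)$ is an $\mathcal{M}_{2,2}^*$-circuit if $|E|=2|V|-1$ and every nonempty proper $F\subsetneq E$ satisfies $|F|\le2|V(F)|-2$ ($V(F)$ = vertices incident with $F$). Let $\mathcal{Y}=\{(x,y,z):x^2+y^2=1\}$; a framework $(G,p)$ on $\mathcal{Y}$ with $V=\{v_1,\dots,v_n\}$ is a map $p:V\to\mathcal{Y}$, generic if its coordinates generate a field of transcendence degree $2n$ over $\mathbb{Q}$. Write $p(v_i)=(x_i,y_i,z_i)$, $\bar p(v_i)=(x_i,y_i,0)$. The rigidity matrix $R_{\mathrm{cyl}}(G,p)$ is the $(|E|+|V|)\times3|V|$ matrix whose columns come in triples indexed by $V$; the row of an edge $e=v_iv_j$ has $p(v_i)-p(v_j)$ in the columns of $v_i$, $p(v_j)-p(v_i)$ in the columns of $v_j$ and zeros elsewhere; the row of a vertex $v_i$ has $\bar p(v_i)$ in the columns of $v_i$ and zeros elsewhere. $R_v(G,p)$ is obtained from $R_{\mathrm{cyl}}(G,p)$ by deleting the row indexed by the vertex $v$ (this is the rigidity matrix when $v$ may move freely in $\mathbb{R}^3$ and all other vertices stay on $\mathcal{Y}$). $(G,p)$ is $v$-free infinitesimally rigid if $\operatorname{rank}R_v(G,p)=3|V|-2$ (equivalently, its only such $v$-free infinitesimal motions are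 induced by the continuous isometries of $\mathcal{Y}$). *)

theory Defs
  imports
    "HOL-Library.Poly_Mapping"
    "HOL-Library.Extended_Nat"
    "HOL-Algebra.Generated_Fields"
    "Jordan_Normal_Form.DL_Rank"
begin

definition simple_graph :: "'a set \<Rightarrow> 'a set set \<Rightarrow> bool" where
  "simple_graph V E \<longleftrightarrow> finite V \<and> (\<forall>e\<in>E. e \<subseteq> V \<and> card e = 2)"

text \<open>The set of vertices incident with a set \<open>F\<close> of edges is \<open>\<Union>F\<close>.\<close>

definition M22_circuit :: "'a set \<Rightarrow> 'a set set \<Rightarrow> bool" where
  "M22_circuit V E \<longleftrightarrow> simple_graph V E \<and>
     int (card E) = 2 * int (card V) - 1 \<and>
     (\<forall>F. F \<noteq> {} \<longrightarrow> F \<subset> E \<longrightarrow> int (card F) \<le> 2 * int (card (\<Union>F)) - 2)"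

text \<open>Points of \<open>\<real>\<^sup>3\<close> are vectors in \<open>carrier_vec 3\<close>, with coordinates
  \<open>x, y, z\<close> at the indices \<open>0, 1, 2\<close>.\<close>

definition cylinder :: "real vec set" where
  "cylinder = {q \<in> carrier_vec 3. (q $ 0)\<^sup>2 + (q $ 1)\<^sup>2 = 1}"

definition framework_on_cylinder :: "'a set \<Rightarrow> ('a \<Rightarrow> real vec) \<Rightarrow> bool" where
  "framework_on_cylinder V p \<longleftrightarrow> (\<forall>u\<in>V. p u \<in> cylinder)"

text \<open>A rational polynomial in variables from \<open>X\<close> is a finitely supported map from
  monomials (finitely supported exponent maps \<open>X \<Rightarrow>\<^sub>0 nat\<close>) to coefficients. Below, the
  variables are themselves real numbers, each of which is evaluated at itself.\<close>

definition eval_rat_poly :: "((real \<Rightarrow>\<^sub>0 nat) \<Rightarrow>\<^sub>0 rat) \<Rightarrow> real" where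
  "eval_rat_poly P =
     (\<Sum>m\<in>Poly_Mapping.keys P. of_rat (Poly_Mapping.lookup P m) *
        (\<Prod>x\<in>Poly_Mapping.keys m. x ^ Poly_Mapping.lookup m x))"

definition algebraically_independent :: "real set \<Rightarrow> bool" where
  "algebraically_independent B \<longleftrightarrow>
     (\<forall>P. (\<forall>m\<in>Poly_Mapping.keys P. Poly_Mapping.keys m \<subseteq> B) \<longrightarrow> eval_rat_poly P = 0 \<longrightarrow> P = 0)"

text \<open>The transcendence degree over \<open>\<rat>\<close> of a field \<open>K\<close> of real numbers; all infinite
  values are identified.\<close>

definition trans_degree :: "real set \<Rightarrow> enat" where
  "trans_degree K =
     (SUP B \<in> {B. B \<subseteq> K \<and> finite B \<and> algebraically_independent B}. enat (card B))"

text \<open>\<open>class_ring\<close> is the field of real numbers as a record. Since the characteristic is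
  \<open>0\<close>, the field generated by the coordinates contains \<open>\<rat>\<close>.\<close>

definition coordinate_field :: "'a set \<Rightarrow> ('a \<Rightarrow> real vec) \<Rightarrow> real set" where
  "coordinate_field V p =
     generate_field (class_ring :: real ring) {p u $ i | u i. u \<in> V \<and> i < 3}"

definition generic_on_cylinder :: "'a set \<Rightarrow> ('a \<Rightarrow> real vec) \<Rightarrow> bool" where
  "generic_on_cylinder V p \<longleftrightarrow> framework_on_cylinder V p \<and>
     trans_degree (coordinate_field V p) = enat (2 * card V)"

text \<open>Rows of the rigidity matrix are indexed by edges (\<open>Inl e\<close>) and vertices (\<open>Inr u\<close>).
  \<open>row_block p l w\<close> is the entry of row \<open>l\<close> in the three columns of the vertex \<open>w\<close>. For an
  edge \<open>e\<close> incident with \<open>w\<close>, the other endpoint of \<open>e\<close> is \<open>the_elem (e - {w})\<close>.\<close>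

fun row_block :: "('a \<Rightarrow> real vec) \<Rightarrow> 'a set + 'a \<Rightarrow> 'a \<Rightarrow> real vec" where
  "row_block p (Inl e) w = (if w \<in> e then p w - p (the_elem (e - {w})) else 0\<^sub>v 3)"
| "row_block p (Inr u) w = (if w = u then vec_of_list [p u $ 0, p u $ 1, 0] else 0\<^sub>v 3)"

text \<open>Here \<open>vs\<close> enumerates the vertices and thereby orders the column triples, while \<open>ls\<close>
  lists the row indices.\<close>

definition matrix_with_rows ::
    "('a \<Rightarrow> real vec) \<Rightarrow> 'a list \<Rightarrow> ('a set + 'a) list \<Rightarrow> real mat" where
  "matrix_with_rows p vs ls =
     mat (length ls) (3 * length vs) (\<lambda>(i, j). row_block p (ls ! i) (vs ! (j div 3)) $ (j mod 3))"

definition row_indices :: "'a list \<Rightarrow> 'a set list \<Rightarrow> ('a set + 'a) list" where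
  "row_indices vs es = map Inl es @ map Inr vs"

definition R_cyl :: "('a \<Rightarrow> real vec) \<Rightarrow> 'a list \<Rightarrow> 'a set list \<Rightarrow> real mat" where
  "R_cyl p vs es = matrix_with_rows p vs (row_indices vs es)"

definition R_free :: "('a \<Rightarrow> real vec) \<Rightarrow> 'a list \<Rightarrow> 'a set list \<Rightarrow> 'a \<Rightarrow> real mat" where
  "R_free p vs es v = matrix_with_rows p vs (remove1 (Inr v) (row_indices vs es))"

text \<open>The rank does not depend on the enumerations \<open>vs\<close> and \<open>es\<close> of the (finite) sets of
  vertices and edges; we require the equation for all of them.\<close>

definition free_infinitesimally_rigid ::
    "'a set \<Rightarrow> 'a set set \<Rightarrow> ('a \<Rightarrow> real vec) \<Rightarrow> 'a \<Rightarrow> bool" where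
  "free_infinitesimally_rigid V E p v \<longleftrightarrow>
     (\<forall>vs es. distinct vs \<longrightarrow> set vs = V \<longrightarrow> distinct es \<longrightarrow> set es = E \<longrightarrow>
        vec_space.rank (dim_row (R_free p vs es v)) (R_free p vs es v) = 3 * card V - 2)"

end

theory Submission
  imports Defs
begin

text \<open>In angular and vertical velocities a bar \<open>xy\<close> imposes one linear condition with coefficients
  \<open>sin (\<theta>\<^sub>x - \<theta>\<^sub>y)\<close> and \<open>z\<^sub>x - z\<^sub>y\<close>, and \<open>1 - cos (\<theta>\<^sub>x - \<theta>\<^sub>y)\<close> for the radial velocity of \<open>v\<close>.
  We show that for generic positions these conditions are independent as soon as every nonempty
  vertex set \<open>X\<close> spans at most \<open>2 |X| - 2\<close> edges, plus one if \<open>v \<in> X\<close>; a circuit has this property.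
  To make an induction possible, edges with coefficients of their own are admitted as well.
  Some vertex \<open>u\<close> has degree at most 3 (at most 2 if \<open>u = v\<close>). If the degree is 3, uniting tight sets
  shows that the graph without \<open>u\<close> stays sparse after adding a suitable edge between two neighbours
  of \<open>u\<close>, so without that edge it has a motion that is not trivial on the neighbours. Such a
  motion extends to \<open>u\<close> only for special positions of \<open>u\<close>.

  Generic points enter through the parametrization \<open>s = tan (\<theta> / 2)\<close>: by the transcendence degree
  no nonzero rational polynomial vanishes at the parameters \<open>(s, z)\<close> of a generic framework.\<close>


section \<open>Polynomial families of vectors\<close>

text \<open>For \<open>n\<close> vertices the matrix without the row of \<open>v\<close> has
  \<open>(2n - 1) + (n - 1) = 3n - 2\<close> rows, so the rank claim says exactly that its rows are
  independent. The extra edge granted to sets containing \<open>v\<close> reflects its third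
  velocity; the 2 that is always subtracted stands for the rotation about the axis and the
  translation along it. Independence is certified by a nonvanishing polynomial in the parameters.
  Hence one good choice of parameters is enough at every step of the induction, finitely many such
  choices can be merged into one, and special positions may be used freely. The obstacle is the edge
  added between two neighbours: it may join vertices that already carry a bar, and a second bar
  there would repeat the same row. Edges with coefficients of their own avoid this. One case still
  needs another source for the motion: if all three edges at \<open>u\<close> end at
  \<open>v\<close>, there is no pair of neighbours to join, and the radial velocity of
  \<open>v\<close> takes over.\<close>

lemma many_vectors_dependent:
  fixes M :: "'j \<Rightarrow> 'k \<Rightarrow> 'f::field"
  assumes "finite K" "finite J" "card K < card J"
  shows "\<exists>c. (\<exists>j\<in>J. c j \<noteq> 0) \<and> (\<forall>k\<in>K. (\<Sum>j\<in>J. c j * M j k) = 0)"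
  using assms
proof (induction K arbitrary: J M rule: finite_induct)
  case empty
  then have "J \<noteq> {}" by auto
  then show ?case by (intro exI[of _ "\<lambda>_. 1"]) auto
next
  case (insert k K)
  show ?case
  proof (cases "\<forall>j\<in>J. M j k = 0")
    case True
    from insert obtain c where "\<exists>j\<in>J. c j \<noteq> 0" "\<forall>k\<in>K. (\<Sum>j\<in>J. c j * M j k) = 0"
      by (metis card_insert_disjoint Suc_lessD)
    with True show ?thesis by (intro exI[of _ c]) auto
  next
    case False
    then obtain l where l: "l \<in> J" "M l k \<noteq> 0" by blast
    define J' where "J' = J - {l}"
    \<comment> \<open>Eliminates coordinate \<open>k\<close> with the pivot \<open>l\<close>; the
      coefficient of \<open>l\<close> is recovered afterwards from the equation at
      \<open>k\<close>.\<close>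
    define M' where "M' j i = M j i - M j k / M l k * M l i" for j i
    have "card K < card J'" "finite J'"
      using insert l by (auto simp: J'_def)
    from insert.IH[OF this(2,1), of M'] obtain c where
      c: "\<exists>j\<in>J'. c j \<noteq> 0" "\<forall>i\<in>K. (\<Sum>j\<in>J'. c j * M' j i) = 0" by blast
    define t where "t = - (\<Sum>j\<in>J'. c j * M j k / M l k)"
    define d where "d = c(l := t)"
    have sum_d: "(\<Sum>j\<in>J. d j * M j i) = t * M l i + (\<Sum>j\<in>J'. c j * M j i)" for i
    proof -
      have "(\<Sum>j\<in>J. d j * M j i) = d l * M l i + (\<Sum>j\<in>J'. d j * M j i)"
        unfolding J'_def using l insert.prems by (intro sum.remove) auto
      also have "(\<Sum>j\<in>J'. d j * M j i) = (\<Sum>j\<in>J'. c j * M j i)"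
        by (intro sum.cong) (auto simp: d_def J'_def)
      finally show ?thesis by (simp add: d_def)
    qed
    have "(\<Sum>j\<in>J. d j * M j i) = 0" if "i \<in> insert k K" for i
    proof (cases "i = k")
      case True
      have "t * M l k = - (\<Sum>j\<in>J'. c j * M j k)"
        using l by (simp add: t_def sum_distrib_right)
      then show ?thesis using True by (simp add: sum_d)
    next
      case False
      with that have "(\<Sum>j\<in>J'. c j * M' j i) = 0" using c(2) by auto
      moreover have "(\<Sum>j\<in>J'. c j * M' j i) = (\<Sum>j\<in>J'. c j * M j i) + t * M l i"
        by (simp add: M'_def t_def algebra_simps sum_subtractf sum_distrib_left)
      ultimately show ?thesis using sum_d[of i] by (simp add: add.commute)
    qed
    moreover have "\<exists>j\<in>J. d j \<noteq> 0"
      using c(1) by (auto simp: d_def J'_def)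
    ultimately show ?thesis by blast
  qed
qed

section \<open>Rational polynomial functions of real parameters\<close>

inductive rat_polyfun :: "'i set \<Rightarrow> (('i \<Rightarrow> real) \<Rightarrow> real) \<Rightarrow> bool" for I where
  const: "rat_polyfun I (\<lambda>_. of_rat r)"
| var: "i \<in> I \<Longrightarrow> rat_polyfun I (\<lambda>Q. Q i)"
| add: "rat_polyfun I f \<Longrightarrow> rat_polyfun I g \<Longrightarrow> rat_polyfun I (\<lambda>Q. f Q + g Q)"
| mult: "rat_polyfun I f \<Longrightarrow> rat_polyfun I g \<Longrightarrow> rat_polyfun I (\<lambda>Q. f Q * g Q)"

named_theorems rpf

lemmas [rpf] = rat_polyfun.intros

lemma rat_polyfun_numerals [rpf]:
  "rat_polyfun I (\<lambda>_. 0)" "rat_polyfun I (\<lambda>_. 1)" "rat_polyfun I (\<lambda>_. numeral n)"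
  "rat_polyfun I (\<lambda>_. - 1)"
  using rat_polyfun.const[of I 0] rat_polyfun.const[of I 1]
    rat_polyfun.const[of I "numeral n"] rat_polyfun.const[of I "- 1"]
  by (simp_all add: of_rat_minus)

lemma rat_polyfun_uminus [rpf]: "rat_polyfun I f \<Longrightarrow> rat_polyfun I (\<lambda>Q. - f Q)"
  using rat_polyfun.mult[OF rat_polyfun_numerals(4), of I f] by simp

lemma rat_polyfun_diff [rpf]:
  "rat_polyfun I f \<Longrightarrow> rat_polyfun I g \<Longrightarrow> rat_polyfun I (\<lambda>Q. f Q - g Q)"
  using rat_polyfun.add[OF _ rat_polyfun_uminus, of I f g] by simp

lemma rat_polyfun_power [rpf]: "rat_polyfun I f \<Longrightarrow> rat_polyfun I (\<lambda>Q. f Q ^ n)"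
  by (induction n) (auto intro: rpf)

lemma rat_polyfun_sum [rpf]:
  "(\<And>j. j \<in> J \<Longrightarrow> rat_polyfun I (f j)) \<Longrightarrow> rat_polyfun I (\<lambda>Q. \<Sum>j\<in>J. f j Q)"
  by (induction J rule: infinite_finite_induct) (auto intro: rpf)

lemma rat_polyfun_prod [rpf]:
  "(\<And>j. j \<in> J \<Longrightarrow> rat_polyfun I (f j)) \<Longrightarrow> rat_polyfun I (\<lambda>Q. \<Prod>j\<in>J. f j Q)"
  by (induction J rule: infinite_finite_induct) (auto intro: rpf)

lemma rat_polyfun_on_line:
  "rat_polyfun I f \<Longrightarrow> \<exists>q. \<forall>t. f (\<lambda>i. Q i + t * (R i - Q i)) = poly q t"
proof (induction rule: rat_polyfun.induct)
  case (const r)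
  show ?case by (intro exI[of _ "[:of_rat r:]"]) simp
next
  case (var i)
  show ?case by (intro exI[of _ "[:Q i, R i - Q i:]"]) simp
next
  case (add f g)
  then show ?case by (metis poly_add)
next
  case (mult f g)
  then show ?case by (metis poly_mult)
qed

text \<open>Restricted to the line through the two points both functions are nonzero polynomials
  in one variable, and so is their product.\<close>

lemma rat_polyfun_common_nonzero:
  assumes f: "rat_polyfun I f" "f Q \<noteq> 0" and g: "rat_polyfun J g" "g R \<noteq> 0"
  shows "\<exists>P. f P \<noteq> 0 \<and> g P \<noteq> 0"
proof -
  define L where "L t = (\<lambda>i. Q i + t * (R i - Q i))" for t
  obtain a b where a: "\<And>t. f (L t) = poly a t" and b: "\<And>t. g (L t) = poly b t"
    using rat_polyfun_on_line[OF f(1), of Q R] rat_polyfun_on_line[OF g(1), of Q R]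
    unfolding L_def by blast
  have "L 0 = Q" "L 1 = R" by (auto simp: L_def)
  then have "poly a 0 \<noteq> 0" "poly b 1 \<noteq> 0" using f g a b by metis+
  then have "a * b \<noteq> 0" by auto
  then obtain t where "poly (a * b) t \<noteq> 0" using poly_all_0_iff_0 by blast
  then show ?thesis using a b by (intro exI[of _ "L t"]) auto
qed

section \<open>Independent rows and their dual vectors\<close>

definition rows_indep :: "'e set \<Rightarrow> 'k set \<Rightarrow> ('e \<Rightarrow> 'k \<Rightarrow> real) \<Rightarrow> bool" where
  "rows_indep E K \<phi> \<longleftrightarrow>
     (\<forall>\<omega>. (\<forall>k\<in>K. (\<Sum>e\<in>E. \<omega> e * \<phi> e k) = 0) \<longrightarrow> (\<forall>e\<in>E. \<omega> e = 0))"

lemma rows_indep_subset: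
  assumes "rows_indep E K \<phi>" "F \<subseteq> E" "finite E"
  shows "rows_indep F K \<phi>"
  unfolding rows_indep_def
proof (intro allI impI ballI)
  fix \<omega> e assume \<omega>: "\<forall>k\<in>K. (\<Sum>e\<in>F. \<omega> e * \<phi> e k) = 0" and e: "e \<in> F"
  define \<omega>' where "\<omega>' e = (if e \<in> F then \<omega> e else 0)" for e
  have "(\<Sum>e\<in>E. \<omega>' e * \<phi> e k) = (\<Sum>e\<in>F. \<omega> e * \<phi> e k)" for k
    using assms(2,3) by (intro sum.mono_neutral_cong_right) (auto simp: \<omega>'_def)
  then have "\<omega>' e = 0" using assms(1,2) \<omega> e unfolding rows_indep_def by auto
  then show "\<omega> e = 0" using e by (simp add: \<omega>'_def)
qed

text \<open>Pairing a vanishing combination of the rows with \<open>N f\<close> leaves only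
  \<open>\<omega> f * D\<close>. The factor \<open>D\<close> is not normalized to 1, so that
  \<open>N\<close> can be polynomial.\<close>

lemma dual_family_imp_rows_indep:
  fixes \<phi> N :: "'e \<Rightarrow> 'k \<Rightarrow> real"
  assumes "finite E"
    and dual: "\<And>e e'. e \<in> E \<Longrightarrow> e' \<in> E \<Longrightarrow> (\<Sum>k\<in>K. \<phi> e k * N e' k) = (if e = e' then D else 0)"
    and "D \<noteq> 0"
  shows "rows_indep E K \<phi>"
  unfolding rows_indep_def
proof (intro allI impI ballI)
  fix \<omega> f assume \<omega>: "\<forall>k\<in>K. (\<Sum>e\<in>E. \<omega> e * \<phi> e k) = 0" and f: "f \<in> E"
  have "0 = (\<Sum>k\<in>K. (\<Sum>e\<in>E. \<omega> e * \<phi> e k) * N f k)" using \<omega> by simp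
  also have "\<dots> = (\<Sum>e\<in>E. \<omega> e * (\<Sum>k\<in>K. \<phi> e k * N f k))"
    unfolding sum_distrib_left sum_distrib_right by (subst sum.swap) (simp add: mult_ac)
  also have "\<dots> = (\<Sum>e\<in>E. if e = f then \<omega> e * D else 0)"
    using dual f by (intro sum.cong) auto
  also have "\<dots> = \<omega> f * D" using assms(1) f by simp
  finally show "\<omega> f = 0" using \<open>D \<noteq> 0\<close> by simp
qed

text \<open>Gaussian elimination with parameters, without division.\<close>

lemma polynomial_dual_family:
  fixes \<phi> :: "('i \<Rightarrow> real) \<Rightarrow> 'e \<Rightarrow> 'k \<Rightarrow> real"
  assumes "finite E" "finite K"
    and "\<And>e k. e \<in> E \<Longrightarrow> k \<in> K \<Longrightarrow> rat_polyfun I (\<lambda>Q. \<phi> Q e k)"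
    and "rows_indep E K (\<phi> Q0)"
  shows "\<exists>D N. rat_polyfun I D \<and> (\<forall>e\<in>E. \<forall>k\<in>K. rat_polyfun I (N e k)) \<and> D Q0 \<noteq> 0 \<and>
    (\<forall>Q. \<forall>e\<in>E. \<forall>e'\<in>E. (\<Sum>k\<in>K. \<phi> Q e k * N e' k Q) = (if e = e' then D Q else 0))"
  using assms(1,3,4)
proof (induction E rule: finite_induct)
  case empty
  show ?case by (intro exI[of _ "\<lambda>_. 1"] exI) (auto intro: rpf)
next
  case (insert f E)
  have "rows_indep E K (\<phi> Q0)"
    using rows_indep_subset[OF insert.prems(2)] insert.hyps by auto
  then have "\<exists>D N. rat_polyfun I D \<and> (\<forall>e\<in>E. \<forall>k\<in>K. rat_polyfun I (N e k)) \<and> D Q0 \<noteq> 0 \<and>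
    (\<forall>Q. \<forall>e\<in>E. \<forall>e'\<in>E. (\<Sum>k\<in>K. \<phi> Q e k * N e' k Q) = (if e = e' then D Q else 0))"
    by (intro insert.IH insert.prems(1)) auto
  then obtain D N where D: "rat_polyfun I D" "D Q0 \<noteq> 0"
    and N: "\<And>e k. e \<in> E \<Longrightarrow> k \<in> K \<Longrightarrow> rat_polyfun I (N e k)"
    and dual: "\<And>Q e e'. e \<in> E \<Longrightarrow> e' \<in> E \<Longrightarrow>
      (\<Sum>k\<in>K. \<phi> Q e k * N e' k Q) = (if e = e' then D Q else 0)"
    by blast
  define ip where "ip Q e g = (\<Sum>k\<in>K. \<phi> Q e k * g k)" for Q e and g :: "'k \<Rightarrow> real"
  \<comment> \<open>\<open>w k\<close> is \<open>D\<close> times the \<open>k\<close>-th unit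
    vector, corrected by the old dual vectors so that every row of \<open>E\<close> annihilates
    it.\<close>
  define w where
    "w k l Q = (if k = l then D Q else 0) - (\<Sum>e\<in>E. \<phi> Q e k * N e l Q)" for k l Q
  have ip_w: "ip Q e (\<lambda>l. w k l Q) = D Q * \<phi> Q e k - (\<Sum>e'\<in>E. \<phi> Q e' k * ip Q e (\<lambda>l. N e' l Q))"
    if k: "k \<in> K" for Q e k
  proof -
    have "ip Q e (\<lambda>l. w k l Q) = (\<Sum>l\<in>K. if k = l then \<phi> Q e l * D Q else 0)
        - (\<Sum>l\<in>K. \<Sum>e'\<in>E. \<phi> Q e l * (\<phi> Q e' k * N e' l Q))"
      unfolding ip_def w_def sum_subtractf[symmetric]
      by (intro sum.cong) (auto simp: right_diff_distrib sum_distrib_left)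
    also have "(\<Sum>l\<in>K. if k = l then \<phi> Q e l * D Q else 0) = D Q * \<phi> Q e k"
      using k \<open>finite K\<close> by simp
    also have "(\<Sum>l\<in>K. \<Sum>e'\<in>E. \<phi> Q e l * (\<phi> Q e' k * N e' l Q))
        = (\<Sum>e'\<in>E. \<phi> Q e' k * ip Q e (\<lambda>l. N e' l Q))"
      unfolding ip_def sum_distrib_left by (subst sum.swap) (simp add: mult_ac)
    finally show ?thesis .
  qed
  have ip_w_E: "ip Q e (\<lambda>l. w k l Q) = 0" if "k \<in> K" "e \<in> E" for Q e k
  proof -
    have "(\<Sum>e'\<in>E. \<phi> Q e' k * ip Q e (\<lambda>l. N e' l Q)) = (\<Sum>e'\<in>E. if e = e' then \<phi> Q e' k * D Q else 0)"
      using dual that by (intro sum.cong) (auto simp: ip_def)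
    then show ?thesis using ip_w that insert.hyps by simp
  qed
  \<comment> \<open>Otherwise \<open>D\<close> times row \<open>f\<close> would be a combination of
    the rows of \<open>E\<close> at \<open>Q0\<close>. Only the choice of \<open>k\<close> depends
    on \<open>Q0\<close>; the identities hold for every \<open>Q\<close>.\<close>
  have "\<exists>k\<in>K. ip Q0 f (\<lambda>l. w k l Q0) \<noteq> 0"
  proof (rule ccontr)
    assume "\<not> ?thesis"
    then have 0: "D Q0 * \<phi> Q0 f k = (\<Sum>e\<in>E. \<phi> Q0 e k * ip Q0 f (\<lambda>l. N e l Q0))" if "k \<in> K" for k
      using ip_w that by auto
    define \<omega> where "\<omega> e = (if e = f then D Q0 else - ip Q0 f (\<lambda>l. N e l Q0))" for e
    have "(\<Sum>e\<in>insert f E. \<omega> e * \<phi> Q0 e k) = 0" if "k \<in> K" for k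
    proof -
      have "(\<Sum>e\<in>E. \<omega> e * \<phi> Q0 e k) = - (\<Sum>e\<in>E. \<phi> Q0 e k * ip Q0 f (\<lambda>l. N e l Q0))"
        unfolding sum_negf[symmetric] using insert.hyps
        by (intro sum.cong) (auto simp: \<omega>_def)
      then show ?thesis using 0[OF that] insert.hyps by (simp add: \<omega>_def)
    qed
    then have "\<omega> f = 0" using insert.prems(2) unfolding rows_indep_def by blast
    then show False using D by (simp add: \<omega>_def)
  qed
  then obtain k where k: "k \<in> K" "ip Q0 f (\<lambda>l. w k l Q0) \<noteq> 0" by blast
  define D' where "D' Q = ip Q f (\<lambda>l. w k l Q)" for Q
  \<comment> \<open>Up to the factor \<open>D\<close>, \<open>w k\<close> is the dual vector of
    \<open>f\<close>; multiples of it correct the old dual vectors until \<open>f\<close>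
    annihilates them. The common value becomes \<open>D * D'\<close>.\<close>
  define N' where "N' e l Q = (if e = f then D Q * w k l Q
      else D' Q * N e l Q - ip Q f (\<lambda>l. N e l Q) * w k l Q)" for e l Q
  have rp_w: "rat_polyfun I (w k l)" if "l \<in> K" for l
  proof -
    have "rat_polyfun I (\<lambda>Q. if k = l then D Q else 0)"
      using D by (cases "k = l") (auto intro: rpf)
    then show ?thesis unfolding w_def using that k N insert.prems(1) by (auto intro!: rpf)
  qed
  then have rp_D': "rat_polyfun I D'"
    unfolding D'_def ip_def using insert.prems(1) by (auto intro!: rpf)
  have rp_N': "rat_polyfun I (N' e l)" if "e \<in> insert f E" "l \<in> K" for e l
  proof (cases "e = f")
    case True
    then show ?thesis unfolding N'_def using D rp_w that by (auto intro!: rpf)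
  next
    case False
    then show ?thesis unfolding N'_def ip_def using rp_D' rp_w that N insert.prems(1)
      by (auto intro!: rpf)
  qed
  have ip_N'_f: "ip Q e (\<lambda>l. N' f l Q) = D Q * ip Q e (\<lambda>l. w k l Q)" for Q e
    by (simp add: N'_def ip_def sum_distrib_left mult_ac)
  have ip_N': "ip Q e (\<lambda>l. N' e' l Q)
      = D' Q * ip Q e (\<lambda>l. N e' l Q) - ip Q f (\<lambda>l. N e' l Q) * ip Q e (\<lambda>l. w k l Q)"
    if "e' \<noteq> f" for Q e e'
    using that unfolding N'_def ip_def
    by (simp add: sum_distrib_left sum_subtractf algebra_simps)
  have "ip Q e (\<lambda>l. N' e' l Q) = (if e = e' then D Q * D' Q else 0)"
    if e: "e \<in> insert f E" "e' \<in> insert f E" for Q e e'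
  proof (cases "e' = f")
    case True
    then show ?thesis using ip_N'_f ip_w_E[OF k(1)] e by (auto simp: D'_def)
  next
    case False
    then have "e' \<in> E" using e by auto
    then show ?thesis using False ip_N'[OF False] ip_w_E[OF k(1)] dual e
      by (cases "e = f") (auto simp: D'_def ip_def)
  qed
  then have "\<forall>Q. \<forall>e\<in>insert f E. \<forall>e'\<in>insert f E.
      (\<Sum>k\<in>K. \<phi> Q e k * N' e' k Q) = (if e = e' then D Q * D' Q else 0)"
    by (simp add: ip_def)
  moreover have "rat_polyfun I (\<lambda>Q. D Q * D' Q)"
    using D(1) rp_D' by (rule rat_polyfun.mult)
  moreover have "D Q0 * D' Q0 \<noteq> 0"
    using D(2) k(2) by (simp add: D'_def)
  ultimately show ?case
    using rp_N' by (intro exI[of _ "\<lambda>Q. D Q * D' Q"] exI[of _ N'] conjI) blast+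
qed

text \<open>\<open>D\<close> plays the part of a maximal minor that is nonzero at
  \<open>Q0\<close>.\<close>

lemma rows_indep_open:
  fixes \<phi> :: "('i \<Rightarrow> real) \<Rightarrow> 'e \<Rightarrow> 'k \<Rightarrow> real"
  assumes "finite E" "finite K"
    and "\<And>e k. e \<in> E \<Longrightarrow> k \<in> K \<Longrightarrow> rat_polyfun I (\<lambda>Q. \<phi> Q e k)"
    and "rows_indep E K (\<phi> Q0)"
  shows "\<exists>D. rat_polyfun I D \<and> D Q0 \<noteq> 0 \<and> (\<forall>Q. D Q \<noteq> 0 \<longrightarrow> rows_indep E K (\<phi> Q))"
proof -
  obtain D N where "rat_polyfun I D" "D Q0 \<noteq> 0"
    and "\<forall>Q. \<forall>e\<in>E. \<forall>e'\<in>E. (\<Sum>k\<in>K. \<phi> Q e k * N e' k Q) = (if e = e' then D Q else 0)"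
    using polynomial_dual_family[of E K I \<phi>, OF assms] by blast
  moreover from this(3) have "rows_indep E K (\<phi> Q)" if "D Q \<noteq> 0" for Q
    using that by (intro dual_family_imp_rows_indep[OF assms(1), where N = "\<lambda>e k. N e k Q" and D = "D Q"]) auto
  ultimately show ?thesis by blast
qed

text \<open>With its entries taken as variables, any real matrix is a value of a polynomial family;
  dividing by \<open>D\<close> at that point gives a true dual vector.\<close>

lemma rows_indep_dual_vector:
  fixes \<phi> :: "'e \<Rightarrow> 'k \<Rightarrow> real"
  assumes "finite E" "finite K" "rows_indep E K \<phi>" "f \<in> E"
  shows "\<exists>m. \<forall>e\<in>E. (\<Sum>k\<in>K. \<phi> e k * m k) = (if e = f then 1 else 0)"
proof -
  define \<psi> :: "('k \<times> 'e \<Rightarrow> real) \<Rightarrow> 'e \<Rightarrow> 'k \<Rightarrow> real" where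
    "\<psi> Q e k = Q (k, e)" for Q e k
  define Q0 where "Q0 = (\<lambda>(k, e). \<phi> e k)"
  have \<psi>: "\<psi> Q0 = \<phi>" by (auto simp: \<psi>_def Q0_def fun_eq_iff)
  have "\<exists>D N. rat_polyfun UNIV D \<and> (\<forall>e\<in>E. \<forall>k\<in>K. rat_polyfun UNIV (N e k)) \<and> D Q0 \<noteq> 0 \<and>
    (\<forall>Q. \<forall>e\<in>E. \<forall>e'\<in>E. (\<Sum>k\<in>K. \<psi> Q e k * N e' k Q) = (if e = e' then D Q else 0))"
    using assms \<psi> by (intro polynomial_dual_family) (auto intro: rpf simp: \<psi>_def)
  then obtain D N where D: "D Q0 \<noteq> (0::real)" and
    N: "\<forall>e\<in>E. \<forall>e'\<in>E. (\<Sum>k\<in>K. \<phi> e k * N e' k Q0) = (if e = e' then D Q0 else 0)"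
    using \<psi> by metis
  have "(\<Sum>k\<in>K. \<phi> e k * (N f k Q0 / D Q0)) = (if e = f then 1 else 0)" if "e \<in> E" for e
  proof -
    have "(\<Sum>k\<in>K. \<phi> e k * (N f k Q0 / D Q0)) = (\<Sum>k\<in>K. \<phi> e k * N f k Q0) / D Q0"
      by (simp add: sum_divide_distrib)
    then show ?thesis using N that assms(4) D by simp
  qed
  then show ?thesis by (intro exI[of _ "\<lambda>k. N f k Q0 / D Q0"]) blast
qed

section \<open>Placing a vertex of degree three\<close>

definition det3 :: "real \<Rightarrow> real \<Rightarrow> real \<Rightarrow> real \<Rightarrow> real \<Rightarrow> real \<Rightarrow> real \<Rightarrow> real \<Rightarrow> real \<Rightarrow> real" where
  "det3 a1 b1 c1 a2 b2 c2 a3 b3 c3 =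
     a1 * (b2 * c3 - b3 * c2) - b1 * (a2 * c3 - a3 * c2) + c1 * (a2 * b3 - a3 * b2)"

text \<open>Cramer's rule: cofactors combine the three equations into \<open>det3\<close> times one
  unknown.\<close>

lemma det3_left_kernel:
  assumes "det3 a1 b1 c1 a2 b2 c2 a3 b3 c3 \<noteq> 0"
    and "w1 * a1 + w2 * a2 + w3 * a3 = 0" "w1 * b1 + w2 * b2 + w3 * b3 = 0"
      "w1 * c1 + w2 * c2 + w3 * c3 = 0"
  shows "w1 = 0 \<and> w2 = 0 \<and> w3 = 0"
proof -
  let ?D = "det3 a1 b1 c1 a2 b2 c2 a3 b3 c3"
  let ?a = "w1 * a1 + w2 * a2 + w3 * a3" and ?b = "w1 * b1 + w2 * b2 + w3 * b3"
    and ?c = "w1 * c1 + w2 * c2 + w3 * c3"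
  have "w1 * ?D = (b2 * c3 - b3 * c2) * ?a - (a2 * c3 - a3 * c2) * ?b + (a2 * b3 - a3 * b2) * ?c"
    "w2 * ?D = - (b1 * c3 - b3 * c1) * ?a + (a1 * c3 - a3 * c1) * ?b - (a1 * b3 - a3 * b1) * ?c"
    "w3 * ?D = (b1 * c2 - b2 * c1) * ?a - (a1 * c2 - a2 * c1) * ?b + (a1 * b2 - a2 * b1) * ?c"
    unfolding det3_def by (simp_all add: algebra_simps)
  then have "w1 * ?D = 0" "w2 * ?D = 0" "w3 * ?D = 0"
    unfolding assms(2-4) by simp_all
  then show ?thesis using assms(1) by simp
qed

lemma det3_swap:
  "det3 a2 b2 c2 a1 b1 c1 a3 b3 c3 = - det3 a1 b1 c1 a2 b2 c2 a3 b3 c3"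
  "det3 a1 b1 c1 a3 b3 c3 a2 b2 c2 = - det3 a1 b1 c1 a2 b2 c2 a3 b3 c3"
  unfolding det3_def by (simp_all add: algebra_simps)

text \<open>With \<open>s = tan (\<theta> / 2)\<close> and \<open>t = tan (\<theta>' / 2)\<close> these are, up to the positive factor
  \<open>(1 + s\<^sup>2) (1 + t\<^sup>2)\<close>, the coefficients \<open>sin (\<theta> - \<theta>')\<close>, \<open>z - y\<close> and \<open>1 - cos (\<theta> - \<theta>')\<close> of the
  bar between the points with parameters \<open>(s, z)\<close> and \<open>(t, y)\<close>.\<close>

definition bar_coeff :: "real \<Rightarrow> real \<Rightarrow> real \<Rightarrow> real \<Rightarrow> nat \<Rightarrow> real" where
  "bar_coeff s z t y j = (if j = 0 then 2 * (s - t) * (1 + s * t)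
     else if j = 1 then (z - y) * (1 + s\<^sup>2) * (1 + t\<^sup>2) else 2 * (s - t)\<^sup>2)"

lemma bar_coeff_simps [simp]:
  "bar_coeff s z t y 0 = 2 * (s - t) * (1 + s * t)"
  "bar_coeff s z t y (Suc 0) = (z - y) * (1 + s\<^sup>2) * (1 + t\<^sup>2)"
  "bar_coeff s z t y 2 = 2 * (s - t)\<^sup>2"
  by (auto simp: bar_coeff_def)

lemma one_plus_square_pos: "1 + (s::real)\<^sup>2 > 0"
  by (smt (verit) zero_le_power2)

text \<open>At \<open>x = s i\<close> the row of the \<open>i\<close>-th bar degenerates to a multiple of \<open>(0, 1, b i)\<close>, which gives
  one linear equation in \<open>y\<close> for each \<open>i\<close>.\<close>

lemma three_bars:
  fixes s z a b :: "nat \<Rightarrow> real" and c :: real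
  defines "A i x y \<equiv> bar_coeff x y (s i) (z i) 0"
  defines "B i x y \<equiv> bar_coeff x y (s i) (z i) 1"
  defines "X i x y \<equiv> A i x y * a i + B i x y * b i -
    (if i = 1 then bar_coeff x y (s i) (z i) 2 * c else 0)"
  assumes dist: "s 1 \<noteq> s 2" "s 1 \<noteq> s 3" "s 2 \<noteq> s 3"
    "1 + s 1 * s 2 \<noteq> 0" "1 + s 1 * s 3 \<noteq> 0" "1 + s 2 * s 3 \<noteq> 0"
    and zero: "\<And>x y. det3 (A 1 x y) (B 1 x y) (X 1 x y) (A 2 x y) (B 2 x y) (X 2 x y)
      (A 3 x y) (B 3 x y) (X 3 x y) = 0"
  shows "a 1 = a 2 \<and> a 2 = a 3 \<and> b 1 = b 2 \<and> b 2 = b 3 \<and> c = 0"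
proof -
  define q where "q i = 1 + (s i)\<^sup>2" for i
  define A' where "A' i j = 2 * (s i - s j) * (1 + s i * s j)" for i j
  have q: "q i > 0" for i using one_plus_square_pos by (simp add: q_def)
  have A: "A i (s j) y = A' j i" for i j y by (simp add: A_def A'_def)
  have A'0: "A' i i = 0" for i by (simp add: A'_def)
  have A'_anti: "A' j i = - A' i j" for i j by (simp add: A'_def algebra_simps)
  have B: "B i (s j) y = (y - z i) * q j * q i" for i j y by (simp add: B_def q_def)
  have X: "X i (s j) y = A' j i * a i + (y - z i) * q j * q i * b i -
      (if i = 1 then 2 * (s j - s i)\<^sup>2 * c else 0)" for i j y
    unfolding X_def A B by simp
  \<comment> \<open>\<open>1 + s i * s j = 0\<close> means that the two points lie at opposite
    angles, where the angular coefficient vanishes as well.\<close>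
  have nz: "A' 1 2 \<noteq> 0" "A' 1 3 \<noteq> 0" "A' 2 3 \<noteq> 0"
    using dist by (auto simp: A'_def)
  \<comment> \<open>Subtracting \<open>e\<close> times the second column from the third leaves only
    \<open>B1\<close> in the first row.\<close>
  have D1: "A2 * (X3 - B3 * e) = A3 * (X2 - B2 * e)"
    if "det3 0 B1 (B1 * e) A2 B2 X2 A3 B3 X3 = 0" "B1 \<noteq> 0" for B1 e A2 B2 X2 A3 B3 X3
  proof -
    have "det3 0 B1 (B1 * e) A2 B2 X2 A3 B3 X3
      = - B1 * (A2 * (X3 - B3 * e) - A3 * (X2 - B2 * e))"
      unfolding det3_def by (simp add: algebra_simps)
    then show ?thesis using that by simp
  qed
  have F1: "A' 1 2 * (A' 1 3 * a 3 + (y - z 3) * q 1 * q 3 * (b 3 - b 1))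
      = A' 1 3 * (A' 1 2 * a 2 + (y - z 2) * q 1 * q 2 * (b 2 - b 1))" if "y \<noteq> z 1" for y
  proof -
    have "det3 0 ((y - z 1) * q 1 * q 1) ((y - z 1) * q 1 * q 1 * b 1)
        (A' 1 2) ((y - z 2) * q 1 * q 2) (A' 1 2 * a 2 + (y - z 2) * q 1 * q 2 * b 2)
        (A' 1 3) ((y - z 3) * q 1 * q 3) (A' 1 3 * a 3 + (y - z 3) * q 1 * q 3 * b 3) = 0"
      using zero[of "s 1" y] unfolding A B X by (simp add: A'0)
    from D1[OF this] show ?thesis using that q[of 1] by (simp add: algebra_simps)
  qed
  have F2: "A' 2 1 * (A' 2 3 * a 3 + (y - z 3) * q 2 * q 3 * (b 3 - b 2))
      = A' 2 3 * (A' 2 1 * a 1 - 2 * (s 2 - s 1)\<^sup>2 * c + (y - z 1) * q 2 * q 1 * (b 1 - b 2))"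
    if "y \<noteq> z 2" for y
  proof -
    have "det3 0 ((y - z 2) * q 2 * q 2) ((y - z 2) * q 2 * q 2 * b 2)
        (A' 2 1) ((y - z 1) * q 2 * q 1)
        (A' 2 1 * a 1 + (y - z 1) * q 2 * q 1 * b 1 - 2 * (s 2 - s 1)\<^sup>2 * c)
        (A' 2 3) ((y - z 3) * q 2 * q 3) (A' 2 3 * a 3 + (y - z 3) * q 2 * q 3 * b 3) = 0"
      using zero[of "s 2" y] unfolding A B X by (subst det3_swap) (simp add: A'0)
    from D1[OF this] show ?thesis using that q[of 2] by (simp add: algebra_simps)
  qed
  have F3: "A' 3 1 * (A' 3 2 * a 2 + (y - z 2) * q 3 * q 2 * (b 2 - b 3))
      = A' 3 2 * (A' 3 1 * a 1 - 2 * (s 3 - s 1)\<^sup>2 * c + (y - z 1) * q 3 * q 1 * (b 1 - b 3))"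
    if "y \<noteq> z 3" for y
  proof -
    have "det3 0 ((y - z 3) * q 3 * q 3) ((y - z 3) * q 3 * q 3 * b 3)
        (A' 3 1) ((y - z 1) * q 3 * q 1)
        (A' 3 1 * a 1 + (y - z 1) * q 3 * q 1 * b 1 - 2 * (s 3 - s 1)\<^sup>2 * c)
        (A' 3 2) ((y - z 2) * q 3 * q 2) (A' 3 2 * a 2 + (y - z 2) * q 3 * q 2 * b 2) = 0"
      using zero[of "s 3" y] unfolding A B X by (subst det3_swap(1), subst det3_swap(2)) (simp add: A'0 det3_def algebra_simps)
    from D1[OF this] show ?thesis using that q[of 3] by (simp add: algebra_simps)
  qed
  \<comment> \<open>Both sides of \<open>F1\<close> are affine in \<open>y\<close>; comparing two
    heights other than \<open>z 1\<close> isolates the slopes, which involve only the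
    \<open>b i\<close>.\<close>
  have "q 1 * (A' 1 2 * q 3 * (b 3 - b 1)) = q 1 * (A' 1 3 * q 2 * (b 2 - b 1))"
    using F1[of "z 1 + 1"] F1[of "z 1 + 2"] by (simp add: algebra_simps)
  then have G1: "A' 1 2 * q 3 * (b 3 - b 1) = A' 1 3 * q 2 * (b 2 - b 1)"
    using q[of 1] by simp
  have "q 2 * (A' 2 1 * q 3 * (b 3 - b 2)) = q 2 * (A' 2 3 * q 1 * (b 1 - b 2))"
    using F2[of "z 2 + 1"] F2[of "z 2 + 2"] by (simp add: algebra_simps)
  then have "A' 2 1 * q 3 * (b 3 - b 2) = A' 2 3 * q 1 * (b 1 - b 2)"
    using q[of 2] by (metis less_irrefl mult_left_cancel)
  then have G2: "A' 1 2 * q 3 * (b 3 - b 2) = A' 2 3 * q 1 * (b 2 - b 1)"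
    unfolding A'_anti[of 2 1] by (simp add: algebra_simps)
  have "(A' 1 2 * q 3 + A' 2 3 * q 1 - A' 1 3 * q 2) * (b 2 - b 1) = 0"
    using G1 G2 by (simp add: algebra_simps)
  \<comment> \<open>A Vandermonde product, nonzero because the three parameters differ.\<close>
  moreover have "A' 1 2 * q 3 + A' 2 3 * q 1 - A' 1 3 * q 2
      = 4 * (s 1 - s 2) * (s 2 - s 3) * (s 1 - s 3)"
    unfolding A'_def q_def by (simp add: power2_eq_square algebra_simps)
  moreover have "4 * (s 1 - s 2) * (s 2 - s 3) * (s 1 - s 3) \<noteq> 0" using dist by simp
  ultimately have b12: "b 2 = b 1" by (metis eq_iff_diff_eq_0 mult_eq_0_iff)
  then have b13: "b 3 = b 1" using G1 nz q[of 3] by simp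
  have a23: "a 3 = a 2" using F1[of "z 1 + 1"] b12 b13 nz by simp
  have "A' 2 3 * (A' 2 1 * (a 3 - a 1) + 2 * (s 2 - s 1)\<^sup>2 * c) = 0"
    using F2[of "z 2 + 1"] b12 b13 by (simp add: algebra_simps)
  then have "A' 2 1 * (a 3 - a 1) + 2 * (s 2 - s 1)\<^sup>2 * c = 0" using nz by simp
  then have "(s 2 - s 1) * ((1 + s 2 * s 1) * (a 3 - a 1) + (s 2 - s 1) * c) = 0"
    unfolding A'_def by (simp add: power2_eq_square algebra_simps)
  then have H2: "(1 + s 2 * s 1) * (a 3 - a 1) + (s 2 - s 1) * c = 0" using dist by simp
  have "A' 3 2 * (A' 3 1 * (a 2 - a 1) + 2 * (s 3 - s 1)\<^sup>2 * c) = 0"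
    using F3[of "z 3 + 1"] b12 b13 by (simp add: algebra_simps)
  then have "A' 3 1 * (a 2 - a 1) + 2 * (s 3 - s 1)\<^sup>2 * c = 0" using nz A'_anti[of 3 2] by simp
  then have "(s 3 - s 1) * ((1 + s 3 * s 1) * (a 2 - a 1) + (s 3 - s 1) * c) = 0"
    unfolding A'_def by (simp add: power2_eq_square algebra_simps)
  then have H3: "(1 + s 3 * s 1) * (a 2 - a 1) + (s 3 - s 1) * c = 0" using dist by simp
  \<comment> \<open>With \<open>a 2 = a 3\<close>, \<open>H2\<close> and \<open>H3\<close> are two
    linear equations in \<open>a 2 - a 1\<close> and \<open>c\<close>; this combination eliminates
    \<open>a 2 - a 1\<close>.\<close>
  have "(s 3 - s 2) * (1 + (s 1)\<^sup>2) * c =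
      (1 + s 2 * s 1) * ((1 + s 3 * s 1) * (a 2 - a 1) + (s 3 - s 1) * c)
      - (1 + s 3 * s 1) * ((1 + s 2 * s 1) * (a 3 - a 1) + (s 2 - s 1) * c)"
    unfolding a23 by (simp add: power2_eq_square algebra_simps)
  then have "(s 3 - s 2) * (1 + (s 1)\<^sup>2) * c = 0"
    using H2 H3 by simp
  then have c: "c = 0" using dist q[of 1] unfolding q_def by simp
  then have "a 3 = a 1" using H2 dist by (simp add: mult.commute)
  then show ?thesis using c a23 b12 b13 by simp
qed

text \<open>The strain that a motion vanishing at the first endpoint induces in an edge with coefficient
  triple \<open>\<tau>\<close> and second endpoint \<open>w\<close>, up to sign; the third coordinate of \<open>m\<close> counts only
  at \<open>v\<close>.\<close>

definition end_strain :: "'a \<Rightarrow> ('a \<times> nat \<Rightarrow> real) \<Rightarrow> 'a \<Rightarrow> (nat \<Rightarrow> real) \<Rightarrow> real" where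
  "end_strain v m w \<tau> =
     \<tau> 0 * m (w, 0) + \<tau> 1 * m (w, 1) - (if w = v then \<tau> 2 * m (v, 2) else 0)"

text \<open>A pair \<open>(w, free)\<close> stands for an edge from a new vertex to
  \<open>w\<close>; its coefficients are at will if \<open>free\<close> holds and those of a bar
  otherwise. The matrix is the linear system for the two velocities of the new vertex, augmented by
  the strain coming from \<open>m\<close>: a nonzero determinant means that \<open>m\<close> does
  not extend.\<close>

definition solvable ::
    "'a \<Rightarrow> ('a \<Rightarrow> real) \<Rightarrow> ('a \<Rightarrow> real) \<Rightarrow> ('a \<times> nat \<Rightarrow> real) \<Rightarrow> 'a \<times> bool \<Rightarrow> 'a \<times> bool \<Rightarrow> 'a \<times> bool \<Rightarrow> bool"
  where
  "solvable v S Z m d1 d2 d3 \<longleftrightarrow> (\<exists>s z \<tau>1 \<tau>2 \<tau>3.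
     (\<forall>(d, \<tau>)\<in>{(d1, \<tau>1), (d2, \<tau>2), (d3, \<tau>3)}.
        \<not> snd d \<longrightarrow> \<tau> = bar_coeff s z (S (fst d)) (Z (fst d))) \<and>
     det3 (\<tau>1 0) (\<tau>1 1) (end_strain v m (fst d1) \<tau>1)
       (\<tau>2 0) (\<tau>2 1) (end_strain v m (fst d2) \<tau>2)
       (\<tau>3 0) (\<tau>3 1) (end_strain v m (fst d3) \<tau>3) \<noteq> 0)"

lemma solvableI:
  assumes "det3 (\<tau>1 0) (\<tau>1 1) (end_strain v m w1 \<tau>1)
       (\<tau>2 0) (\<tau>2 1) (end_strain v m w2 \<tau>2)
       (\<tau>3 0) (\<tau>3 1) (end_strain v m w3 \<tau>3) \<noteq> 0"
    and "\<not> f1 \<Longrightarrow> \<tau>1 = bar_coeff s z (S w1) (Z w1)"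
    and "\<not> f2 \<Longrightarrow> \<tau>2 = bar_coeff s z (S w2) (Z w2)"
    and "\<not> f3 \<Longrightarrow> \<tau>3 = bar_coeff s z (S w3) (Z w3)"
  shows "solvable v S Z m (w1, f1) (w2, f2) (w3, f3)"
  unfolding solvable_def using assms
  by (intro exI[of _ s] exI[of _ z] exI[of _ \<tau>1] exI[of _ \<tau>2] exI[of _ \<tau>3]) auto

lemma solvable_swap12: "solvable v S Z m d1 d2 d3 \<Longrightarrow> solvable v S Z m d2 d1 d3"
  unfolding solvable_def by (subst det3_swap(1)) (simp add: insert_commute, blast)

lemma solvable_swap23: "solvable v S Z m d1 d2 d3 \<Longrightarrow> solvable v S Z m d1 d3 d2"
  unfolding solvable_def by (subst det3_swap(2)) (simp add: insert_commute, blast)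

text \<open>Of the three neighbours only \<open>w1\<close> may be \<open>v\<close>, as the radial
  term of \<open>three_bars\<close> belongs to the first bar.\<close>

lemma solvable_distinct:
  assumes "S w1 \<noteq> S w2" "S w1 \<noteq> S w3" "S w2 \<noteq> S w3"
    "1 + S w1 * S w2 \<noteq> 0" "1 + S w1 * S w3 \<noteq> 0" "1 + S w2 * S w3 \<noteq> 0"
    and "v \<noteq> w2" "v \<noteq> w3"
    and nontriv: "\<not> (\<forall>i\<le>1. m (w1, i) = m (w2, i) \<and> m (w2, i) = m (w3, i)) \<or> (v = w1 \<and> m (v, 2) \<noteq> 0)"
  shows "solvable v S Z m (w1, f1) (w2, f2) (w3, f3)"
proof -
  define w where "w i = (if i = 1 then w1 else if i = 2 then w2 else w3)" for i :: nat
  have w: "w 1 = w1" "w 2 = w2" "w 3 = w3" by (auto simp: w_def)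
  let ?\<tau> = "\<lambda>i s z. bar_coeff s z (S (w i)) (Z (w i))"
  have "\<exists>s z. det3 (?\<tau> 1 s z 0) (?\<tau> 1 s z 1) (end_strain v m w1 (?\<tau> 1 s z))
       (?\<tau> 2 s z 0) (?\<tau> 2 s z 1) (end_strain v m w2 (?\<tau> 2 s z))
       (?\<tau> 3 s z 0) (?\<tau> 3 s z 1) (end_strain v m w3 (?\<tau> 3 s z)) \<noteq> 0"
  proof (rule ccontr)
    assume 0: "\<not> ?thesis"
    have "m (w 1, 0) = m (w 2, 0) \<and> m (w 2, 0) = m (w 3, 0) \<and>
      m (w 1, 1) = m (w 2, 1) \<and> m (w 2, 1) = m (w 3, 1) \<and> (if v = w1 then m (v, 2) else 0) = 0"
      by (rule three_bars[where s = "\<lambda>i. S (w i)" and z = "\<lambda>i. Z (w i)"])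
        (use assms(1-8) 0 in \<open>auto simp: w(1)[unfolded One_nat_def] w(2,3) end_strain_def
          simp del: bar_coeff_simps\<close>)
    with nontriv show False
      by (auto simp: w(1)[unfolded One_nat_def] w(2,3) le_Suc_eq split: if_splits)
  qed
  then show ?thesis by (metis solvableI w)
qed

text \<open>Except when \<open>v = w\<close> moves radially, the free coefficients are chosen so
  that the two edges to \<open>w\<close> force the velocity of the new vertex to be that of
  \<open>w\<close>; what remains is the strain of the edge to \<open>y\<close>. The other two flags
  are arbitrary because a free edge may take the coefficients of a bar.\<close>

lemma solvable_double:
  assumes "S w \<noteq> S y" "1 + S w * S y \<noteq> 0"
    and nontriv: "\<not> (\<forall>i\<le>1. m (w, i) = m (y, i)) \<or> (v \<in> {w, y} \<and> m (v, 2) \<noteq> 0)"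
  shows "solvable v S Z m (w, True) (w, f2) (y, f3)"
proof (cases "v = w \<and> m (v, 2) \<noteq> 0")
  case True
  \<comment> \<open>The free edge reads off the radial velocity of \<open>v\<close> alone. Straight
    above \<open>w\<close> the bar to \<open>w\<close> has only a vertical coefficient, and the bar
    to \<open>y\<close> supplies the angular one.\<close>
  then show ?thesis using assms one_plus_square_pos[of "S w"]
    by (intro solvableI[where s = "S w" and z = "Z w + 1" and
        ?\<tau>1.0 = "\<lambda>j. if j < 2 then 0 else 1" and
        ?\<tau>2.0 = "bar_coeff (S w) (Z w + 1) (S w) (Z w)" and
        ?\<tau>3.0 = "bar_coeff (S w) (Z w + 1) (S y) (Z y)"])
      (auto simp: end_strain_def det3_def)
next
  case F: False
  define c where "c = (if v = y then m (v, 2) else 0)"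
  define D where "D s z = bar_coeff s z (S y) (Z y) 0 * (m (y, 0) - m (w, 0)) +
    bar_coeff s z (S y) (Z y) 1 * (m (y, 1) - m (w, 1)) - bar_coeff s z (S y) (Z y) 2 * c" for s z
  have "\<exists>s z. D s z \<noteq> 0 \<and> (bar_coeff s z (S w) (Z w) 0 \<noteq> 0 \<or> bar_coeff s z (S w) (Z w) 1 \<noteq> 0)"
  proof (cases "m (w, 1) = m (y, 1)")
    case False
    then show ?thesis using assms one_plus_square_pos[of "S y"]
      by (intro exI[of _ "S y"] exI[of _ "Z y + 1"])
        (auto simp: D_def mult.commute)
  next
    case True
    define \<delta> where "\<delta> = m (y, 0) - m (w, 0)"
    have D: "D s z = 2 * (s - S y) * ((1 + s * S y) * \<delta> - (s - S y) * c)" for s z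
      unfolding D_def \<delta>_def using True by (simp add: power2_eq_square algebra_simps)
    have "\<delta> \<noteq> 0 \<or> c \<noteq> 0"
      using nontriv F True by (auto simp: \<delta>_def c_def le_Suc_eq)
    \<comment> \<open>The last factor of \<open>D\<close> is affine in \<open>s\<close>, so two
      positions decide whether it vanishes identically; \<open>S y\<close> itself is avoided because
      there the factor \<open>s - S y\<close> is zero.\<close>
    moreover have "\<delta> = 0 \<and> c = 0" if "D (S y + 1) (Z w + 1) = 0" "D (S y + 2) (Z w + 1) = 0"
    proof -
      have 1: "(1 + (S y + 1) * S y) * \<delta> - c = 0" "(1 + (S y + 2) * S y) * \<delta> - 2 * c = 0"
        using that unfolding D by auto
      moreover have "(1 + (S y)\<^sup>2) * \<delta> =
          2 * ((1 + (S y + 1) * S y) * \<delta> - c) - ((1 + (S y + 2) * S y) * \<delta> - 2 * c)"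
        by (simp add: power2_eq_square algebra_simps)
      ultimately have "(1 + (S y)\<^sup>2) * \<delta> = 0" by simp
      then have "\<delta> = 0" using one_plus_square_pos[of "S y"] by auto
      with 1 show ?thesis by auto
    qed
    ultimately obtain s where s: "D s (Z w + 1) \<noteq> 0" by blast
    have "bar_coeff s (Z w + 1) (S w) (Z w) 1 \<noteq> 0"
      using one_plus_square_pos[of "S w"] one_plus_square_pos[of s] by auto
    with s show ?thesis by blast
  qed
  then obtain s z where sz: "D s z \<noteq> 0"
    "bar_coeff s z (S w) (Z w) 0 \<noteq> 0 \<or> bar_coeff s z (S w) (Z w) 1 \<noteq> 0" by blast
  let ?p = "bar_coeff s z (S w) (Z w)"
  \<comment> \<open>The last column is a combination of the first two, plus \<open>d\<close> in the
    last row. So the determinant is \<open>d\<close> times the minor of the first two rows, which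
    are orthogonal.\<close>
  have "det3 (- ?p 1) (?p 0) (- ?p 1 * a + ?p 0 * b) (?p 0) (?p 1) (?p 0 * a + ?p 1 * b)
      x y' (x * a + y' * b + d) = - ((?p 0)\<^sup>2 + (?p 1)\<^sup>2) * d" for a b x y' d
    unfolding det3_def by (simp add: power2_eq_square algebra_simps)
  note det = this[of "m (w, 0)" "m (w, 1)" "bar_coeff s z (S y) (Z y) 0" "bar_coeff s z (S y) (Z y) 1" "D s z"]
  have "(?p 0)\<^sup>2 + (?p 1)\<^sup>2 \<noteq> 0" using sz(2) by (metis sum_power2_eq_zero_iff)
  with sz(1) have "- ((?p 0)\<^sup>2 + (?p 1)\<^sup>2) * D s z \<noteq> 0"
    by (metis mult_eq_0_iff neg_equal_0_iff_equal)
  note nz = this[folded det]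
  define \<tau> where "\<tau> = (\<lambda>j::nat. if j = 0 then - ?p 1 else if j = 1 then ?p 0 else 0)"
  have e1: "end_strain v m w \<tau> = - ?p 1 * m (w, 0) + ?p 0 * m (w, 1)"
    using F by (auto simp: end_strain_def \<tau>_def)
  have e2: "end_strain v m w ?p = ?p 0 * m (w, 0) + ?p 1 * m (w, 1)"
    using F by (auto simp: end_strain_def)
  have e3: "end_strain v m y (bar_coeff s z (S y) (Z y)) =
      bar_coeff s z (S y) (Z y) 0 * m (w, 0) + bar_coeff s z (S y) (Z y) 1 * m (w, 1) + D s z"
    unfolding end_strain_def D_def c_def by (auto simp: algebra_simps)
  have "\<tau> 0 = - ?p 1" "\<tau> 1 = ?p 0" by (auto simp: \<tau>_def)
  then show ?thesis using nz
    by (intro solvableI[where s = s and z = z and ?\<tau>1.0 = \<tau> and ?\<tau>2.0 = ?p and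
          ?\<tau>3.0 = "bar_coeff s z (S y) (Z y)"])
      (simp_all only: e1 e2 e3 not_True_eq_False simp_thms)
qed

text \<open>The two free edges fix the angular and the vertical velocity at those of
  \<open>v\<close>; the third edge is placed as a bar at another angle, where it feels the radial
  velocity.\<close>

lemma solvable_triple:
  assumes "m (v, 2) \<noteq> 0"
  shows "solvable v S Z m (v, True) (v, True) (v, f)"
  using assms
  by (intro solvableI[where s = "S v + 1" and z = 0 and ?\<tau>1.0 = "\<lambda>j. if j = 0 then 1 else 0" and
        ?\<tau>2.0 = "\<lambda>j. if j = 1 then 1 else 0" and ?\<tau>3.0 = "bar_coeff (S v + 1) 0 (S v) (Z v)"])
    (auto simp: end_strain_def det3_def algebra_simps)

text \<open>The cases are the possible coincidences among the neighbours. Since parallel edges are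
  never both bars, a double neighbour always comes with a free edge, and permuting the edges brings
  that edge, or \<open>v\<close>, to the front.\<close>

lemma solvable_general:
  assumes "\<And>x y. x \<in> {w1, w2, w3} \<Longrightarrow> y \<in> {w1, w2, w3} \<Longrightarrow> x \<noteq> y \<Longrightarrow> S x \<noteq> S y \<and> 1 + S x * S y \<noteq> 0"
    and "\<not> f1 \<Longrightarrow> \<not> f2 \<Longrightarrow> w1 \<noteq> w2" "\<not> f1 \<Longrightarrow> \<not> f3 \<Longrightarrow> w1 \<noteq> w3" "\<not> f2 \<Longrightarrow> \<not> f3 \<Longrightarrow> w2 \<noteq> w3"
    and nontriv: "(\<exists>x\<in>{w1, w2, w3}. \<exists>y\<in>{w1, w2, w3}. \<exists>i\<le>1. m (x, i) \<noteq> m (y, i)) \<or>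
      (v \<in> {w1, w2, w3} \<and> m (v, 2) \<noteq> 0)"
    and triple: "w1 = w2 \<Longrightarrow> w2 = w3 \<Longrightarrow> w1 = v"
  shows "solvable v S Z m (w1, f1) (w2, f2) (w3, f3)"
proof -
  have two: "solvable v S Z m (x, f) (x, g) (y, h)"
    if "x \<noteq> y" "{w1, w2, w3} = {x, y}" "f \<or> g" for x y f g h
  proof -
    have "S x \<noteq> S y" "1 + S x * S y \<noteq> 0" using assms(1) that by auto
    moreover have "\<not> (\<forall>i\<le>1. m (x, i) = m (y, i)) \<or> (v \<in> {x, y} \<and> m (v, 2) \<noteq> 0)"
      using nontriv unfolding that(2) by auto
    ultimately have "solvable v S Z m (x, True) (x, g) (y, h)" for g by (rule solvable_double)
    then show ?thesis using that(3) solvable_swap12[of v S Z m "(x, True)" "(x, f)"] by (cases f) auto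
  qed
  consider "w1 = w2" "w2 = w3" | "w1 = w2" "w2 \<noteq> w3" | "w1 = w3" "w2 \<noteq> w3" | "w2 = w3" "w1 \<noteq> w2"
    | "w1 \<noteq> w2" "w2 \<noteq> w3" "w1 \<noteq> w3" by blast
  then show ?thesis
  proof cases
    case 1
    then have m: "m (v, 2) \<noteq> 0" and w: "w1 = v" "w2 = v" "w3 = v" using nontriv triple by auto
    note tr = solvable_triple[where m = m and v = v and S = S and Z = Z, OF m]
    consider "f1" "f2" | "f1" "f3" | "f2" "f3" using assms(2-4) 1 by blast
    then show ?thesis unfolding w
    proof cases
      case 1
      then show "solvable v S Z m (v, f1) (v, f2) (v, f3)" using tr by simp
    next
      case 2
      then show "solvable v S Z m (v, f1) (v, f2) (v, f3)"
        using solvable_swap23[OF tr] by simp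
    next
      case 3
      then show "solvable v S Z m (v, f1) (v, f2) (v, f3)"
        using solvable_swap12[OF solvable_swap23[OF tr]] by simp
    qed
  next
    case 2
    then show ?thesis using two[of w1 w3 f1 f2 f3] assms(2) by auto
  next
    case 3
    have "solvable v S Z m (w1, f1) (w3, f3) (w2, f2)" using two[of w1 w2 f1 f3 f2] assms(3) 3 by auto
    then show ?thesis by (rule solvable_swap23)
  next
    case 4
    have "solvable v S Z m (w2, f2) (w3, f3) (w1, f1)" using two[of w2 w1 f2 f3 f1] assms(4) 4 by auto
    then show ?thesis by (rule solvable_swap12[OF solvable_swap23])
  next
    case 5
    have *: "solvable v S Z m (x, f) (y, g) (t, h)"
      if "{w1, w2, w3} = {x, y, t}" "x \<noteq> y" "y \<noteq> t" "x \<noteq> t" "v \<noteq> y" "v \<noteq> t" for x y t f g h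
    proof -
      have "\<not> (\<forall>i\<le>1. m (x, i) = m (y, i) \<and> m (y, i) = m (t, i)) \<or> (v = x \<and> m (v, 2) \<noteq> 0)"
        using nontriv that(5,6) unfolding that(1) by auto
      then show ?thesis using that assms(1) unfolding that(1)
        by (intro solvable_distinct) auto
    qed
    consider "v \<noteq> w2" "v \<noteq> w3" | "v = w2" | "v = w3" by blast
    then show ?thesis
    proof cases
      case 1
      then show ?thesis using *[of w1 w2 w3] 5 by auto
    next
      case 2
      then have "solvable v S Z m (w2, f2) (w1, f1) (w3, f3)" using 5 by (intro *) auto
      then show ?thesis by (rule solvable_swap12)
    next
      case 3
      then have "solvable v S Z m (w3, f3) (w1, f1) (w2, f2)" using 5 by (intro *) auto
      then show ?thesis by (rule solvable_swap23[OF solvable_swap12])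
    qed
  qed
qed

section \<open>Algebraic independence\<close>

text \<open>Each exponent is bounded separately instead of the total degree: the number of monomials
  is then exactly a power, and the bounds still add up in products.\<close>

definition box :: "'i set \<Rightarrow> nat \<Rightarrow> ('i \<Rightarrow> nat) set" where
  "box I s = (I \<rightarrow>\<^sub>E {..s})"

definition monom_val :: "'i set \<Rightarrow> ('i \<Rightarrow> nat) \<Rightarrow> ('i \<Rightarrow> real) \<Rightarrow> real" where
  "monom_val I \<epsilon> Q = (\<Prod>i\<in>I. Q i ^ \<epsilon> i)"

definition box_span :: "'i set \<Rightarrow> nat \<Rightarrow> (('i \<Rightarrow> real) \<Rightarrow> real) \<Rightarrow> bool" where
  "box_span I s f \<longleftrightarrow>
     (\<exists>c :: ('i \<Rightarrow> nat) \<Rightarrow> rat. \<forall>Q. f Q = (\<Sum>\<epsilon>\<in>box I s. of_rat (c \<epsilon>) * monom_val I \<epsilon> Q))"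

lemma finite_box: "finite I \<Longrightarrow> finite (box I s)"
  by (simp add: box_def finite_PiE)

lemma card_box: "finite I \<Longrightarrow> card (box I s) = Suc s ^ card I"
  by (simp add: box_def card_PiE)

lemma rat_polyfun_monom_val: "rat_polyfun I (monom_val I \<epsilon>)"
  unfolding monom_val_def by (intro rpf)

context
  fixes I :: "'i set"
  assumes fin: "finite I"
begin

lemma box_span_mono:
  assumes "box_span I s f" "s \<le> t"
  shows "box_span I t f"
proof -
  obtain c where c: "\<And>Q. f Q = (\<Sum>\<epsilon>\<in>box I s. of_rat (c \<epsilon>) * monom_val I \<epsilon> Q)"
    using assms(1) unfolding box_span_def by blast
  have "box I s \<subseteq> box I t" using assms(2) unfolding box_def by (intro PiE_mono) auto
  then have "f Q = (\<Sum>\<epsilon>\<in>box I t. of_rat (if \<epsilon> \<in> box I s then c \<epsilon> else 0) * monom_val I \<epsilon> Q)" for Q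
    unfolding c using finite_box[OF fin] by (intro sum.mono_neutral_cong_left) auto
  then show ?thesis unfolding box_span_def
    by (intro exI[of _ "\<lambda>\<epsilon>. if \<epsilon> \<in> box I s then c \<epsilon> else 0"]) blast
qed

lemma box_span_add:
  assumes "box_span I s f" "box_span I s g"
  shows "box_span I s (\<lambda>Q. f Q + g Q)"
proof -
  obtain c d where "\<And>Q. f Q = (\<Sum>\<epsilon>\<in>box I s. of_rat (c \<epsilon>) * monom_val I \<epsilon> Q)"
    and "\<And>Q. g Q = (\<Sum>\<epsilon>\<in>box I s. of_rat (d \<epsilon>) * monom_val I \<epsilon> Q)"
    using assms unfolding box_span_def by blast
  then show ?thesis unfolding box_span_def
    by (intro exI[of _ "\<lambda>\<epsilon>. c \<epsilon> + d \<epsilon>"]) (simp add: of_rat_add algebra_simps sum.distrib)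
qed

lemma box_span_monom:
  assumes "\<epsilon> \<in> box I s"
  shows "box_span I s (\<lambda>Q. of_rat r * monom_val I \<epsilon> Q)"
  unfolding box_span_def using assms finite_box[OF fin]
  by (intro exI[of _ "\<lambda>\<epsilon>'. if \<epsilon>' = \<epsilon> then r else 0"])
    (auto simp: if_distrib[of of_rat] if_distribR if_distrib[of "\<lambda>x. x * _"] cong: if_cong)

lemma box_span_zero: "box_span I s (\<lambda>Q. 0)"
  unfolding box_span_def by (intro exI[of _ "\<lambda>_. 0"]) simp

lemma box_span_sum:
  "(\<And>j. j \<in> J \<Longrightarrow> box_span I s (f j)) \<Longrightarrow> box_span I s (\<lambda>Q. \<Sum>j\<in>J. f j Q)"
  by (induction J rule: infinite_finite_induct) (auto intro: box_span_add box_span_zero)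

lemma box_span_mult:
  assumes "box_span I s f" "box_span I t g"
  shows "box_span I (s + t) (\<lambda>Q. f Q * g Q)"
proof -
  obtain c d where c: "\<And>Q. f Q = (\<Sum>\<epsilon>\<in>box I s. of_rat (c \<epsilon>) * monom_val I \<epsilon> Q)"
    and d: "\<And>Q. g Q = (\<Sum>\<epsilon>\<in>box I t. of_rat (d \<epsilon>) * monom_val I \<epsilon> Q)"
    using assms unfolding box_span_def by blast
  define pl where "pl \<epsilon> \<eta> = restrict (\<lambda>i. \<epsilon> i + \<eta> i) I" for \<epsilon> \<eta> :: "'i \<Rightarrow> nat"
  have "monom_val I \<epsilon> Q * monom_val I \<eta> Q = monom_val I (pl \<epsilon> \<eta>) Q" for \<epsilon> \<eta> Q
    by (simp add: monom_val_def pl_def power_add prod.distrib)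
  then have "f Q * g Q = (\<Sum>\<epsilon>\<in>box I s. \<Sum>\<eta>\<in>box I t. of_rat (c \<epsilon> * d \<eta>) * monom_val I (pl \<epsilon> \<eta>) Q)" for Q
    unfolding c d sum_product by (intro sum.cong refl) (simp add: of_rat_mult mult_ac)
  moreover have "pl \<epsilon> \<eta> \<in> box I (s + t)" if "\<epsilon> \<in> box I s" "\<eta> \<in> box I t" for \<epsilon> \<eta>
    using that by (auto simp: box_def pl_def PiE_def Pi_def intro: add_mono)
  ultimately show ?thesis
    by (auto intro!: box_span_sum box_span_monom)
qed

lemma box_span_const: "box_span I 0 (\<lambda>Q. of_rat r)"
proof -
  have "box_span I 0 (\<lambda>Q. of_rat r * monom_val I (\<lambda>i\<in>I. 0) Q)"
    by (intro box_span_monom) (auto simp: box_def)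
  then show ?thesis by (simp add: monom_val_def)
qed

lemma box_span_power:
  assumes "box_span I s f"
  shows "box_span I (s * n) (\<lambda>Q. f Q ^ n)"
proof (induction n)
  case 0
  show ?case using box_span_const[of 1] by simp
next
  case (Suc n)
  show ?case using box_span_mult[OF assms Suc] by simp
qed

lemma box_span_prod:
  "finite J \<Longrightarrow> (\<And>j. j \<in> J \<Longrightarrow> box_span I (s j) (f j)) \<Longrightarrow>
    box_span I (\<Sum>j\<in>J. s j) (\<lambda>Q. \<Prod>j\<in>J. f j Q)"
proof (induction J rule: finite_induct)
  case empty
  show ?case using box_span_const[of 1] by simp
next
  case (insert j J)
  then show ?case using box_span_mult[of "s j" "f j"] by simp
qed

lemma rat_polyfun_imp_box_span:
  assumes "rat_polyfun I f"
  shows "\<exists>s. box_span I s f"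
  using assms
proof (induction rule: rat_polyfun.induct)
  case (const r)
  then show ?case using box_span_const by blast
next
  case (var i)
  have "box_span I 1 (\<lambda>Q. of_rat 1 * monom_val I (\<lambda>j\<in>I. if j = i then 1 else 0) Q)"
    by (intro box_span_monom) (auto simp: box_def)
  moreover have "monom_val I (\<lambda>j\<in>I. if j = i then 1 else 0) Q = Q i" for Q
  proof -
    have "monom_val I (\<lambda>j\<in>I. if j = i then 1 else 0) Q = (\<Prod>j\<in>I. if j = i then Q j else 1)"
      unfolding monom_val_def by (intro prod.cong) auto
    then show ?thesis using fin var by simp
  qed
  ultimately show ?case by auto
next
  case (add f g)
  then obtain s t where "box_span I s f" "box_span I t g" by blast
  then have "box_span I (max s t) f" "box_span I (max s t) g"
    by (auto intro: box_span_mono)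
  then show ?case using box_span_add by blast
next
  case (mult f g)
  then show ?case using box_span_mult by blast
qed

end

text \<open>With the other variables fixed, the sum is a polynomial in \<open>Q i\<close> that
  vanishes identically. So each of its coefficients, a polynomial in fewer variables, vanishes
  everywhere.\<close>

lemma box_poly_zero:
  fixes c :: "('i \<Rightarrow> nat) \<Rightarrow> real"
  assumes "finite I" "\<And>Q. (\<Sum>\<epsilon>\<in>box I s. c \<epsilon> * monom_val I \<epsilon> Q) = 0" "\<epsilon> \<in> box I s"
  shows "c \<epsilon> = 0"
  using assms
proof (induction I arbitrary: c \<epsilon> rule: finite_induct)
  case empty
  then show ?case by (simp add: box_def monom_val_def)
next
  case (insert i I)
  define h where "h \<eta> k = \<eta>(i := k)" for \<eta> :: "'i \<Rightarrow> nat" and k :: nat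
  have bij: "bij_betw (\<lambda>(k, \<eta>). h \<eta> k) ({..s} \<times> box I s) (box (insert i I) s)"
    unfolding bij_betw_def box_def h_def
    using insert.hyps inj_combinator[of i I "\<lambda>_. {..s}"] PiE_insert_eq[of i I "\<lambda>_. {..s}"]
    by auto
  have mv: "monom_val (insert i I) (h \<eta> k) Q = Q i ^ k * monom_val I \<eta> Q" for \<eta> k Q
  proof -
    have "monom_val I (h \<eta> k) Q = monom_val I \<eta> Q"
      unfolding monom_val_def h_def using insert.hyps by (intro prod.cong) auto
    then show ?thesis using insert.hyps by (simp add: monom_val_def h_def)
  qed
  define C where "C k Q = (\<Sum>\<eta>\<in>box I s. c (h \<eta> k) * monom_val I \<eta> Q)" for k Q
  have sum0: "(\<Sum>k\<le>s. C k Q * Q i ^ k) = 0" for Q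
  proof -
    have "0 = (\<Sum>\<epsilon>\<in>box (insert i I) s. c \<epsilon> * monom_val (insert i I) \<epsilon> Q)"
      using insert.prems(1) by simp
    also have "\<dots> = (\<Sum>(k, \<eta>)\<in>{..s} \<times> box I s. c (h \<eta> k) * monom_val (insert i I) (h \<eta> k) Q)"
      by (subst sum.reindex_bij_betw[OF bij, symmetric]) (simp add: case_prod_unfold)
    also have "\<dots> = (\<Sum>k\<le>s. C k Q * Q i ^ k)"
      unfolding C_def mv sum.cartesian_product[symmetric] sum_distrib_right
      by (simp add: mult_ac)
    finally show ?thesis by simp
  qed
  have C0: "C k Q = 0" if "k \<le> s" for k Q
  proof -
    have "C k (Q(i := x)) = C k Q" for k x
      unfolding C_def monom_val_def using insert.hyps
      by (intro sum.cong arg_cong2[of _ _ _ _ "(*)"] prod.cong) auto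
    then have "(\<Sum>k\<le>s. C k Q * x ^ k) = 0" for x
      using sum0[of "Q(i := x)"] by simp
    then show ?thesis using polyfun_eq_0[of "\<lambda>k. C k Q" s] that by blast
  qed
  obtain k \<eta> where k: "k \<le> s" "\<eta> \<in> box I s" "\<epsilon> = h \<eta> k"
  proof -
    have "\<epsilon> \<in> (\<lambda>(k, \<eta>). h \<eta> k) ` ({..s} \<times> box I s)"
      using insert.prems(2) bij by (simp add: bij_betw_def)
    then show thesis using that by auto
  qed
  have "c (h \<eta> k) = 0"
    by (rule insert.IH[of "\<lambda>\<eta>. c (h \<eta> k)"]) (use C0 k in \<open>auto simp: C_def\<close>)
  then show ?case using k by simp
qed

text \<open>A mean value estimate. It bounds the number of monomials gained when a box is enlarged
  by the degree bound \<open>d\<close> of \<open>f\<close>.\<close>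

lemma power_add_le:
  fixes y d n :: nat
  shows "(y + d) ^ n \<le> y ^ n + n * d * (y + d) ^ (n - 1)"
proof (induction n)
  case (Suc n)
  have "(y + d) ^ Suc n = y * (y + d) ^ n + d * (y + d) ^ n" by (simp add: algebra_simps)
  also have "\<dots> \<le> y * (y ^ n + n * d * (y + d) ^ (n - 1)) + d * (y + d) ^ n"
    using Suc by simp
  also have "y * (n * d * (y + d) ^ (n - 1)) \<le> n * d * (y + d) ^ n"
  proof (cases n)
    case (Suc k)
    then show ?thesis by (simp add: algebra_simps)
  qed simp
  then have "y * (y ^ n + n * d * (y + d) ^ (n - 1)) + d * (y + d) ^ n \<le>
      y ^ Suc n + Suc n * d * (y + d) ^ (Suc n - 1)"
    by (simp add: algebra_simps)
  finally show ?case .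
qed simp

text \<open>Passes from finitely supported maps to sums over a box: exponents are extended by zero
  outside \<open>B\<close>, coefficients by zero outside the box.\<close>

lemma algebraically_independentD:
  fixes c :: "(real \<Rightarrow> nat) \<Rightarrow> rat"
  assumes "algebraically_independent B" "finite B"
    and "(\<Sum>\<mu>\<in>box B s. of_rat (c \<mu>) * (\<Prod>b\<in>B. b ^ \<mu> b)) = 0" "\<mu> \<in> box B s"
  shows "c \<mu> = 0"
proof -
  define \<iota> where "\<iota> \<mu> = Abs_poly_mapping (\<lambda>x. if x \<in> B then \<mu> x else (0::nat))"
    for \<mu> :: "real \<Rightarrow> nat"
  have lookup_\<iota>: "Poly_Mapping.lookup (\<iota> \<mu>) x = (if x \<in> B then \<mu> x else 0)" for \<mu> x
    unfolding \<iota>_def using assms(2) by (subst lookup_Abs_poly_mapping) auto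
  have keys_\<iota>: "Poly_Mapping.keys (\<iota> \<mu>) \<subseteq> B" for \<mu>
    by (auto simp: in_keys_iff lookup_\<iota> split: if_splits)
  have inj: "inj_on \<iota> (box B s)"
  proof (rule inj_onI)
    fix \<mu> \<nu> assume *: "\<mu> \<in> box B s" "\<nu> \<in> box B s" "\<iota> \<mu> = \<iota> \<nu>"
    then have "\<mu> x = \<nu> x" if "x \<in> B" for x using lookup_\<iota>[of \<mu> x] lookup_\<iota>[of \<nu> x] that by simp
    then show "\<mu> = \<nu>" using * unfolding box_def by (intro PiE_ext) auto
  qed
  define P where "P = Abs_poly_mapping (\<lambda>m. if m \<in> \<iota> ` box B s then c (the_inv_into (box B s) \<iota> m) else 0)"
  have lookup_P: "Poly_Mapping.lookup P m =
      (if m \<in> \<iota> ` box B s then c (the_inv_into (box B s) \<iota> m) else 0)" for m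
    unfolding P_def using finite_box[OF assms(2)]
    by (subst lookup_Abs_poly_mapping) auto
  have keys_P: "Poly_Mapping.keys P \<subseteq> \<iota> ` box B s"
    by (auto simp: in_keys_iff lookup_P split: if_splits)
  have P\<iota>: "Poly_Mapping.lookup P (\<iota> \<mu>) = c \<mu>" if "\<mu> \<in> box B s" for \<mu>
    using that inj by (simp add: lookup_P the_inv_into_f_f)
  have monom: "(\<Prod>x\<in>Poly_Mapping.keys (\<iota> \<mu>). x ^ Poly_Mapping.lookup (\<iota> \<mu>) x) = (\<Prod>b\<in>B. b ^ \<mu> b)" for \<mu>
    using assms(2) keys_\<iota>[of \<mu>]
    by (intro prod.mono_neutral_cong_left) (auto simp: in_keys_iff lookup_\<iota>)
  have "eval_rat_poly P = (\<Sum>m\<in>\<iota> ` box B s. of_rat (Poly_Mapping.lookup P m) *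
        (\<Prod>x\<in>Poly_Mapping.keys m. x ^ Poly_Mapping.lookup m x))"
    unfolding eval_rat_poly_def using keys_P finite_box[OF assms(2)]
    by (intro sum.mono_neutral_left) (auto simp: in_keys_iff)
  also have "\<dots> = (\<Sum>\<mu>\<in>box B s. of_rat (c \<mu>) * (\<Prod>b\<in>B. b ^ \<mu> b))"
    by (simp add: sum.reindex[OF inj] P\<iota> monom)
  finally have "eval_rat_poly P = 0" using assms(3) by simp
  moreover have "\<forall>m\<in>Poly_Mapping.keys P. Poly_Mapping.keys m \<subseteq> B"
    using keys_P keys_\<iota> by blast
  ultimately have "P = 0" using assms(1) unfolding algebraically_independent_def by blast
  then show ?thesis using P\<iota>[OF assms(4)] by simp
qed

text \<open>A dimension count: if \<open>f\<close> vanishes at \<open>Q0\<close>, then the values at \<open>Q0\<close> of the polynomials with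
  all degrees at most \<open>n\<close> span a space of dimension \<open>O(n ^ (card I - 1))\<close> over the rationals,
  because all multiples of \<open>f\<close> vanish.\<close>

lemma card_algebraically_independent_less:
  fixes Q0 :: "'i \<Rightarrow> real"
  assumes "finite I" "I \<noteq> {}" and f: "rat_polyfun I f" "f Q0 = 0" "f Q1 \<noteq> 0"
    and B: "finite B" "algebraically_independent B"
    and K: "\<And>b. b \<in> B \<Longrightarrow> \<exists>g h. rat_polyfun I g \<and> rat_polyfun I h \<and> h Q0 \<noteq> 0 \<and> b = g Q0 / h Q0"
  shows "card B < card I"
proof (rule ccontr)
  assume "\<not> ?thesis"
  then have cardB: "card I \<le> card B" by simp
  define N where "N = card I"
  have N: "N > 0" using assms(1,2) by (auto simp: N_def card_gt_0_iff)
  obtain g h where gh: "\<And>b. b \<in> B \<Longrightarrow> rat_polyfun I (g b) \<and> rat_polyfun I (h b) \<and>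
      h b Q0 \<noteq> 0 \<and> b = g b Q0 / h b Q0"
    using K by metis
  \<comment> \<open>Brings the elements of \<open>B\<close> to the common denominator
    \<open>H\<close>: each \<open>b\<close> is \<open>G b Q0 / H Q0\<close>.\<close>
  define H where "H Q = (\<Prod>b\<in>B. h b Q)" for Q
  define G where "G b Q = g b Q * (\<Prod>b'\<in>B-{b}. h b' Q)" for b Q
  have H0: "H Q0 \<noteq> 0" using gh B by (simp add: H_def)
  have G: "G b Q0 = b * H Q0" if "b \<in> B" for b
  proof -
    have "H Q0 = h b Q0 * (\<Prod>b'\<in>B-{b}. h b' Q0)"
      unfolding H_def using B that by (intro prod.remove)
    moreover have "g b Q0 = b * h b Q0" using gh[OF that] by (metis nonzero_eq_divide_eq)
    ultimately show ?thesis by (simp add: G_def)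
  qed
  have rpH: "rat_polyfun I H" unfolding H_def using gh by (intro rpf) auto
  have rpG: "rat_polyfun I (G b)" if "b \<in> B" for b
    unfolding G_def using gh that by (intro rpf) auto
  obtain sH where sH: "box_span I sH H"
    using rat_polyfun_imp_box_span[OF assms(1) rpH] by blast
  obtain sG where sG: "\<And>b. b \<in> B \<Longrightarrow> box_span I (sG b) (G b)"
    using rat_polyfun_imp_box_span[OF assms(1) rpG] by metis
  define r where "r = sH + (\<Sum>b\<in>B. sG b)"
  have rH: "box_span I r H" using box_span_mono[OF assms(1) sH] by (simp add: r_def)
  have rG: "box_span I r (G b)" if "b \<in> B" for b
  proof -
    have "sG b \<le> (\<Sum>b\<in>B. sG b)" using that B by (intro member_le_sum) auto
    then show ?thesis by (intro box_span_mono[OF assms(1) sG[OF that]]) (simp add: r_def)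
  qed
  obtain d where d: "box_span I d f" using rat_polyfun_imp_box_span[OF assms(1) f(1)] by blast
  define k where "k = card B"
  \<comment> \<open>Chosen so that, with \<open>M = k * D\<close>, enlarging the box gains at most
    \<open>D * Suc D ^ (N - 1)\<close> monomials. This is less than \<open>Suc D ^ k\<close>, the
    number of products of elements of \<open>B\<close> that are considered, because
    \<open>N \<le> k\<close>.\<close>
  define D where "D = N * d * (r * k + 1 + d) ^ (N - 1)"
  define M where "M = k * D"
  \<comment> \<open>The monomial \<open>\<mu>\<close> in the elements of \<open>B\<close>, made
    homogeneous with \<open>H\<close>, so that all values at \<open>Q0\<close> carry the same factor
    \<open>H Q0 ^ M\<close>.\<close>
  define W where "W \<mu> Q = (\<Prod>b\<in>B. G b Q ^ \<mu> b) * H Q ^ (M - (\<Sum>b\<in>B. \<mu> b))" for \<mu> Q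
  have sum_le: "(\<Sum>b\<in>B. \<mu> b) \<le> M" if "\<mu> \<in> box B D" for \<mu>
  proof -
    have "(\<Sum>b\<in>B. \<mu> b) \<le> (\<Sum>b\<in>B. D)"
      using that by (intro sum_mono) (auto simp: box_def PiE_def Pi_def)
    then show ?thesis by (simp add: M_def k_def)
  qed
  have spW: "box_span I (r * M) (W \<mu>)" if "\<mu> \<in> box B D" for \<mu>
  proof -
    have "box_span I ((\<Sum>b\<in>B. r * \<mu> b) + r * (M - (\<Sum>b\<in>B. \<mu> b))) (W \<mu>)"
      unfolding W_def using B rG rH assms(1)
      by (intro box_span_mult box_span_prod box_span_power) auto
    then show ?thesis using sum_le[OF that]
      by (simp flip: sum_distrib_left distrib_left)
  qed
  have W0: "W \<mu> Q0 = H Q0 ^ M * (\<Prod>b\<in>B. b ^ \<mu> b)" if "\<mu> \<in> box B D" for \<mu>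
  proof -
    have "(\<Prod>b\<in>B. G b Q0 ^ \<mu> b) = (\<Prod>b\<in>B. b ^ \<mu> b * H Q0 ^ \<mu> b)"
      by (intro prod.cong) (auto simp: G power_mult_distrib)
    also have "\<dots> = (\<Prod>b\<in>B. b ^ \<mu> b) * H Q0 ^ (\<Sum>b\<in>B. \<mu> b)"
      by (simp add: prod.distrib power_sum)
    finally show ?thesis using sum_le[OF that]
      by (simp add: W_def mult_ac flip: power_add)
  qed
  \<comment> \<open>Two families in one box: the products \<open>W\<close> and the monomial
    multiples of \<open>f\<close>. Together they outnumber the monomials of the box, which forces a
    rational linear relation.\<close>
  define J :: "((real \<Rightarrow> nat) + ('i \<Rightarrow> nat)) set" where
    "J = Inl ` box B D \<union> Inr ` box I (r * M)"
  define F where "F j = (case j of Inl \<mu> \<Rightarrow> W \<mu> | Inr \<epsilon> \<Rightarrow> (\<lambda>Q. f Q * monom_val I \<epsilon> Q))" for j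
  have finJ: "finite J" using B assms(1) by (auto simp: J_def intro: finite_box)
  have spF: "box_span I (d + r * M) (F j)" if "j \<in> J" for j
  proof (cases j)
    case (Inl \<mu>)
    then show ?thesis using that spW box_span_mono[OF assms(1), of "r * M" _ "d + r * M"]
      by (auto simp: J_def F_def)
  next
    case (Inr \<epsilon>)
    then have "\<epsilon> \<in> box I (r * M)" using that by (auto simp: J_def)
    from box_span_mult[OF assms(1) d box_span_monom[OF assms(1) this, of 1]] show ?thesis
      by (simp add: Inr F_def)
  qed
  then obtain C where C: "\<And>j Q. j \<in> J \<Longrightarrow>
      F j Q = (\<Sum>\<epsilon>\<in>box I (d + r * M). of_rat (C j \<epsilon>) * monom_val I \<epsilon> Q)"
    unfolding box_span_def by metis
  have "card J = Suc D ^ k + Suc (r * M) ^ N"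
    unfolding J_def using B assms(1)
    by (subst card_Un_disjoint) (auto simp: finite_box card_image card_box k_def N_def)
  moreover have "card (box I (d + r * M)) = (Suc (r * M) + d) ^ N"
    by (simp add: card_box assms(1) N_def add.commute)
  moreover have "(Suc (r * M) + d) ^ N < Suc D ^ k + Suc (r * M) ^ N"
  proof -
    have "Suc (r * M) + d \<le> (r * k + 1 + d) * Suc D"
      by (simp add: M_def algebra_simps)
    then have "(Suc (r * M) + d) ^ (N - 1) \<le> (r * k + 1 + d) ^ (N - 1) * Suc D ^ (N - 1)"
      by (metis power_mono power_mult_distrib zero_le)
    then have "N * d * (Suc (r * M) + d) ^ (N - 1) \<le> D * Suc D ^ (N - 1)"
      unfolding D_def by (metis mult.assoc mult_le_mono2)
    also have "\<dots> < Suc D * Suc D ^ (N - 1)" by simp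
    also have "\<dots> = Suc D ^ N" using N by (simp add: power_eq_if)
    also have "\<dots> \<le> Suc D ^ k" using cardB by (intro power_increasing) (auto simp: N_def k_def)
    finally show ?thesis using power_add_le[of "Suc (r * M)" d N] by simp
  qed
  ultimately obtain l where l: "\<exists>j\<in>J. l j \<noteq> 0"
    "\<And>\<epsilon>. \<epsilon> \<in> box I (d + r * M) \<Longrightarrow> (\<Sum>j\<in>J. l j * C j \<epsilon>) = 0"
    using many_vectors_dependent[of "box I (d + r * M)" J C] finJ finite_box[OF assms(1)] by metis
  have rel: "(\<Sum>j\<in>J. of_rat (l j) * F j Q) = 0" for Q
  proof -
    have "(\<Sum>j\<in>J. of_rat (l j) * F j Q) =
        (\<Sum>j\<in>J. \<Sum>\<epsilon>\<in>box I (d + r * M). of_rat (l j * C j \<epsilon>) * monom_val I \<epsilon> Q)"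
      by (intro sum.cong refl) (simp add: C sum_distrib_left of_rat_mult mult_ac)
    also have "\<dots> = (\<Sum>\<epsilon>\<in>box I (d + r * M). of_rat (\<Sum>j\<in>J. l j * C j \<epsilon>) * monom_val I \<epsilon> Q)"
      by (subst sum.swap) (simp add: of_rat_sum sum_distrib_right)
    also have "\<dots> = 0" using l(2) by simp
    finally show ?thesis .
  qed
  have split: "(\<Sum>j\<in>J. of_rat (l j) * F j Q) = (\<Sum>\<mu>\<in>box B D. of_rat (l (Inl \<mu>)) * W \<mu> Q) +
      f Q * (\<Sum>\<epsilon>\<in>box I (r * M). of_rat (l (Inr \<epsilon>)) * monom_val I \<epsilon> Q)" for Q
    unfolding J_def using B assms(1)
    by (subst sum.union_disjoint)
      (auto simp: finite_box sum.reindex F_def sum_distrib_left mult_ac)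
  \<comment> \<open>At \<open>Q0\<close> the multiples of \<open>f\<close> drop out, and the
    independence of \<open>B\<close> kills the coefficients of the \<open>W\<close>. What is left is
    \<open>f * q = 0\<close> for an \<open>f\<close> that is not identically zero, so
    \<open>q\<close> is zero too.\<close>
  have "H Q0 ^ M * (\<Sum>\<mu>\<in>box B D. of_rat (l (Inl \<mu>)) * (\<Prod>b\<in>B. b ^ \<mu> b)) = 0"
    using rel[of Q0] unfolding split f(2) by (simp add: W0 sum_distrib_left mult_ac)
  then have "(\<Sum>\<mu>\<in>box B D. of_rat (l (Inl \<mu>)) * (\<Prod>b\<in>B. b ^ \<mu> b)) = 0" using H0 by simp
  then have lB: "l (Inl \<mu>) = 0" if "\<mu> \<in> box B D" for \<mu>
    using algebraically_independentD[OF B(2,1)] that by metis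
  define q where "q Q = (\<Sum>\<epsilon>\<in>box I (r * M). of_rat (l (Inr \<epsilon>)) * monom_val I \<epsilon> Q)" for Q
  have "f Q * q Q = 0" for Q
    using rel[of Q] unfolding split q_def[symmetric] using lB by simp
  moreover have "rat_polyfun I q" unfolding q_def by (intro rpf rat_polyfun_monom_val)
  ultimately have "q Q = 0" for Q
    using rat_polyfun_common_nonzero[OF f(1,3), of I q Q] by auto
  then have "of_rat (l (Inr \<epsilon>)) = (0::real)" if "\<epsilon> \<in> box I (r * M)" for \<epsilon>
    using that unfolding q_def by (intro box_poly_zero[OF assms(1), where c = "\<lambda>\<epsilon>. of_rat (l (Inr \<epsilon>))"])
  then show False using l(1) lB by (auto simp: J_def)
qed

section \<open>Sparse graphs with a free vertex\<close>

text \<open>Besides the bars of a framework we allow edges with three coefficients of their own. They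
  may be parallel to each other and to bars, which makes the induction on vertices of degree at
  most 3 work without any exceptional case.\<close>

datatype 'a edge = is_bar: Bar (src: 'a) (tgt: 'a) | Free (label: nat) (src: 'a) (tgt: 'a)

datatype 'a par = PosS 'a | PosZ 'a | Coef nat nat

definition ends :: "'a edge \<Rightarrow> 'a set" where
  "ends e = {src e, tgt e}"

definition other :: "'a \<Rightarrow> 'a edge \<Rightarrow> 'a" where
  "other u e = (if src e = u then tgt e else src e)"

fun edge_coeff :: "('a par \<Rightarrow> real) \<Rightarrow> 'a edge \<Rightarrow> nat \<Rightarrow> real" where
  "edge_coeff Q (Bar x y) j = bar_coeff (Q (PosS x)) (Q (PosZ x)) (Q (PosS y)) (Q (PosZ y)) j"
| "edge_coeff Q (Free k x y) j = Q (Coef k j)"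

text \<open>The coordinates \<open>(x, 0)\<close> and \<open>(x, 1)\<close> are the angular and the vertical velocity of \<open>x\<close>, and
  \<open>(v, 2)\<close> is the radial velocity of the free vertex \<open>v\<close>.\<close>

fun edge_row :: "'a \<Rightarrow> ('a par \<Rightarrow> real) \<Rightarrow> 'a edge \<Rightarrow> 'a \<times> nat \<Rightarrow> real" where
  "edge_row v Q e (x, j) =
    (if j < 2 then edge_coeff Q e j * (of_bool (x = src e) - of_bool (x = tgt e))
     else if x = v \<and> v \<in> ends e then edge_coeff Q e 2 else 0)"

definition strain :: "'a \<Rightarrow> ('a par \<Rightarrow> real) \<Rightarrow> 'a edge \<Rightarrow> ('a \<times> nat \<Rightarrow> real) \<Rightarrow> real" where
  "strain v Q e m = edge_coeff Q e 0 * (m (src e, 0) - m (tgt e, 0)) +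
     edge_coeff Q e 1 * (m (src e, 1) - m (tgt e, 1)) + (if v \<in> ends e then edge_coeff Q e 2 * m (v, 2) else 0)"

text \<open>The vertex \<open>v\<close> need not belong to \<open>V\<close>; then no vertex is free.\<close>

definition sparse :: "'a \<Rightarrow> 'a set \<Rightarrow> 'a edge set \<Rightarrow> bool" where
  "sparse v V E \<longleftrightarrow> finite V \<and> finite E \<and> (\<forall>e\<in>E. src e \<noteq> tgt e \<and> ends e \<subseteq> V) \<and>
     (\<forall>e\<in>E. \<forall>f\<in>E. is_bar e \<longrightarrow> is_bar f \<longrightarrow> ends e = ends f \<longrightarrow> e = f) \<and>
     (\<forall>e\<in>E. \<forall>f\<in>E. \<not> is_bar e \<longrightarrow> \<not> is_bar f \<longrightarrow> label e = label f \<longrightarrow> e = f) \<and>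
     (\<forall>X\<subseteq>V. X \<noteq> {} \<longrightarrow> card {e\<in>E. ends e \<subseteq> X} + 2 \<le> 2 * card X + of_bool (v \<in> X))"

text \<open>The columns \<open>(x, 2)\<close> with \<open>x \<noteq> v\<close> are zero; keeping
  them makes the index set uniform.\<close>

abbreviation generically_indep :: "'a \<Rightarrow> 'a set \<Rightarrow> 'a edge set \<Rightarrow> bool" where
  "generically_indep v V E \<equiv> \<exists>Q. rows_indep E (V \<times> {..<3}) (edge_row v Q)"

lemma sum_lessThan_3: "(\<Sum>j<3. f j) = f 0 + f 1 + f (2::nat)" for f :: "nat \<Rightarrow> real"
  by (simp add: numeral_3_eq_3 numeral_2_eq_2)

lemma sum_row:
  assumes "finite V" "ends e \<subseteq> V"
  shows "(\<Sum>k\<in>V \<times> {..<3}. edge_row v Q e k * m k) = strain v Q e m"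
proof -
  have "(\<Sum>k\<in>V \<times> {..<3}. edge_row v Q e k * m k) = (\<Sum>x\<in>V. \<Sum>j<3. edge_row v Q e (x, j) * m (x, j))"
    by (simp add: sum.cartesian_product case_prod_unfold del: edge_row.simps)
  also have "\<dots> = (\<Sum>x\<in>V. (if x = src e then edge_coeff Q e 0 * m (x, 0) + edge_coeff Q e 1 * m (x, 1) else 0)
      - (if x = tgt e then edge_coeff Q e 0 * m (x, 0) + edge_coeff Q e 1 * m (x, 1) else 0)
      + (if x = v then (if v \<in> ends e then edge_coeff Q e 2 * m (x, 2) else 0) else 0))"
    unfolding sum_lessThan_3 by (intro sum.cong) (auto simp: algebra_simps)
  also have "\<dots> = strain v Q e m"
    using assms by (auto simp: sum.distrib sum_subtractf strain_def ends_def algebra_simps)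
  finally show ?thesis .
qed

lemma stress_strain:
  assumes "finite V" "\<And>e. e \<in> E \<Longrightarrow> ends e \<subseteq> V"
    and "\<forall>k\<in>V \<times> {..<3}. (\<Sum>e\<in>E. \<omega> e * edge_row v Q e k) = 0"
  shows "(\<Sum>e\<in>E. \<omega> e * strain v Q e m) = 0"
proof -
  have "(\<Sum>e\<in>E. \<omega> e * strain v Q e m) = (\<Sum>e\<in>E. \<Sum>k\<in>V \<times> {..<3}. \<omega> e * edge_row v Q e k * m k)"
    using assms(1,2) by (intro sum.cong refl)
      (simp add: sum_row[symmetric] sum_distrib_left mult_ac del: edge_row.simps)
  also have "\<dots> = (\<Sum>k\<in>V \<times> {..<3}. (\<Sum>e\<in>E. \<omega> e * edge_row v Q e k) * m k)"
    by (subst sum.swap) (simp add: sum_distrib_right del: edge_row.simps)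
  also have "\<dots> = 0" using assms(3) by (intro sum.neutral) (auto simp del: edge_row.simps)
  finally show ?thesis .
qed

text \<open>This is how an added test edge \<open>f\<close> yields a motion that respects all other
  edges but is not trivial at the ends of \<open>f\<close>.\<close>

lemma dual_motion:
  assumes "finite V" "finite E" "\<And>e. e \<in> E \<Longrightarrow> ends e \<subseteq> V"
    and "rows_indep E (V \<times> {..<3}) (edge_row v Q)" "f \<in> E"
  shows "\<exists>m. \<forall>e\<in>E. strain v Q e m = of_bool (e = f)"
proof -
  obtain m where "\<forall>e\<in>E. (\<Sum>k\<in>V \<times> {..<3}. edge_row v Q e k * m k) = (if e = f then 1 else 0)"
    using rows_indep_dual_vector[OF assms(2) _ assms(4,5)] assms(1) by auto
  then show ?thesis using sum_row[OF assms(1,3)] by (intro exI[of _ m]) auto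
qed

lemma rat_polyfun_bar_coeff [rpf]:
  assumes "rat_polyfun I s" "rat_polyfun I z" "rat_polyfun I t" "rat_polyfun I y"
  shows "rat_polyfun I (\<lambda>Q. bar_coeff (s Q) (z Q) (t Q) (y Q) j)"
  unfolding bar_coeff_def using assms
  by (cases "j = 0"; cases "j = 1") (auto intro!: rpf)

lemma rat_polyfun_row:
  assumes "case e of Bar x y \<Rightarrow> {PosS x, PosZ x, PosS y, PosZ y} \<subseteq> I
    | Free k x y \<Rightarrow> \<forall>j. Coef k j \<in> I"
  shows "rat_polyfun I (\<lambda>Q. edge_row v Q e k)"
proof -
  have c: "rat_polyfun I (\<lambda>Q. edge_coeff Q e j)" for j
    using assms by (cases e) (auto intro!: rpf)
  obtain x j where k: "k = (x, j)" by fastforce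
  have "rat_polyfun I (\<lambda>Q. edge_coeff Q e j * of_rat (of_bool (x = src e) - of_bool (x = tgt e)))"
    by (intro rpf c)
  then show ?thesis unfolding k using c[of 2]
    by (cases "j < 2"; cases "x = v \<and> v \<in> ends e") (auto intro: rpf)
qed

lemma rat_polyfun_row_UNIV: "rat_polyfun UNIV (\<lambda>Q. edge_row v Q e k)"
  by (rule rat_polyfun_row) (auto split: edge.split)

lemma sparseD:
  assumes "sparse v V E"
  shows "finite V" "finite E" "e \<in> E \<Longrightarrow> src e \<noteq> tgt e" "e \<in> E \<Longrightarrow> ends e \<subseteq> V"
    "e \<in> E \<Longrightarrow> f \<in> E \<Longrightarrow> is_bar e \<Longrightarrow> is_bar f \<Longrightarrow> ends e = ends f \<Longrightarrow> e = f"
    "e \<in> E \<Longrightarrow> f \<in> E \<Longrightarrow> \<not> is_bar e \<Longrightarrow> \<not> is_bar f \<Longrightarrow> label e = label f \<Longrightarrow> e = f"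
    "X \<subseteq> V \<Longrightarrow> X \<noteq> {} \<Longrightarrow> card {e\<in>E. ends e \<subseteq> X} + 2 \<le> 2 * card X + of_bool (v \<in> X)"
  using assms unfolding sparse_def by blast+

lemma sparse_subset:
  assumes "sparse v V E" "F \<subseteq> E" "W \<subseteq> V" "\<And>e. e \<in> F \<Longrightarrow> ends e \<subseteq> W"
  shows "sparse v W F"
proof -
  note sp = sparseD[OF assms(1)]
  have "card {e\<in>F. ends e \<subseteq> X} + 2 \<le> 2 * card X + of_bool (v \<in> X)" if "X \<subseteq> W" "X \<noteq> {}" for X
  proof -
    have "card {e\<in>F. ends e \<subseteq> X} \<le> card {e\<in>E. ends e \<subseteq> X}"
      using sp(2) assms(2) by (intro card_mono) auto
    then show ?thesis using sp(7)[of X] that assms(3) by force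
  qed
  moreover have "finite W" "finite F"
    using sp(1,2) assms(2,3) finite_subset by blast+
  moreover have "\<forall>e\<in>F. src e \<noteq> tgt e \<and> ends e \<subseteq> W"
    using assms(2,4) sp(3) by blast
  moreover have "\<forall>e\<in>F. \<forall>f\<in>F. is_bar e \<longrightarrow> is_bar f \<longrightarrow> ends e = ends f \<longrightarrow> e = f"
    "\<forall>e\<in>F. \<forall>f\<in>F. \<not> is_bar e \<longrightarrow> \<not> is_bar f \<longrightarrow> label e = label f \<longrightarrow> e = f"
    using assms(1,2) unfolding sparse_def by (meson subsetD)+
  ultimately show ?thesis unfolding sparse_def by simp
qed

text \<open>Otherwise the degrees sum to at least \<open>4 * card V\<close>, less 1 if
  \<open>v \<in> V\<close>, whereas sparsity of \<open>V\<close> itself bounds twice the number of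
  edges by \<open>4 * card V - 4\<close>, plus 2 if \<open>v \<in> V\<close>.\<close>

lemma exists_low_degree:
  assumes "sparse v V E" "V \<noteq> {}"
  shows "\<exists>u\<in>V. card {e\<in>E. u \<in> ends e} \<le> (if u = v then 2 else 3)"
proof (rule ccontr)
  assume "\<not> ?thesis"
  then have *: "4 - of_bool (u = v) \<le> card {e\<in>E. u \<in> ends e}" if "u \<in> V" for u
    using that by (auto simp: not_le split: if_splits)
  note sp = sparseD[OF assms(1)]
  have "4 * card V = (\<Sum>u\<in>V. 4 - of_bool (u = v) + of_bool (u = v))"
    by (simp add: of_bool_def)
  also have "\<dots> = (\<Sum>u\<in>V. 4 - of_bool (u = v)) + of_bool (v \<in> V)"
    unfolding sum.distrib using sp(1) by (simp add: of_bool_def)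
  also have "(\<Sum>u\<in>V. 4 - of_bool (u = v)) \<le> (\<Sum>u\<in>V. card {e\<in>E. u \<in> ends e})"
    using * by (rule sum_mono)
  also have "\<dots> = (\<Sum>u\<in>V. \<Sum>e\<in>E. of_bool (u \<in> ends e))"
    using sp(2) by (simp add: of_bool_def sum.If_cases Int_def)
  also have "\<dots> = (\<Sum>e\<in>E. \<Sum>u\<in>V. of_bool (u \<in> ends e))" by (rule sum.swap)
  also have "\<dots> = (\<Sum>e\<in>E. 2)"
  proof (intro sum.cong refl)
    fix e assume e: "e \<in> E"
    have "(\<Sum>u\<in>V. of_bool (u \<in> ends e)) = card (V \<inter> ends e)"
      using sp(1) by (simp add: of_bool_def sum.If_cases)
    also have "V \<inter> ends e = {src e, tgt e}" using sp(4)[OF e] by (auto simp: ends_def)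
    finally show "(\<Sum>u\<in>V. of_bool (u \<in> ends e)) = (2::nat)" using sp(3)[OF e] by simp
  qed
  also have "\<dots> = 2 * card E" by simp
  finally have "4 * card V \<le> 2 * card E + of_bool (v \<in> V)" by simp
  moreover have "{e\<in>E. ends e \<subseteq> V} = E" using sp(4) by auto
  then have "card E + 2 \<le> 2 * card V + of_bool (v \<in> V)"
    using sp(7)[of V] assms(2) by auto
  ultimately show False by (auto simp: of_bool_def split: if_splits)
qed

section \<open>Adding a vertex of degree at most three\<close>

lemma local_rank_two:
  fixes d1 d2 :: "'a edge"
  assumes at: "u \<in> ends d1" "u \<in> ends d2" "src d1 \<noteq> tgt d1" "src d2 \<noteq> tgt d2"
    and order: "is_bar d1 \<or> \<not> is_bar d2"
    and bars: "is_bar d1 \<Longrightarrow> is_bar d2 \<Longrightarrow> ends d1 \<noteq> ends d2"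
    and labels: "\<not> is_bar d1 \<Longrightarrow> \<not> is_bar d2 \<Longrightarrow> label d1 \<noteq> label d2"
  shows "\<exists>Q. rows_indep {d1, d2} ({u} \<times> {..<2}) (edge_row v Q)"
proof -
  define w where "w = other u d1"
  \<comment> \<open>\<open>d1\<close> becomes purely angular: \<open>w\<close> has another angle
    than \<open>u\<close> and the same height. \<open>d2\<close> becomes purely vertical: a third
    vertex has the angle of \<open>u\<close> and another height. Free edges take unit vectors. A bar
    must come first, since a bar \<open>d2\<close> next to a free \<open>d1\<close> could end at
    \<open>w\<close>.\<close>
  define Q :: "'a par \<Rightarrow> real" where "Q p = (case p of PosS x \<Rightarrow> of_bool (x = w) | PosZ x \<Rightarrow> of_bool (x \<noteq> u \<and> x \<noteq> w)
    | Coef k j \<Rightarrow> if \<not> is_bar d1 \<and> k = label d1 then of_bool (j = 0) else of_bool (j = 1))" for p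
  have uw: "u \<noteq> w" using at by (auto simp: w_def other_def ends_def)
  have c1: "edge_coeff Q d1 0 \<noteq> 0" "edge_coeff Q d1 1 = 0"
    using at by (cases d1; auto simp: Q_def w_def other_def ends_def)+
  have c2: "edge_coeff Q d2 0 = 0" "edge_coeff Q d2 1 \<noteq> 0"
  proof -
    have "edge_coeff Q d2 0 = 0 \<and> edge_coeff Q d2 1 \<noteq> 0"
    proof (cases d2)
      case (Bar x y)
      then obtain x' y' where d1: "d1 = Bar x' y'" using order by (cases d1) auto
      show ?thesis using at bars unfolding d1 Bar Q_def w_def other_def ends_def
        by (auto simp: doubleton_eq_iff)
    next
      case (Free k x y)
      then show ?thesis using labels by (auto simp: Q_def)
    qed
    then show "edge_coeff Q d2 0 = 0" "edge_coeff Q d2 1 \<noteq> 0" by auto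
  qed
  have "d1 \<noteq> d2" using c1 c2 by auto
  have sg: "of_bool (u = src d) - of_bool (u = tgt d) \<noteq> (0::real)" if "d \<in> {d1, d2}" for d
    using that at by (auto simp: ends_def)
  have "rows_indep {d1, d2} ({u} \<times> {..<2}) (edge_row v Q)"
    unfolding rows_indep_def
  proof (intro allI impI)
    fix \<omega> assume "\<forall>k\<in>{u} \<times> {..<2}. (\<Sum>e\<in>{d1, d2}. \<omega> e * edge_row v Q e k) = 0"
    then have "(\<Sum>e\<in>{d1, d2}. \<omega> e * edge_row v Q e (u, 0)) = 0" "(\<Sum>e\<in>{d1, d2}. \<omega> e * edge_row v Q e (u, 1)) = 0"
      by auto
    then show "\<forall>e\<in>{d1, d2}. \<omega> e = 0"
      using c1 c2 sg[of d1] sg[of d2] \<open>d1 \<noteq> d2\<close> by simp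
  qed
  then show ?thesis by blast
qed

lemma local_rank_le_two:
  assumes sp: "sparse v V E" and D: "D \<subseteq> E" "\<And>e. e \<in> D \<Longrightarrow> u \<in> ends e" and card: "card D \<le> 2"
  shows "\<exists>Q. rows_indep D ({u} \<times> {..<2}) (edge_row v Q)"
proof -
  note sp' = sparseD[OF sp]
  have fin: "finite D" using D(1) sp'(2) by (rule finite_subset)
  consider "D = {}" | d where "D = {d}" | d1 d2 where "D = {d1, d2}" "d1 \<noteq> d2"
  proof -
    consider "card D = 0" | "card D = 1" | "card D = 2" using card by linarith
    then show thesis
    proof cases
      case 1
      then have "D = {}" using fin by simp
      then show thesis by (rule that(1))
    next
      case 2
      then obtain d where "D = {d}" by (rule card_1_singletonE)
      then show thesis by (rule that(2))
    next
      case 3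
      then obtain d1 d2 where "D = {d1, d2}" "d1 \<noteq> d2" unfolding card_2_iff by auto
      then show thesis by (rule that(3))
    qed
  qed
  then show ?thesis
  proof cases
    case 1
    then show ?thesis by (simp add: rows_indep_def)
  next
    case (2 d)
    \<comment> \<open>A single edge is completed by an auxiliary free edge with another
      label.\<close>
    define f where "f = Free (Suc (label d)) u (other u d)"
    have d: "d \<in> E" "u \<in> ends d" using 2 D by auto
    have f: "u \<in> ends f" "src f \<noteq> tgt f" "\<not> is_bar f" "label d \<noteq> label f"
      using d sp'(3)[OF d(1)] by (auto simp: f_def ends_def other_def)
    have "\<exists>Q. rows_indep {d, f} ({u} \<times> {..<2}) (edge_row v Q)"
      by (rule local_rank_two[OF d(2) f(1) sp'(3)[OF d(1)] f(2)]) (use f in simp_all)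
    then obtain Q where "rows_indep {d, f} ({u} \<times> {..<2}) (edge_row v Q)" ..
    then have "rows_indep {d} ({u} \<times> {..<2}) (edge_row v Q)"
      by (rule rows_indep_subset) auto
    then show ?thesis unfolding 2 by (intro exI[of _ Q])
  next
    case (3 d1 d2)
    have d: "d1 \<in> E" "u \<in> ends d1" "d2 \<in> E" "u \<in> ends d2" using 3 D by auto
    have neq: "src d1 \<noteq> tgt d1" "src d2 \<noteq> tgt d2" using sp'(3) d by auto
    have bars: "ends d1 \<noteq> ends d2" if "is_bar d1" "is_bar d2"
      using sp'(5)[OF d(1,3) that] 3(2) by auto
    have labels: "label d1 \<noteq> label d2" if "\<not> is_bar d1" "\<not> is_bar d2"
      using sp'(6)[OF d(1,3) that] 3(2) by auto
    show ?thesis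
    proof (cases "is_bar d1 \<or> \<not> is_bar d2")
      case True
      then show ?thesis unfolding 3(1)
        by (rule local_rank_two[OF d(2,4) neq]) (auto simp: bars labels)
    next
      case False
      then have "\<exists>Q. rows_indep {d2, d1} ({u} \<times> {..<2}) (edge_row v Q)"
        by (intro local_rank_two[OF d(4,2) neq(2,1)]) auto
      moreover have "{d2, d1} = D" unfolding 3(1) by (rule insert_commute)
      ultimately show ?thesis by (simp del: edge_row.simps)
    qed
  qed
qed

text \<open>In the columns of \<open>u\<close> only the edges of \<open>D\<close> are nonzero, so
  the matrix is block triangular. Each block is independent for some parameters, hence both are for
  common ones. Two columns of \<open>u\<close> suffice, even if \<open>u = v\<close>.\<close>

lemma zero_extension:
  assumes sp: "sparse v V E" and u: "u \<in> V"
    and D: "D = {e\<in>E. u \<in> ends e}" "card D \<le> 2"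
    and rest: "generically_indep v (V - {u}) (E - D)"
  shows "generically_indep v V E"
proof -
  note sp' = sparseD[OF sp]
  have fin: "finite D" "finite (E - D)" using sp'(2) D by auto
  have finK: "finite ((V - {u}) \<times> {..<3::nat})" "finite ({u} \<times> {..<2::nat})" using sp'(1) by auto
  obtain Q1 where Q1: "rows_indep (E - D) ((V - {u}) \<times> {..<3}) (edge_row v Q1)" using rest by blast
  have "D \<subseteq> E" "\<And>e. e \<in> D \<Longrightarrow> u \<in> ends e" using D(1) by auto
  from local_rank_le_two[OF sp this D(2)]
  obtain Q2 where Q2: "rows_indep D ({u} \<times> {..<2}) (edge_row v Q2)" ..
  obtain f where f: "rat_polyfun UNIV f" "f Q1 \<noteq> 0"
    "\<And>Q. f Q \<noteq> 0 \<Longrightarrow> rows_indep (E - D) ((V - {u}) \<times> {..<3}) (edge_row v Q)"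
    using rows_indep_open[of "E - D" "(V - {u}) \<times> {..<3}" UNIV "edge_row v", OF fin(2) finK(1) rat_polyfun_row_UNIV Q1]
    by blast
  obtain g where g: "rat_polyfun UNIV g" "g Q2 \<noteq> 0"
    "\<And>Q. g Q \<noteq> 0 \<Longrightarrow> rows_indep D ({u} \<times> {..<2}) (edge_row v Q)"
    using rows_indep_open[of D "{u} \<times> {..<2}" UNIV "edge_row v", OF fin(1) finK(2) rat_polyfun_row_UNIV Q2] by blast
  obtain Q where Q: "f Q \<noteq> 0" "g Q \<noteq> 0"
    using rat_polyfun_common_nonzero[OF f(1,2) g(1,2)] by blast
  have "rows_indep E (V \<times> {..<3}) (edge_row v Q)" unfolding rows_indep_def
  proof (intro allI impI)
    fix \<omega> assume \<omega>: "\<forall>k\<in>V \<times> {..<3}. (\<Sum>e\<in>E. \<omega> e * edge_row v Q e k) = 0"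
    have split: "(\<Sum>e\<in>E. \<omega> e * edge_row v Q e k) =
        (\<Sum>e\<in>E - D. \<omega> e * edge_row v Q e k) + (\<Sum>e\<in>D. \<omega> e * edge_row v Q e k)" for k
      using D(1) sp'(2) by (intro sum.subset_diff) auto
    have "(\<Sum>e\<in>D. \<omega> e * edge_row v Q e k) = 0" if "k \<in> {u} \<times> {..<2}" for k
    proof -
      have 0: "(\<Sum>e\<in>E - D. \<omega> e * edge_row v Q e k) = 0"
        using that D(1) by (intro sum.neutral) (auto simp: ends_def)
      have "k \<in> V \<times> {..<3}" using that u by auto
      then have "(\<Sum>e\<in>E. \<omega> e * edge_row v Q e k) = 0" using \<omega> by blast
      with 0 show ?thesis using split[of k] by linarith
    qed
    then have \<omega>D: "\<forall>e\<in>D. \<omega> e = 0" using g(3)[OF Q(2)] unfolding rows_indep_def by blast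
    then have "(\<Sum>e\<in>D. \<omega> e * edge_row v Q e k) = 0" for k by simp
    then have "(\<Sum>e\<in>E - D. \<omega> e * edge_row v Q e k) = 0" if "k \<in> (V - {u}) \<times> {..<3}" for k
    proof -
      have "k \<in> V \<times> {..<3}" using that by auto
      then have "(\<Sum>e\<in>E. \<omega> e * edge_row v Q e k) = 0" using \<omega> by blast
      then show ?thesis using split[of k] \<open>(\<Sum>e\<in>D. \<omega> e * edge_row v Q e k) = 0\<close> by linarith
    qed
    then have "\<forall>e\<in>E - D. \<omega> e = 0" using f(3)[OF Q(1)] unfolding rows_indep_def by blast
    then show "\<forall>e\<in>E. \<omega> e = 0" using \<omega>D by blast
  qed
  then show ?thesis by blast
qed

text \<open>The coefficients as seen from the end \<open>u\<close>: reversing an edge changes the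
  sign of the angular and the vertical one, while the radial one is symmetric.\<close>

definition end_coeff :: "'a \<Rightarrow> ('a par \<Rightarrow> real) \<Rightarrow> 'a edge \<Rightarrow> nat \<Rightarrow> real" where
  "end_coeff u Q e j = (if src e = u \<or> j = 2 then edge_coeff Q e j else - edge_coeff Q e j)"

lemma strain_from_end:
  assumes "u \<in> ends e" "src e \<noteq> tgt e" "u \<noteq> v"
  shows "strain v Q e m = end_coeff u Q e 0 * m (u, 0) + end_coeff u Q e 1 * m (u, 1)
    - end_strain v m (other u e) (end_coeff u Q e)"
  using assms unfolding strain_def end_coeff_def end_strain_def other_def ends_def
  by (auto simp: algebra_simps)

lemma end_coeff_bar:
  assumes "is_bar e" "u \<in> ends e" "src e \<noteq> tgt e" "j \<le> 2"
  shows "end_coeff u Q e j = bar_coeff (Q (PosS u)) (Q (PosZ u)) (Q (PosS (other u e))) (Q (PosZ (other u e))) j"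
proof -
  have "j = 0 \<or> j = 1 \<or> j = 2" using assms(4) by linarith
  moreover obtain x y where "e = Bar x y" using assms(1) by (cases e) auto
  ultimately show ?thesis using assms
    by (auto simp: end_coeff_def other_def ends_def algebra_simps power2_eq_square)
qed

lemma edge_coeff_cong:
  assumes "\<And>x. x \<in> ends e \<Longrightarrow> Q (PosS x) = R (PosS x) \<and> Q (PosZ x) = R (PosZ x)"
    and "\<And>j. \<not> is_bar e \<Longrightarrow> Q (Coef (label e) j) = R (Coef (label e) j)"
  shows "edge_coeff Q e j = edge_coeff R e j"
  using assms by (cases e) (auto simp: ends_def)

text \<open>The position of \<open>u\<close> and the labels of the free edges at \<open>u\<close> do
  not occur in the other edges, so the edges at \<open>u\<close> can be given any admissible
  coefficients without disturbing the rest.\<close>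

lemma realize_coefficients:
  fixes Q :: "'a par \<Rightarrow> real" and \<tau> :: "'a edge \<Rightarrow> nat \<Rightarrow> real"
  assumes "sparse v V E" "D = {e\<in>E. u \<in> ends e}"
    and "\<And>e. e \<in> D \<Longrightarrow> is_bar e \<Longrightarrow>
      \<tau> e = bar_coeff s z (Q (PosS (other u e))) (Q (PosZ (other u e)))"
  obtains R where "\<And>e j. e \<in> E - D \<Longrightarrow> edge_coeff R e j = edge_coeff Q e j"
    and "\<And>e j. e \<in> D \<Longrightarrow> j \<le> 2 \<Longrightarrow> end_coeff u R e j = \<tau> e j"
proof -
  note sp = sparseD[OF assms(1)]
  define R where "R p = (case p of PosS x \<Rightarrow> if x = u then s else Q p | PosZ x \<Rightarrow> if x = u then z else Q p
    | Coef k j \<Rightarrow> (if \<exists>e\<in>D. \<not> is_bar e \<and> label e = k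
        then (let e = (THE e. e \<in> D \<and> \<not> is_bar e \<and> label e = k) in
          if src e = u \<or> j = 2 then \<tau> e j else - \<tau> e j) else Q p))" for p
  have "edge_coeff R e j = edge_coeff Q e j" if e: "e \<in> E - D" for e j
  proof (rule edge_coeff_cong)
    fix x assume "x \<in> ends e"
    then have "x \<noteq> u" using e assms(2) by auto
    then show "R (PosS x) = Q (PosS x) \<and> R (PosZ x) = Q (PosZ x)" by (simp add: R_def)
  next
    fix j assume "\<not> is_bar e"
    moreover have "e \<in> E" "e \<notin> D" using e by auto
    ultimately have "\<not> (\<exists>f\<in>D. \<not> is_bar f \<and> label f = label e)"
      using sp(6)[OF \<open>e \<in> E\<close>] assms(2) by (metis (no_types, lifting) mem_Collect_eq)
    then show "R (Coef (label e) j) = Q (Coef (label e) j)" unfolding R_def par.case by (simp only: if_False)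
  qed
  moreover have "end_coeff u R e j = \<tau> e j" if e: "e \<in> D" and j: "j \<le> 2" for e j
  proof (cases "is_bar e")
    case True
    have eE: "e \<in> E" "u \<in> ends e" using e assms(2) by auto
    then have "other u e \<noteq> u" using sp(3)[OF eE(1)] by (auto simp: other_def ends_def)
    then show ?thesis
      unfolding end_coeff_bar[OF True eE(2) sp(3)[OF eE(1)] j] assms(3)[OF e True]
      by (simp add: R_def)
  next
    case False
    have "(THE f. f \<in> D \<and> \<not> is_bar f \<and> label f = label e) = e"
      using e False sp(6)[of _ e] assms(2) by (intro the_equality) auto
    then have "R (Coef (label e) j) = (if src e = u \<or> j = 2 then \<tau> e j else - \<tau> e j)"
      using e False by (auto simp: R_def)
    moreover have "edge_coeff R e j = R (Coef (label e) j)" using False by (cases e) auto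
    ultimately show ?thesis by (simp add: end_coeff_def)
  qed
  ultimately show thesis by (rule that)
qed

text \<open>Three edges on two vertices exceed the bound \<open>2 * 2 - 2\<close> unless
  \<open>v\<close> is one of the two.\<close>

lemma degree_three_single_neighbour:
  assumes sp: "sparse v V E" and u: "u \<in> V" "u \<noteq> v"
    and D: "D = {e\<in>E. u \<in> ends e}" "card D = 3" "other u ` D \<subseteq> {w}"
  shows "w = v"
proof (rule ccontr)
  assume ne: "w \<noteq> v"
  note sp' = sparseD[OF sp]
  have ends_D: "ends e = {u, w}" if "e \<in> D" for e
  proof -
    have "other u e = w" using that D(3) by auto
    then show ?thesis using that D(1) by (auto simp: ends_def other_def)
  qed
  obtain e where "e \<in> D" using D(2) by fastforce
  then have "w \<in> V" using ends_D[of e] sp'(4)[of e] D(1) by auto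
  have "D \<subseteq> {e\<in>E. ends e \<subseteq> {u, w}}" using ends_D D(1) by auto
  then have "3 \<le> card {e\<in>E. ends e \<subseteq> {u, w}}"
    unfolding D(2)[symmetric] using sp'(2) by (intro card_mono) auto
  moreover have "card {e\<in>E. ends e \<subseteq> {u, w}} + 2 \<le> 2 * card {u, w} + of_bool (v \<in> {u, w})"
    using u(1) \<open>w \<in> V\<close> by (intro sp'(7)) auto
  moreover have "card {u, w} \<le> 2" by (simp add: card_insert_if)
  ultimately show False using ne u(2) by auto
qed

text \<open>A stress pairs to zero with the strains of every motion. Three motions that strain only
  edges at \<open>u\<close> give three equations for the stress on \<open>D\<close>; their
  determinant is the one in \<open>solvable\<close>, so the stress lives on \<open>E - D\<close> and
  vanishes there too.\<close>

lemma one_extension: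
  assumes sp: "sparse v V E" and u: "u \<in> V" "u \<noteq> v"
    and D: "D = {e\<in>E. u \<in> ends e}" "card D = 3"
    and rest: "rows_indep (E - D) ((V - {u}) \<times> {..<3}) (edge_row v Q)"
    and pos: "\<And>x y. x \<in> V \<Longrightarrow> y \<in> V \<Longrightarrow> x \<noteq> y \<Longrightarrow>
      Q (PosS x) \<noteq> Q (PosS y) \<and> 1 + Q (PosS x) * Q (PosS y) \<noteq> 0"
    and m: "\<And>e. e \<in> E - D \<Longrightarrow> strain v Q e m = 0"
    and nontriv: "(\<exists>x\<in>other u ` D. \<exists>y\<in>other u ` D. \<exists>i\<le>1. m (x, i) \<noteq> m (y, i)) \<or>
      (v \<in> other u ` D \<and> m (v, 2) \<noteq> 0)"
  shows "generically_indep v V E"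
proof -
  note sp' = sparseD[OF sp]
  obtain d1 d2 d3 where d: "D = {d1, d2, d3}" "d1 \<noteq> d2" "d1 \<noteq> d3" "d2 \<noteq> d3"
    using D(2) unfolding card_3_iff by auto
  have at: "u \<in> ends e" "src e \<noteq> tgt e" "ends e = {u, other u e}" "other u e \<in> V" "other u e \<noteq> u" "e \<in> E"
    if "e \<in> D" for e
    using that D(1) sp'(3)[of e] sp'(4)[of e] by (auto simp: ends_def other_def)
  define S where "S x = Q (PosS x)" for x
  define Z where "Z x = Q (PosZ x)" for x
  let ?d = "\<lambda>e. (other u e, \<not> is_bar e)"
  have ot: "other u ` D = {other u d1, other u d2, other u d3}" unfolding d(1) by simp
  have bars: "other u e \<noteq> other u f" if "e \<in> D" "f \<in> D" "e \<noteq> f" "is_bar e" "is_bar f" for e f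
    using sp'(5)[OF at(6)[OF that(1)] at(6)[OF that(2)] that(4,5)] at(3)[OF that(1)] at(3)[OF that(2)] that(3)
    by auto
  have triple: "other u d1 = v" if "other u d1 = other u d2" "other u d2 = other u d3"
    by (rule degree_three_single_neighbour[OF sp u D]) (simp add: that ot)
  have "solvable v S Z m (?d d1) (?d d2) (?d d3)"
  proof (rule solvable_general)
    fix x y assume "x \<in> {other u d1, other u d2, other u d3}" "y \<in> {other u d1, other u d2, other u d3}" "x \<noteq> y"
    then show "S x \<noteq> S y \<and> 1 + S x * S y \<noteq> 0"
      using pos[of x y] at(4) unfolding ot[symmetric] S_def by auto
  next
    show "other u d1 \<noteq> other u d2" if "\<not> \<not> is_bar d1" "\<not> \<not> is_bar d2"
      using bars[of d1 d2] that d by auto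
    show "other u d1 \<noteq> other u d3" if "\<not> \<not> is_bar d1" "\<not> \<not> is_bar d3"
      using bars[of d1 d3] that d by auto
    show "other u d2 \<noteq> other u d3" if "\<not> \<not> is_bar d2" "\<not> \<not> is_bar d3"
      using bars[of d2 d3] that d by auto
  next
    show "(\<exists>x\<in>{other u d1, other u d2, other u d3}. \<exists>y\<in>{other u d1, other u d2, other u d3}.
        \<exists>i\<le>1. m (x, i) \<noteq> m (y, i)) \<or> v \<in> {other u d1, other u d2, other u d3} \<and> m (v, 2) \<noteq> 0"
      using nontriv unfolding ot .
  qed (rule triple)
  then obtain s z \<tau>1 \<tau>2 \<tau>3 where
    bar: "\<forall>(d, \<tau>)\<in>{(?d d1, \<tau>1), (?d d2, \<tau>2), (?d d3, \<tau>3)}.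
        \<not> snd d \<longrightarrow> \<tau> = bar_coeff s z (S (fst d)) (Z (fst d))"
    and det: "det3 (\<tau>1 0) (\<tau>1 1) (end_strain v m (other u d1) \<tau>1)
       (\<tau>2 0) (\<tau>2 1) (end_strain v m (other u d2) \<tau>2)
       (\<tau>3 0) (\<tau>3 1) (end_strain v m (other u d3) \<tau>3) \<noteq> 0"
    unfolding solvable_def fst_conv by blast
  define \<tau> where "\<tau> e = (if e = d1 then \<tau>1 else if e = d2 then \<tau>2 else \<tau>3)" for e
  have "\<tau> e = bar_coeff s z (Q (PosS (other u e))) (Q (PosZ (other u e)))" if "e \<in> D" "is_bar e" for e
    using bar that d(2-4) unfolding d(1) by (auto simp: \<tau>_def S_def Z_def)
  then obtain R where R: "\<And>e j. e \<in> E - D \<Longrightarrow> edge_coeff R e j = edge_coeff Q e j"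
    "\<And>e j. e \<in> D \<Longrightarrow> j \<le> 2 \<Longrightarrow> end_coeff u R e j = \<tau> e j"
    using realize_coefficients[OF sp D(1), of \<tau> s z Q] by metis
  have rowR: "edge_row v R e k = edge_row v Q e k" if "e \<in> E - D" for e k
    using R(1)[OF that] by (cases k) simp
  have "rows_indep E (V \<times> {..<3}) (edge_row v R)" unfolding rows_indep_def
  proof (intro allI impI)
    fix \<omega> assume \<omega>: "\<forall>k\<in>V \<times> {..<3}. (\<Sum>e\<in>E. \<omega> e * edge_row v R e k) = 0"
    have split: "(\<Sum>e\<in>E. f e) = (\<Sum>e\<in>E - D. f e) + (\<Sum>e\<in>D. f e)" for f :: "'a edge \<Rightarrow> real"
      using D(1) sp'(2) by (intro sum.subset_diff) auto
    have sumD: "(\<Sum>e\<in>D. \<omega> e * strain v R e m') = 0"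
      if "\<And>e. e \<in> E - D \<Longrightarrow> strain v R e m' = 0" for m'
    proof -
      have "(\<Sum>e\<in>E. \<omega> e * strain v R e m') = 0"
        using stress_strain[OF sp'(1) sp'(4) \<omega>] .
      moreover have "(\<Sum>e\<in>E - D. \<omega> e * strain v R e m') = 0" using that by simp
      ultimately show ?thesis unfolding split by simp
    qed
    have far: "src e \<noteq> u \<and> tgt e \<noteq> u" if "e \<in> E - D" for e
      using that D(1) by (auto simp: ends_def)
    have unit: "(\<Sum>e\<in>D. \<omega> e * \<tau> e i) = 0" if "i \<le> 1" for i
    proof -
      define n where "n k = (if k = (u, i) then 1 else 0 :: real)" for k
      have "strain v R e n = 0" if "e \<in> E - D" for e
        using far[OF that] u(2) by (simp add: strain_def n_def)
      moreover have "strain v R e n = \<tau> e i" if e: "e \<in> D" for e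
        using strain_from_end[OF at(1,2)[OF e] u(2), of R n] at(5)[OF e] u(2) R(2)[OF e] \<open>i \<le> 1\<close>
        by (auto simp: n_def end_strain_def le_Suc_eq)
      ultimately show ?thesis using sumD[of n] by simp
    qed
    \<comment> \<open>The third test motion, after the two unit velocities of \<open>u\<close>:
      \<open>m\<close> with \<open>u\<close> held fixed.\<close>
    define n where "n k = (if fst k = u then 0 else m k)" for k
    have "strain v R e n = 0" if "e \<in> E - D" for e
    proof -
      have "strain v R e n = strain v Q e m"
        using far[OF that] u(2) R(1)[OF that] by (simp add: strain_def n_def)
      then show ?thesis using m that by simp
    qed
    moreover have "strain v R e n = - end_strain v m (other u e) (\<tau> e)" if e: "e \<in> D" for e
      using strain_from_end[OF at(1,2)[OF e] u(2), of R n] at(5)[OF e] u(2) R(2)[OF e]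
      by (auto simp: n_def end_strain_def)
    ultimately have "(\<Sum>e\<in>D. \<omega> e * end_strain v m (other u e) (\<tau> e)) = 0"
      using sumD[of n] by (simp add: sum_negf)
    moreover have sum_d: "(\<Sum>e\<in>D. f e) = f d1 + f d2 + f d3" for f :: "'a edge \<Rightarrow> real"
      unfolding d(1) using d by simp
    ultimately have "\<omega> d1 = 0 \<and> \<omega> d2 = 0 \<and> \<omega> d3 = 0"
      using unit[of 0] unit[of 1] d(2-4)
      by (intro det3_left_kernel[OF det]) (auto simp: sum_d \<tau>_def)
    then have \<omega>D: "\<forall>e\<in>D. \<omega> e = 0" unfolding d(1) by simp
    have "(\<Sum>e\<in>E - D. \<omega> e * edge_row v Q e k) = 0" if "k \<in> (V - {u}) \<times> {..<3}" for k
    proof -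
      have "k \<in> V \<times> {..<3}" using that by auto
      then have "(\<Sum>e\<in>E. \<omega> e * edge_row v R e k) = 0" using \<omega> by blast
      moreover have "(\<Sum>e\<in>D. \<omega> e * edge_row v R e k) = 0" using \<omega>D by (intro sum.neutral) auto
      moreover have "(\<Sum>e\<in>E - D. \<omega> e * edge_row v R e k) = (\<Sum>e\<in>E - D. \<omega> e * edge_row v Q e k)"
        by (intro sum.cong refl) (simp only: rowR)
      ultimately show ?thesis unfolding split by linarith
    qed
    then have "\<forall>e\<in>E - D. \<omega> e = 0" using rest unfolding rows_indep_def by blast
    then show "\<forall>e\<in>E. \<omega> e = 0" using \<omega>D by blast
  qed
  then show ?thesis by (intro exI[of _ R])
qed

text \<open>Placing a vertex requires neighbours at different and not opposite angles. These are
  polynomial conditions too, so they can be imposed together with independence.\<close>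

lemma generic_positions:
  assumes "finite V" "finite E" "rows_indep E K (edge_row v Q0)" "finite K"
  obtains Q where "rows_indep E K (edge_row v Q)"
    and "\<And>x y. x \<in> V \<Longrightarrow> y \<in> V \<Longrightarrow> x \<noteq> y \<Longrightarrow>
      Q (PosS x) \<noteq> Q (PosS y) \<and> 1 + Q (PosS x) * Q (PosS y) \<noteq> 0"
proof -
  obtain f where f: "rat_polyfun UNIV f" "f Q0 \<noteq> 0"
    "\<And>Q. f Q \<noteq> 0 \<Longrightarrow> rows_indep E K (edge_row v Q)"
    using rows_indep_open[of E K UNIV "edge_row v", OF assms(2,4) rat_polyfun_row_UNIV assms(3)] by blast
  define P where "P = {(x, y). x \<in> V \<and> y \<in> V \<and> x \<noteq> y}"
  define g where "g Q = (\<Prod>(x, y)\<in>P. (Q (PosS x) - Q (PosS y)) * (1 + Q (PosS x) * Q (PosS y)))"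
    for Q :: "'a par \<Rightarrow> real"
  have finP: "finite P"
    by (rule finite_subset[of _ "V \<times> V"]) (use assms(1) in \<open>auto simp: P_def\<close>)
  have g: "rat_polyfun UNIV g"
    unfolding g_def case_prod_unfold by (intro rpf) auto
  obtain \<iota> :: "'a \<Rightarrow> nat" where \<iota>: "inj_on \<iota> V"
    using assms(1) finite_imp_inj_to_nat_seg by metis
  \<comment> \<open>Distinct nonnegative values, for which \<open>1 + s * t\<close> is
    positive.\<close>
  define Q1 where "Q1 p = (case p of PosS x \<Rightarrow> real (\<iota> x) | _ \<Rightarrow> 0)" for p
  have "1 + real a * real b \<noteq> 0" for a b
    by (metis add_cancel_left_left add_nonneg_eq_0_iff mult_nonneg_nonneg of_nat_0_le_iff zero_le_one zero_neq_one)
  then have "g Q1 \<noteq> 0"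
    using \<iota> finP by (auto simp: g_def Q1_def P_def inj_on_def)
  with f g obtain Q where Q: "f Q \<noteq> 0" "g Q \<noteq> 0" using rat_polyfun_common_nonzero by blast
  show thesis
  proof (rule that)
    show "rows_indep E K (edge_row v Q)" using f(3) Q(1) .
    fix x y assume "x \<in> V" "y \<in> V" "x \<noteq> y"
    then have "(x, y) \<in> P" by (simp add: P_def)
    then have "(Q (PosS x) - Q (PosS y)) * (1 + Q (PosS x) * Q (PosS y)) \<noteq> 0"
      using Q(2) finP unfolding g_def by (auto simp: prod_zero_iff)
    then show "Q (PosS x) \<noteq> Q (PosS y) \<and> 1 + Q (PosS x) * Q (PosS y) \<noteq> 0" by auto
  qed
qed

section \<open>Tight sets and the choice of the added edge\<close>

definition tight :: "'a \<Rightarrow> 'a edge set \<Rightarrow> 'a set \<Rightarrow> bool" where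
  "tight v E X \<longleftrightarrow> 2 * card X + of_bool (v \<in> X) \<le> card {e\<in>E. ends e \<subseteq> X} + 2"

text \<open>The number of induced edges is supermodular, the bound is modular, and sparsity applies
  to the intersection because it is nonempty.\<close>

lemma tight_Un:
  assumes sp: "sparse v V E" and "X \<subseteq> V" "Y \<subseteq> V" "X \<inter> Y \<noteq> {}" "tight v E X" "tight v E Y"
  shows "tight v E (X \<union> Y)"
proof -
  note sp' = sparseD[OF sp]
  let ?i = "\<lambda>X. {e\<in>E. ends e \<subseteq> X}"
  have fin: "finite X" "finite Y" using assms(2,3) sp'(1) finite_subset by auto
  have "card (?i X) + card (?i Y) = card (?i X \<union> ?i Y) + card (?i X \<inter> ?i Y)"
    using sp'(2) by (intro card_Un_Int) auto
  also have "?i X \<inter> ?i Y = ?i (X \<inter> Y)" by auto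
  also have "card (?i X \<union> ?i Y) \<le> card (?i (X \<union> Y))"
    using sp'(2) by (intro card_mono) auto
  finally have 1: "card (?i X) + card (?i Y) \<le> card (?i (X \<union> Y)) + card (?i (X \<inter> Y))" by simp
  have 2: "card (?i (X \<inter> Y)) + 2 \<le> 2 * card (X \<inter> Y) + of_bool (v \<in> X \<inter> Y)"
    using assms(2,4) by (intro sp'(7)) auto
  have 3: "card X + card Y = card (X \<union> Y) + card (X \<inter> Y)"
    using fin by (rule card_Un_Int)
  have 4: "of_bool (v \<in> X) + of_bool (v \<in> Y) = of_bool (v \<in> X \<union> Y) + (of_bool (v \<in> X \<inter> Y) :: nat)"
    by auto
  show ?thesis using assms(5,6) 1 2 3 4 unfolding tight_def by linarith
qed

text \<open>With a fresh label only the edge count can fail. A set where it fails contains both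
  ends, and as one edge makes the difference, it was tight before.\<close>

lemma tight_if_not_sparse_insert:
  assumes sp: "sparse v V E" and "x \<noteq> y" "x \<in> V" "y \<in> V"
    and k: "\<And>e. e \<in> E \<Longrightarrow> \<not> is_bar e \<Longrightarrow> label e \<noteq> k"
    and not: "\<not> sparse v V (insert (Free k x y) E)"
  shows "\<exists>X\<subseteq>V. x \<in> X \<and> y \<in> X \<and> tight v E X"
proof -
  note sp' = sparseD[OF sp]
  let ?f = "Free k x y"
  have f: "src ?f \<noteq> tgt ?f" "ends ?f = {x, y}" "\<not> is_bar ?f" "label ?f = k"
    using assms(2) by (auto simp: ends_def)
  have "\<not> (\<forall>X\<subseteq>V. X \<noteq> {} \<longrightarrow> card {e\<in>insert ?f E. ends e \<subseteq> X} + 2 \<le> 2 * card X + of_bool (v \<in> X))"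
  proof
    assume *: "\<forall>X\<subseteq>V. X \<noteq> {} \<longrightarrow> card {e\<in>insert ?f E. ends e \<subseteq> X} + 2 \<le> 2 * card X + of_bool (v \<in> X)"
    have "sparse v V (insert ?f E)" unfolding sparse_def
    proof (intro conjI)
      show "\<forall>e\<in>insert ?f E. src e \<noteq> tgt e \<and> ends e \<subseteq> V" using f assms(3,4) sp'(3,4) by auto
      show "\<forall>e\<in>insert ?f E. \<forall>g\<in>insert ?f E. is_bar e \<longrightarrow> is_bar g \<longrightarrow> ends e = ends g \<longrightarrow> e = g"
        using f sp'(5) by auto
      show "\<forall>e\<in>insert ?f E. \<forall>g\<in>insert ?f E. \<not> is_bar e \<longrightarrow> \<not> is_bar g \<longrightarrow> label e = label g \<longrightarrow> e = g"
        using k sp'(6) by auto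
    qed (use sp'(1,2) * in auto)
    then show False using not by blast
  qed
  then obtain X where X: "X \<subseteq> V" "X \<noteq> {}"
    "2 * card X + of_bool (v \<in> X) < card {e\<in>insert ?f E. ends e \<subseteq> X} + 2" by (auto simp: not_le)
  have "x \<in> X \<and> y \<in> X"
  proof (rule ccontr)
    assume "\<not> ?thesis"
    then have "{e\<in>insert ?f E. ends e \<subseteq> X} = {e\<in>E. ends e \<subseteq> X}" using f(2) by auto
    then show False using sp'(7)[OF X(1,2)] X(3) by simp
  qed
  moreover have "card {e\<in>insert ?f E. ends e \<subseteq> X} \<le> card {e\<in>E. ends e \<subseteq> X} + 1"
  proof -
    have "{e\<in>insert ?f E. ends e \<subseteq> X} \<subseteq> insert ?f {e\<in>E. ends e \<subseteq> X}" by auto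
    then have "card {e\<in>insert ?f E. ends e \<subseteq> X} \<le> card (insert ?f {e\<in>E. ends e \<subseteq> X})"
      using sp'(2) by (intro card_mono) auto
    also have "\<dots> \<le> card {e\<in>E. ends e \<subseteq> X} + 1" by (simp add: card_insert_le_m1 card_insert_if sp'(2))
    finally show ?thesis .
  qed
  ultimately show ?thesis using X(1,3) unfolding tight_def by (intro exI[of _ X]) auto
qed

text \<open>Adding \<open>u\<close> to \<open>X\<close> raises the bound by 2 but brings in 3
  edges.\<close>

lemma no_tight_around_degree_three:
  assumes sp: "sparse v V E" and u: "u \<in> V" "u \<noteq> v"
    and D: "D = {e\<in>E. u \<in> ends e}" "card D = 3"
    and X: "X \<subseteq> V - {u}" "other u ` D \<subseteq> X"
  shows "\<not> tight v (E - D) X"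
proof
  assume t: "tight v (E - D) X"
  note sp' = sparseD[OF sp]
  have finX: "finite X" using X(1) sp'(1) finite_subset by blast
  let ?A = "{e\<in>E - D. ends e \<subseteq> X}"
  have "?A \<union> D \<subseteq> {e\<in>E. ends e \<subseteq> insert u X}"
    using X(2) D(1) by (auto simp: ends_def other_def image_subset_iff split: if_splits)
  then have "card (?A \<union> D) \<le> card {e\<in>E. ends e \<subseteq> insert u X}"
    using sp'(2) by (intro card_mono) auto
  moreover have "card (?A \<union> D) = card ?A + 3"
    unfolding D(2)[symmetric] using sp'(2) D(1) by (intro card_Un_disjoint) auto
  moreover have "card {e\<in>E. ends e \<subseteq> insert u X} + 2 \<le> 2 * card (insert u X) + of_bool (v \<in> insert u X)"
    using u X by (intro sp'(7)) auto
  moreover have "card (insert u X) = Suc (card X)" using X(1) finX by (subst card_insert_disjoint) auto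
  moreover have "of_bool (v \<in> insert u X) = (of_bool (v \<in> X) :: nat)" using u(2) by simp
  ultimately show False using t unfolding tight_def by linarith
qed

text \<open>An edge between \<open>x\<close> and \<open>y\<close> is rejected only if some tight set contains both. If all edges from
  one neighbour \<open>x\<close> of \<open>u\<close> to the others were rejected, the tight sets, which all contain \<open>x\<close>, would
  unite to a tight set around \<open>u\<close>.\<close>

lemma exists_detecting_edge:
  assumes sp: "sparse v V E" and u: "u \<in> V" "u \<noteq> v"
    and D: "D = {e\<in>E. u \<in> ends e}" "card D = 3" and N: "\<not> (\<exists>w. other u ` D \<subseteq> {w})"
    and k: "\<And>e. e \<in> E \<Longrightarrow> \<not> is_bar e \<Longrightarrow> label e \<noteq> k"
  shows "\<exists>x\<in>other u ` D. \<exists>y\<in>other u ` D. x \<noteq> y \<and> sparse v (V - {u}) (insert (Free k x y) (E - D))"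
    (is ?goal)
proof (rule ccontr)
  assume no: "\<not> ?thesis"
  note sp' = sparseD[OF sp]
  have sp1: "sparse v (V - {u}) (E - D)"
    using sp'(4) D(1) by (intro sparse_subset[OF sp]) auto
  have NV: "other u ` D \<subseteq> V - {u}"
  proof (rule image_subsetI)
    fix e assume "e \<in> D"
    then show "other u e \<in> V - {u}"
      using D(1) sp'(3)[of e] sp'(4)[of e] by (auto simp: ends_def other_def)
  qed
  obtain x where x: "x \<in> other u ` D" using N by blast
  have step: "\<exists>X\<subseteq>V - {u}. x \<in> X \<and> y \<in> X \<and> tight v (E - D) X" if "y \<in> other u ` D" "y \<noteq> x" for y
  proof (rule tight_if_not_sparse_insert[OF sp1])
    show "\<not> sparse v (V - {u}) (insert (Free k x y) (E - D))"
    proof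
      assume "sparse v (V - {u}) (insert (Free k x y) (E - D))"
      then have "?goal"
        using x that by (intro bexI[of _ x] bexI[of _ y] conjI) simp_all
      with no show False ..
    qed
    show "x \<noteq> y" using that(2) by simp
    show "x \<in> V - {u}" "y \<in> V - {u}" using NV x that(1) by (simp_all only: subsetD)
    show "label e \<noteq> k" if "e \<in> E - D" "\<not> is_bar e" for e using k[of e] that by simp
  qed
  have "finite D" using D(2) by (intro card_ge_0_finite) simp
  then have fin: "finite (other u ` D - {x})" by simp
  \<comment> \<open>The union cannot start from \<open>{x}\<close>, which is not tight if
    \<open>x = v\<close>.\<close>
  have un: "S \<noteq> {} \<longrightarrow> (\<exists>X\<subseteq>V - {u}. x \<in> X \<and> S \<subseteq> X \<and> tight v (E - D) X)"
    if "S \<subseteq> other u ` D - {x}" for S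
    using finite_subset[OF that fin] that
  proof (induction S rule: finite_induct)
    case empty
    show ?case by simp
  next
    case (insert y S)
    then obtain Y where Y: "Y \<subseteq> V - {u}" "x \<in> Y" "y \<in> Y" "tight v (E - D) Y"
      using step[of y] by auto
    show ?case
    proof (cases "S = {}")
      case True
      then show ?thesis using Y by auto
    next
      case False
      then obtain X where X: "X \<subseteq> V - {u}" "x \<in> X" "S \<subseteq> X" "tight v (E - D) X"
        using insert by auto
      have "tight v (E - D) (X \<union> Y)"
        using X Y by (intro tight_Un[OF sp1]) auto
      then show ?thesis using X Y by (intro impI exI[of _ "X \<union> Y"]) auto
    qed
  qed
  have "other u ` D - {x} \<noteq> {}" using N by blast
  with un[OF subset_refl] obtain X where X: "X \<subseteq> V - {u}" "x \<in> X" "other u ` D - {x} \<subseteq> X" "tight v (E - D) X" by blast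
  then have "other u ` D \<subseteq> X" by auto
  then show False using no_tight_around_degree_three[OF sp u D X(1)] X(4) by simp
qed

text \<open>The induction on the number of vertices is general in \<open>v\<close>, since in one
  case the smaller graph is considered with no free vertex.\<close>

lemma sparse_generically_indep:
  "sparse v V E \<Longrightarrow> generically_indep v V E"
proof (induction "card V" arbitrary: v V E rule: less_induct)
  case less
  note sp = less.prems
  note sp' = sparseD[OF sp]
  show ?case
  proof (cases "V = {}")
    case True
    then have "E = {}" using sp'(4) by (auto simp: ends_def)
    then show ?thesis by (simp add: rows_indep_def)
  next
    case False
    then obtain u where u: "u \<in> V" "card {e\<in>E. u \<in> ends e} \<le> (if u = v then 2 else 3)"
      using exists_low_degree[OF sp] by blast
    define D where "D = {e\<in>E. u \<in> ends e}"
    have smaller: "card (V - {u}) < card V" using u(1) sp'(1) by (intro psubset_card_mono) auto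
    have sp1: "sparse v (V - {u}) (E - D)"
      using sp'(4) by (intro sparse_subset[OF sp]) (auto simp: D_def)
    have fin: "finite (V - {u})" "finite (E - D)" "finite ((V - {u}) \<times> {..<3::nat})"
      using sp'(1,2) by auto
    have E1: "src e \<noteq> u \<and> tgt e \<noteq> u \<and> ends e \<subseteq> V - {u}" if "e \<in> E - D" for e
      using that sp'(4)[of e] by (auto simp: D_def ends_def)
    have NV: "other u ` D \<subseteq> V - {u}"
    proof (rule image_subsetI)
      fix e assume "e \<in> D"
      then show "other u e \<in> V - {u}"
        using sp'(3)[of e] sp'(4)[of e] by (auto simp: D_def ends_def other_def)
    qed
    consider "card D \<le> 2" | "card D = 3" "u \<noteq> v"
    proof -
      have "card D \<le> (if u = v then 2 else 3)" using u(2) unfolding D_def .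
      then have "card D \<le> 2 \<or> card D = 3 \<and> u \<noteq> v" by (cases "u = v") (simp, simp, linarith)
      then show thesis using that by blast
    qed
    then show ?thesis
    proof cases
      case 1
      show ?thesis
        by (rule zero_extension[OF sp u(1) D_def 1 less.hyps[OF smaller sp1]])
    next
      case 2
      note ext = one_extension[OF sp u(1) 2(2) D_def 2(1)]
      show ?thesis
      proof (cases "\<exists>w. other u ` D \<subseteq> {w}")
        case True
        then obtain w where w: "other u ` D \<subseteq> {w}" by blast
        then have "w = v" by (rule degree_three_single_neighbour[OF sp u(1) 2(2) D_def 2(1)])
        moreover have "D \<noteq> {}" using 2(1) by auto
        ultimately have N: "other u ` D = {v}" using w by blast
        \<comment> \<open>\<open>u\<close> takes the role of \<open>v\<close> here: it is not in \<open>V - {u}\<close>, so no vertex is free. Independence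
          without the radial coordinate allows correcting any radial velocity of \<open>v\<close> to a motion.\<close>
        have "sparse u (V - {u}) (E - D)"
        proof -
          note sp1' = sparseD[OF sp1]
          have "card {e\<in>E - D. ends e \<subseteq> X} + 2 \<le> 2 * card X + of_bool (u \<in> X)"
            if X: "X \<subseteq> V - {u}" "X \<noteq> {}" for X
          proof (cases "v \<in> X")
            case True
            \<comment> \<open>\<open>X\<close> contains \<open>v\<close>, the only neighbour of
              \<open>u\<close>, and is therefore not tight; this slack pays for the extra edge that
              is no longer granted.\<close>
            then have "\<not> tight v (E - D) X"
              using N X(1) by (intro no_tight_around_degree_three[OF sp u(1) 2(2) D_def 2(1)]) auto
            then show ?thesis using True unfolding tight_def by auto
          next
            case False
            then show ?thesis using sp1'(7)[OF X] by simp
          qed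
          then show ?thesis using sp1 unfolding sparse_def by simp
        qed
        from less.hyps[OF smaller this]
        obtain Q0 where "rows_indep (E - D) ((V - {u}) \<times> {..<3}) (edge_row u Q0)" ..
        then obtain Q where Q: "rows_indep (E - D) ((V - {u}) \<times> {..<3}) (edge_row u Q)"
          and pos: "\<And>x y. x \<in> V \<Longrightarrow> y \<in> V \<Longrightarrow> x \<noteq> y \<Longrightarrow>
            Q (PosS x) \<noteq> Q (PosS y) \<and> 1 + Q (PosS x) * Q (PosS y) \<noteq> 0"
          using generic_positions[OF sp'(1) fin(2) _ fin(3)] by metis
        \<comment> \<open>Making \<open>v\<close> free only fills the zero column
          \<open>(v, 2)\<close>, so independence persists.\<close>
        have indep: "rows_indep (E - D) ((V - {u}) \<times> {..<3}) (edge_row v Q)"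
          unfolding rows_indep_def
        proof (intro allI impI)
          fix \<omega> assume \<omega>: "\<forall>k\<in>(V - {u}) \<times> {..<3}. (\<Sum>e\<in>E - D. \<omega> e * edge_row v Q e k) = 0"
          have "(\<Sum>e\<in>E - D. \<omega> e * edge_row u Q e k) = 0" if k: "k \<in> (V - {u}) \<times> {..<3}" for k
          proof (cases "snd k < 2")
            case True
            then have "edge_row u Q e k = edge_row v Q e k" for e by (cases k) simp
            then show ?thesis using bspec[OF \<omega> k] by (simp only:)
          next
            case False
            then have "edge_row u Q e k = 0" for e using k by (cases k) auto
            then show ?thesis by simp
          qed
          then show "\<forall>e\<in>E - D. \<omega> e = 0" using Q unfolding rows_indep_def by blast
        qed
        have "\<exists>m. \<forall>e\<in>E - D. strain u Q e m = of_bool (e = f)" if "f \<in> E - D" for f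
          using E1 that by (intro dual_motion[OF fin(1,2) _ Q]) auto
        then obtain g where g: "\<And>e f. e \<in> E - D \<Longrightarrow> f \<in> E - D \<Longrightarrow> strain u Q e (g f) = of_bool (e = f)"
          by metis
        \<comment> \<open>\<open>\<gamma> f\<close> is the strain that a unit radial velocity of
          \<open>v\<close> causes in \<open>f\<close>; the dual motions cancel it.\<close>
        define \<gamma> where "\<gamma> f = (if v \<in> ends f then edge_coeff Q f 2 else 0)" for f
        define m where "m k = (if k = (v, 2) then 1 else - (\<Sum>f\<in>E - D. \<gamma> f * g f k))" for k
        have m0: "strain v Q e m = 0" if e: "e \<in> E - D" for e
        proof -
          have "u \<notin> ends e" using E1[OF e] by (auto simp: ends_def)
          then have "strain v Q e m = \<gamma> e - (\<Sum>f\<in>E - D. \<gamma> f * strain u Q e (g f))"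
            by (simp add: strain_def m_def \<gamma>_def algebra_simps sum.distrib sum_distrib_left sum_subtractf)
          also have "(\<Sum>f\<in>E - D. \<gamma> f * strain u Q e (g f)) = (\<Sum>f\<in>E - D. if e = f then \<gamma> f else 0)"
            using g e by (intro sum.cong) auto
          also have "\<dots> = \<gamma> e" using fin(2) e by (simp only: sum.delta' if_True)
          finally show ?thesis by simp
        qed
        show ?thesis
        proof (rule ext[OF indep, where m = m])
          show "Q (PosS x) \<noteq> Q (PosS y) \<and> 1 + Q (PosS x) * Q (PosS y) \<noteq> 0"
            if "x \<in> V" "y \<in> V" "x \<noteq> y" for x y
            using that by (rule pos)
        qed (simp_all add: m0 N m_def)
      next
        case False
        \<comment> \<open>A fresh label makes the test edge different from every edge of
          \<open>E\<close>, even from those parallel to it.\<close>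
        obtain k where k: "k \<notin> label ` E" using sp'(2) ex_new_if_finite[OF infinite_UNIV_nat] by blast
        then have k': "label e \<noteq> k" if "e \<in> E" for e using that by blast
        obtain x y where xy: "x \<in> other u ` D" "y \<in> other u ` D" "x \<noteq> y"
          and spf: "sparse v (V - {u}) (insert (Free k x y) (E - D))"
          using exists_detecting_edge[OF sp u(1) 2(2) D_def 2(1) False k'] by blast
        let ?f = "Free k x y" and ?F = "insert (Free k x y) (E - D)"
        have finF: "finite ?F" using fin(2) by simp
        from less.hyps[OF smaller spf]
        obtain Q0 where "rows_indep ?F ((V - {u}) \<times> {..<3}) (edge_row v Q0)" ..
        then obtain Q where Q: "rows_indep ?F ((V - {u}) \<times> {..<3}) (edge_row v Q)"
          and pos: "\<And>x y. x \<in> V \<Longrightarrow> y \<in> V \<Longrightarrow> x \<noteq> y \<Longrightarrow>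
            Q (PosS x) \<noteq> Q (PosS y) \<and> 1 + Q (PosS x) * Q (PosS y) \<noteq> 0"
          using generic_positions[OF sp'(1) finF _ fin(3)] by metis
        have indep: "rows_indep (E - D) ((V - {u}) \<times> {..<3}) (edge_row v Q)"
          using Q finF by (intro rows_indep_subset[OF Q]) auto
        have "ends e \<subseteq> V - {u}" if "e \<in> ?F" for e
          using sparseD(4)[OF spf that] .
        from dual_motion[OF fin(1) finF this Q, of ?f]
        obtain m where m: "\<forall>e\<in>?F. strain v Q e m = of_bool (e = ?f)" by blast
        have "?f \<notin> E" using k'[of ?f] by auto
        then have m0: "strain v Q e m = 0" if "e \<in> E - D" for e using m that by auto
        have "strain v Q ?f m \<noteq> 0" using m by simp
        then have *: "m (x, 0) \<noteq> m (y, 0) \<or> m (x, 1) \<noteq> m (y, 1) \<or> (v \<in> {x, y} \<and> m (v, 2) \<noteq> 0)"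
          by (auto simp: strain_def ends_def split: if_splits)
        have nontriv: "(\<exists>x\<in>other u ` D. \<exists>y\<in>other u ` D. \<exists>i\<le>1. m (x, i) \<noteq> m (y, i)) \<or>
            (v \<in> other u ` D \<and> m (v, 2) \<noteq> 0)"
        proof (cases "v \<in> {x, y} \<and> m (v, 2) \<noteq> 0")
          case True
          then show ?thesis using xy by blast
        next
          case False
          then have "\<exists>i\<le>1. m (x, i) \<noteq> m (y, i)" using * by (metis le_numeral_extra(4) zero_le_one)
          then show ?thesis using xy(1,2) by (intro disjI1 bexI[of _ x] bexI[of _ y])
        qed
        show ?thesis
        proof (rule ext[OF indep, where m = m])
          show "Q (PosS x) \<noteq> Q (PosS y) \<and> 1 + Q (PosS x) * Q (PosS y) \<noteq> 0"
            if "x \<in> V" "y \<in> V" "x \<noteq> y" for x y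
            using that by (rule pos)
        qed (rule m0 nontriv | assumption)+
      qed
    qed
  qed
qed

section \<open>From circuits to sparse graphs of bars\<close>

definition bar_of :: "'a set \<Rightarrow> 'a edge" where
  "bar_of e = (SOME b. is_bar b \<and> src b \<noteq> tgt b \<and> ends b = e)"

lemma bar_of:
  assumes "card e = 2"
  shows "is_bar (bar_of e)" "src (bar_of e) \<noteq> tgt (bar_of e)" "ends (bar_of e) = e"
proof -
  obtain x y where "e = {x, y}" "x \<noteq> y" using assms card_2_iff by metis
  then have "\<exists>b. is_bar b \<and> src b \<noteq> tgt b \<and> ends b = e"
    by (intro exI[of _ "Bar x y"]) (auto simp: ends_def)
  from someI_ex[OF this] show "is_bar (bar_of e)" "src (bar_of e) \<noteq> tgt (bar_of e)"
    "ends (bar_of e) = e" unfolding bar_of_def by blast+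
qed

text \<open>A set that spans a proper part of \<open>E\<close> satisfies the count of the circuit.
  If \<open>X\<close> spans all of \<open>E\<close>, the count after deleting one edge gives
  \<open>X = V\<close>, and the remaining edge is the extra one granted because
  \<open>v \<in> V\<close>.\<close>

lemma M22_circuit_sparse:
  assumes "M22_circuit V E" "v \<in> V"
  shows "sparse v V (bar_of ` E)"
proof -
  have fin: "finite V" and edge: "\<And>e. e \<in> E \<Longrightarrow> e \<subseteq> V \<and> card e = 2"
    and cardE: "int (card E) = 2 * int (card V) - 1"
    and sub: "\<And>F. F \<noteq> {} \<Longrightarrow> F \<subset> E \<Longrightarrow> int (card F) \<le> 2 * int (card (\<Union>F)) - 2"
    using assms(1) unfolding M22_circuit_def simple_graph_def by auto
  have finE: "finite E" using fin edge by (intro finite_subset[of E "Pow V"]) auto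
  note b = bar_of[OF conjunct2[OF edge]]
  have inj: "inj_on bar_of E" using b(3) by (metis inj_onI)
  have count: "card {e\<in>E. e \<subseteq> X} + 2 \<le> 2 * card X + of_bool (v \<in> X)" if X: "X \<subseteq> V" "X \<noteq> {}" for X
  proof -
    let ?F = "{e\<in>E. e \<subseteq> X}"
    have finX: "finite X" using X(1) fin finite_subset by blast
    then have X1: "card X \<ge> 1" using X(2) by (simp add: Suc_le_eq card_gt_0_iff)
    consider "?F = {}" | "?F \<noteq> {}" "?F \<subset> E" | "?F = E" "E \<noteq> {}" by blast
    then show ?thesis
    proof cases
      case 1
      show ?thesis unfolding 1 using X1 by simp
    next
      case 2
      have "card (\<Union>?F) \<le> card X" using finX by (intro card_mono) auto
      then show ?thesis using sub[OF 2] by linarith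
    next
      case 3
      then obtain e where e: "e \<in> E" by blast
      have "E - {e} \<noteq> {}"
      proof
        assume "E - {e} = {}"
        then have "E = {e}" using e by blast
        then have "card V = 1" using cardE by simp
        moreover have "card e \<le> card V" using edge[OF e] fin by (intro card_mono) auto
        ultimately show False using edge[OF e] by simp
      qed
      then have "int (card (E - {e})) \<le> 2 * int (card (\<Union>(E - {e}))) - 2"
        using e by (intro sub) auto
      moreover have "card (\<Union>(E - {e})) \<le> card X"
        using finX 3(1) by (intro card_mono) auto
      moreover have "int (card (E - {e})) = int (card E) - 1"
        using card_Suc_Diff1[OF finE e] by linarith
      ultimately have "card V \<le> card X" using cardE by linarith
      then have "X = V" using X(1) fin by (simp add: card_seteq)
      then show ?thesis using 3(1) cardE assms(2) by simp
    qed
  qed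
  have image: "{d \<in> bar_of ` E. ends d \<subseteq> X} = bar_of ` {e\<in>E. e \<subseteq> X}" for X
    using b(3) by auto
  have "card {d \<in> bar_of ` E. ends d \<subseteq> X} = card {e\<in>E. e \<subseteq> X}" for X
    unfolding image using inj by (intro card_image) (auto intro: inj_on_subset)
  then show ?thesis unfolding sparse_def
    using fin finE count b edge by (auto simp: image_iff)
qed

section \<open>Generic frameworks\<close>

text \<open>At \<open>x = - 1\<close> the division by zero gives \<open>s = 0\<close>. This is harmless, since the coordinates are
  still rational functions of \<open>s\<close> and \<open>z\<close>; generic frameworks avoid such points because \<open>s \<noteq> 0\<close>.\<close>

definition cyl_par :: "('a \<Rightarrow> real vec) \<Rightarrow> 'a par \<Rightarrow> real" where
  "cyl_par p k = (case k of PosS x \<Rightarrow> p x $ 1 / (1 + p x $ 0) | PosZ x \<Rightarrow> p x $ 2 | Coef _ _ \<Rightarrow> 0)"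

definition par_set :: "'a set \<Rightarrow> 'a par set" where
  "par_set V = PosS ` V \<union> PosZ ` V"

lemma cylinder_parametrization:
  fixes x y :: real
  assumes "x\<^sup>2 + y\<^sup>2 = 1" "1 + x \<noteq> 0" "s = y / (1 + x)"
  shows "x = (1 - s\<^sup>2) / (1 + s\<^sup>2)" "y = 2 * s / (1 + s\<^sup>2)"
proof -
  define q where "q = 1 + x"
  have q: "q \<noteq> 0" and s: "s = y / q" using assms by (auto simp: q_def)
  have "y\<^sup>2 = q * (2 - q)" using assms(1) by (simp add: q_def power2_eq_square algebra_simps)
  then have s2: "s\<^sup>2 = (2 - q) / q"
    using q by (simp add: s power_divide power2_eq_square)
  then have 1: "1 + s\<^sup>2 = 2 / q" using q by (simp add: field_simps)
  show "x = (1 - s\<^sup>2) / (1 + s\<^sup>2)"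
    unfolding 1 using q s2 by (simp add: field_simps) (simp add: q_def)
  show "y = 2 * s / (1 + s\<^sup>2)"
    unfolding 1 using q by (simp add: s)
qed

text \<open>The values of rational functions at the parameters contain the coordinates and are
  closed under the field operations; an inverse exchanges \<open>g\<close> and
  \<open>h\<close>.\<close>

lemma coordinate_field_rational:
  assumes "framework_on_cylinder V p" "b \<in> coordinate_field V p"
  shows "\<exists>g h. rat_polyfun (par_set V) g \<and> rat_polyfun (par_set V) h \<and>
    h (cyl_par p) \<noteq> 0 \<and> b = g (cyl_par p) / h (cyl_par p)"
proof -
  define K where "K = {b. \<exists>g h. rat_polyfun (par_set V) g \<and> rat_polyfun (par_set V) h \<and>
    h (cyl_par p) \<noteq> 0 \<and> b = g (cyl_par p) / h (cyl_par p)}"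
  have KI: "g (cyl_par p) / h (cyl_par p) \<in> K"
    if "rat_polyfun (par_set V) g" "rat_polyfun (par_set V) h" "h (cyl_par p) \<noteq> 0" for g h
    unfolding K_def using that by blast
  have coord: "p u $ i \<in> K" if u: "u \<in> V" and i: "i < 3" for u i
  proof -
    define s where "s = p u $ 1 / (1 + p u $ 0)"
    have cyl: "(p u $ 0)\<^sup>2 + (p u $ 1)\<^sup>2 = 1"
      using assms(1) u unfolding framework_on_cylinder_def cylinder_def by auto
    have S: "cyl_par p (PosS u) = s" and Z: "cyl_par p (PosZ u) = p u $ 2"
      by (simp_all add: cyl_par_def s_def)
    have mem: "PosS u \<in> par_set V" "PosZ u \<in> par_set V" using u by (auto simp: par_set_def)
    have pos: "1 + s\<^sup>2 \<noteq> 0" using one_plus_square_pos[of s] by simp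
    have sq: "rat_polyfun (par_set V) (\<lambda>Q. 1 + (Q (PosS u))\<^sup>2)" using mem by (intro rpf)
    show ?thesis
    proof (cases "1 + p u $ 0 = 0")
      case True
      then have x: "p u $ 0 = - 1" by simp
      then have y: "p u $ 1 = 0" using cyl by simp
      have "(\<lambda>_. -1) (cyl_par p) / (\<lambda>_. 1) (cyl_par p) \<in> K" "(\<lambda>_. 0) (cyl_par p) / (\<lambda>_. 1) (cyl_par p) \<in> K"
        "(\<lambda>Q. Q (PosZ u)) (cyl_par p) / (\<lambda>_. 1) (cyl_par p) \<in> K"
        using mem by (intro KI; auto intro: rpf)+
      moreover have "i = 0 \<or> i = 1 \<or> i = 2" using i by linarith
      ultimately show ?thesis using x y Z by auto
    next
      case False
      note cylinder_parametrization[OF cyl False s_def]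
      moreover have "(\<lambda>Q. 1 - (Q (PosS u))\<^sup>2) (cyl_par p) / (\<lambda>Q. 1 + (Q (PosS u))\<^sup>2) (cyl_par p) \<in> K"
        "(\<lambda>Q. 2 * Q (PosS u)) (cyl_par p) / (\<lambda>Q. 1 + (Q (PosS u))\<^sup>2) (cyl_par p) \<in> K"
        using mem pos by (intro KI sq rpf; simp add: S)+
      moreover have "(\<lambda>Q. Q (PosZ u)) (cyl_par p) / (\<lambda>_. 1) (cyl_par p) \<in> K"
        using mem by (intro KI rpf) auto
      moreover have "i = 0 \<or> i = 1 \<or> i = 2" using i by linarith
      ultimately show ?thesis using S Z by auto
    qed
  qed
  have "b \<in> K" using assms(2) unfolding coordinate_field_def
  proof (induction rule: generate_field.induct)
    case one
    have "(\<lambda>_. 1) (cyl_par p) / (\<lambda>_. 1) (cyl_par p) \<in> K" by (intro KI rpf) auto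
    then show ?case by simp
  next
    case (incl h)
    then show ?case using coord by auto
  next
    case (a_inv h)
    then obtain g k where gk: "rat_polyfun (par_set V) g" "rat_polyfun (par_set V) k"
      "k (cyl_par p) \<noteq> 0" "h = g (cyl_par p) / k (cyl_par p)" unfolding K_def by blast
    have "(\<lambda>Q. - g Q) (cyl_par p) / k (cyl_par p) \<in> K" using gk by (intro KI rpf) auto
    then show ?case using gk(4) by (simp add: class_ring_simps)
  next
    case (m_inv h)
    then obtain g k where gk: "rat_polyfun (par_set V) g" "rat_polyfun (par_set V) k"
      "k (cyl_par p) \<noteq> 0" "h = g (cyl_par p) / k (cyl_par p)" unfolding K_def by blast
    have "h \<noteq> 0" using m_inv by simp
    then have "k (cyl_par p) / g (cyl_par p) \<in> K" using gk by (intro KI) auto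
    then show ?case using gk(4) \<open>h \<noteq> 0\<close> by (simp add: class_ring_simps)
  next
    case (eng_add h h')
    then obtain g k g' k' where gk: "rat_polyfun (par_set V) g" "rat_polyfun (par_set V) k"
      "k (cyl_par p) \<noteq> 0" "h = g (cyl_par p) / k (cyl_par p)"
      "rat_polyfun (par_set V) g'" "rat_polyfun (par_set V) k'"
      "k' (cyl_par p) \<noteq> 0" "h' = g' (cyl_par p) / k' (cyl_par p)" unfolding K_def by blast
    have "(\<lambda>Q. g Q * k' Q + g' Q * k Q) (cyl_par p) / (\<lambda>Q. k Q * k' Q) (cyl_par p) \<in> K"
      using gk by (intro KI rpf) auto
    then show ?case using gk(3,4,7,8) by (simp add: add_frac_eq)
  next
    case (eng_mult h h')
    then obtain g k g' k' where gk: "rat_polyfun (par_set V) g" "rat_polyfun (par_set V) k"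
      "k (cyl_par p) \<noteq> 0" "h = g (cyl_par p) / k (cyl_par p)"
      "rat_polyfun (par_set V) g'" "rat_polyfun (par_set V) k'"
      "k' (cyl_par p) \<noteq> 0" "h' = g' (cyl_par p) / k' (cyl_par p)" unfolding K_def by blast
    have "(\<lambda>Q. g Q * g' Q) (cyl_par p) / (\<lambda>Q. k Q * k' Q) (cyl_par p) \<in> K"
      using gk by (intro KI rpf) auto
    then show ?case using gk(4,8) by simp
  qed
  then show ?thesis unfolding K_def by blast
qed

text \<open>A zero at the parameters would limit every algebraically independent set in the
  coordinate field to fewer than \<open>2 * card V\<close> elements, the number of parameters,
  against the transcendence degree.\<close>

lemma generic_nonvanishing:
  assumes "generic_on_cylinder V p" "finite V" "V \<noteq> {}"
    and f: "rat_polyfun (par_set V) f" "f Q \<noteq> 0"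
  shows "f (cyl_par p) \<noteq> 0"
proof
  assume f0: "f (cyl_par p) = 0"
  have fin: "finite (par_set V)" "par_set V \<noteq> {}" using assms(2,3) by (auto simp: par_set_def)
  have card: "card (par_set V) = 2 * card V"
    unfolding par_set_def using assms(2)
    by (subst card_Un_disjoint) (auto simp: card_image inj_on_def)
  have "card B \<le> 2 * card V - 1"
    if "B \<subseteq> coordinate_field V p" "finite B" "algebraically_independent B" for B
  proof -
    have "card B < card (par_set V)"
      using coordinate_field_rational[of V p] that(1) assms(1) unfolding generic_on_cylinder_def
      by (intro card_algebraically_independent_less[OF fin f(1) f0 f(2) that(2,3)]) auto
    then show ?thesis using card by simp
  qed
  then have "trans_degree (coordinate_field V p) \<le> enat (2 * card V - 1)"
    unfolding trans_degree_def by (intro SUP_least) auto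
  moreover have "card V > 0" using assms(2,3) by (simp add: card_gt_0_iff)
  ultimately show False using assms(1) unfolding generic_on_cylinder_def by simp
qed

section \<open>The rigidity matrix\<close>

text \<open>The rank is a dimension of the column space. Dual vectors of the rows are preimages of
  the unit vectors, so the columns span everything.\<close>

lemma full_row_rank:
  fixes A :: "real mat"
  assumes A: "A \<in> carrier_mat n nc" and indep: "rows_indep {..<n} {..<nc} (\<lambda>i j. A $$ (i, j))"
  shows "vec_space.rank n A = n"
proof -
  interpret vec_space "TYPE(real)" n .
  have "\<exists>m. \<forall>i'\<in>{..<n}. (\<Sum>j<nc. A $$ (i', j) * m j) = (if i' = i then 1 else 0)" if "i < n" for i
    using that by (intro rows_indep_dual_vector[OF _ _ indep]) auto
  then obtain m where m: "\<And>i i'. i < n \<Longrightarrow> i' < n \<Longrightarrow>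
      (\<Sum>j<nc. A $$ (i', j) * m i j) = (if i' = i then 1 else 0)"
    by (metis lessThan_iff)
  have "y \<in> col_space A" if y: "y \<in> carrier_vec n" for y
  proof -
    define x where "x = vec nc (\<lambda>j. \<Sum>i<n. y $ i * m i j)"
    have "A *\<^sub>v x = y"
    proof (rule eq_vecI)
      fix i assume "i < dim_vec y"
      then have i: "i < n" using y by simp
      have "(A *\<^sub>v x) $ i = (\<Sum>j<nc. A $$ (i, j) * (\<Sum>l<n. y $ l * m l j))"
        using i A by (simp add: x_def scalar_prod_def atLeast0LessThan)
      also have "\<dots> = (\<Sum>l<n. y $ l * (\<Sum>j<nc. A $$ (i, j) * m l j))"
        unfolding sum_distrib_left by (subst sum.swap) (simp add: mult_ac)
      also have "\<dots> = (\<Sum>l<n. if i = l then y $ l else 0)"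
        using m i by (intro sum.cong) auto
      also have "\<dots> = y $ i" using i by simp
      finally show "(A *\<^sub>v x) $ i = y $ i" .
    qed (use A y in auto)
    then show ?thesis using y A unfolding col_space_eq[OF A] by (auto simp: x_def)
  qed
  moreover have "col_space A \<subseteq> carrier_vec n" using A unfolding col_space_eq[OF A] by auto
  ultimately have "span (set (cols A)) = carrier_vec n" unfolding col_space_def by blast
  then have "span_vs (set (cols A)) = V" by simp
  then show ?thesis unfolding rank_def using dim_is_n by simp
qed

text \<open>Contractions of the block with the tangent \<open>(-y, x, 0)\<close>, the axis direction
  and the normal \<open>(x, y, 0)\<close> at the point. The factor \<open>\<kappa>\<close> clears
  the denominators \<open>1 + s^2\<close> of the parametrization at both ends.\<close>

lemma row_block_bar:
  fixes p :: "'a \<Rightarrow> real vec"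
  assumes e: "card e = 2" and x: "x \<in> e"
    and cyl: "\<forall>u\<in>e. p u \<in> cylinder \<and> 1 + p u $ 0 \<noteq> 0"
    and \<kappa>: "\<kappa> = (\<Prod>u\<in>e. 1 + (cyl_par p (PosS u))\<^sup>2)"
  shows "\<kappa> * (row_block p (Inl e) x $ 1 * p x $ 0 - row_block p (Inl e) x $ 0 * p x $ 1)
      = edge_row v (cyl_par p) (bar_of e) (x, 0)"
    and "\<kappa> * row_block p (Inl e) x $ 2 = edge_row v (cyl_par p) (bar_of e) (x, 1)"
    and "x = v \<Longrightarrow> \<kappa> * (row_block p (Inl e) x $ 0 * p x $ 0 + row_block p (Inl e) x $ 1 * p x $ 1)
      = edge_row v (cyl_par p) (bar_of e) (x, 2)"
proof -
  define w where "w = the_elem (e - {x})"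
  obtain w' where w': "e = {x, w'}" "x \<noteq> w'" using e x unfolding card_2_iff by auto
  have "e - {x} = {w'}" using w' by auto
  then have "w = w'" by (simp add: w_def)
  then have ew: "e = {x, w}" "x \<noteq> w" using w' by auto
  let ?Q = "cyl_par p"
  define s where "s = ?Q (PosS x)"
  define t where "t = ?Q (PosS w)"
  have dim: "p x \<in> carrier_vec 3" "p w \<in> carrier_vec 3"
    using cyl ew by (auto simp: cylinder_def)
  have rb: "row_block p (Inl e) x $ i = p x $ i - p w $ i" if "i < 3" for i
    using x dim that by (simp add: w_def[symmetric])
  have cx: "(p x $ 0)\<^sup>2 + (p x $ 1)\<^sup>2 = 1" "1 + p x $ 0 \<noteq> 0"
    and cw: "(p w $ 0)\<^sup>2 + (p w $ 1)\<^sup>2 = 1" "1 + p w $ 0 \<noteq> 0"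
    using cyl ew by (auto simp: cylinder_def)
  define qs where "qs = 1 + s\<^sup>2"
  define qt where "qt = 1 + t\<^sup>2"
  have q: "qs > 0" "qt > 0" using one_plus_square_pos by (auto simp: qs_def qt_def)
  have px: "p x $ 0 = (1 - s\<^sup>2) / qs" "p x $ 1 = 2 * s / qs"
    unfolding qs_def by (rule cylinder_parametrization[OF cx], simp add: s_def cyl_par_def)+
  have pw: "p w $ 0 = (1 - t\<^sup>2) / qt" "p w $ 1 = 2 * t / qt"
    unfolding qt_def by (rule cylinder_parametrization[OF cw], simp add: t_def cyl_par_def)+
  have \<kappa>q: "\<kappa> = qs * qt"
    unfolding \<kappa> using ew by (simp add: s_def t_def qs_def qt_def)
  note b = bar_of[OF e]
  have other: "other x (bar_of e) = w" "x \<in> ends (bar_of e)"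
    using b ew by (auto simp: other_def ends_def doubleton_eq_iff)
  have row: "edge_row v ?Q (bar_of e) (x, j) = bar_coeff s (?Q (PosZ x)) t (?Q (PosZ w)) j" if "j < 2" for j
  proof -
    have "edge_row v ?Q (bar_of e) (x, j) = end_coeff x ?Q (bar_of e) j"
      using that b(2) other(2) by (auto simp: end_coeff_def ends_def)
    then show ?thesis
      using end_coeff_bar[OF b(1) other(2) b(2), of j ?Q] that by (simp add: other(1) s_def t_def)
  qed
  have "\<kappa> * ((p x $ 1 - p w $ 1) * p x $ 0 - (p x $ 0 - p w $ 0) * p x $ 1)
      = (qs * p x $ 1) * (qt * p w $ 0) - (qs * p x $ 0) * (qt * p w $ 1)"
    by (simp add: \<kappa>q algebra_simps)
  also have "\<dots> = (2 * s) * (1 - t\<^sup>2) - (1 - s\<^sup>2) * (2 * t)"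
    unfolding px pw using q by simp
  also have "\<dots> = bar_coeff s (?Q (PosZ x)) t (?Q (PosZ w)) 0"
    by (simp add: power2_eq_square algebra_simps)
  finally show "\<kappa> * (row_block p (Inl e) x $ 1 * p x $ 0 - row_block p (Inl e) x $ 0 * p x $ 1)
      = edge_row v ?Q (bar_of e) (x, 0)" by (simp only: row rb zero_less_numeral one_less_numeral_iff semiring_norm)
  have "\<kappa> * (p x $ 2 - p w $ 2) = bar_coeff s (?Q (PosZ x)) t (?Q (PosZ w)) 1"
    by (simp add: \<kappa>q qs_def qt_def cyl_par_def)
  then show "\<kappa> * row_block p (Inl e) x $ 2 = edge_row v ?Q (bar_of e) (x, 1)"
    by (simp only: row rb one_less_numeral_iff numeral_less_iff semiring_norm)
  assume "x = v"
  have "edge_row v ?Q (bar_of e) (x, 2) = end_coeff x ?Q (bar_of e) 2"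
    using \<open>x = v\<close> other(2) by (simp add: end_coeff_def)
  also have "\<dots> = bar_coeff s (?Q (PosZ x)) t (?Q (PosZ w)) 2"
    using end_coeff_bar[OF b(1) other(2) b(2), of 2 ?Q] by (simp only: other(1) s_def t_def)
  finally have r2: "edge_row v ?Q (bar_of e) (x, 2) = 2 * (s - t)\<^sup>2" by simp
  have "\<kappa> * ((p x $ 0 - p w $ 0) * p x $ 0 + (p x $ 1 - p w $ 1) * p x $ 1)
      = qs * qt * ((p x $ 0)\<^sup>2 + (p x $ 1)\<^sup>2) - ((qs * p x $ 0) * (qt * p w $ 0) + (qs * p x $ 1) * (qt * p w $ 1))"
    by (simp add: \<kappa>q power2_eq_square algebra_simps)
  also have "\<dots> = qs * qt - ((1 - s\<^sup>2) * (1 - t\<^sup>2) + (2 * s) * (2 * t))"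
    unfolding cx(1) unfolding px pw using q by simp
  also have "\<dots> = 2 * (s - t)\<^sup>2"
    by (simp add: qs_def qt_def power2_eq_square algebra_simps)
  finally show "\<kappa> * (row_block p (Inl e) x $ 0 * p x $ 0 + row_block p (Inl e) x $ 1 * p x $ 1)
      = edge_row v ?Q (bar_of e) (x, 2)" unfolding r2 by (simp only: rb zero_less_numeral one_less_numeral_iff semiring_norm)
qed

lemma row_block_outside:
  assumes "x \<notin> e" "card e = 2"
  shows "i < 3 \<Longrightarrow> row_block p (Inl e) x $ i = 0" "j < 3 \<Longrightarrow> edge_row v Q (bar_of e) (x, j) = 0"
  using assms bar_of(3)[OF assms(2)] by (auto simp: ends_def)

text \<open>Contracting the columns of each vertex with the tangent vectors of the cylinder, and with
  the normal at \<open>v\<close>, kills the rows of the vertices and turns those of the edges into the rows of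
  the reduced matrix.\<close>

lemma rigidity_stress_zero:
  assumes "finite V" "finite E" and edges: "\<And>e. e \<in> E \<Longrightarrow> e \<subseteq> V \<and> card e = 2"
    and cyl: "\<And>u. u \<in> V \<Longrightarrow> p u \<in> cylinder \<and> 1 + p u $ 0 \<noteq> 0"
    and indep: "rows_indep (bar_of ` E) (V \<times> {..<3}) (edge_row v (cyl_par p))"
    and stress: "\<And>x c. x \<in> V \<Longrightarrow> c < 3 \<Longrightarrow>
      (\<Sum>l\<in>Inl ` E \<union> Inr ` (V - {v}). W l * row_block p l x $ c) = 0"
  shows "\<forall>l\<in>Inl ` E \<union> Inr ` (V - {v}). W l = 0"
proof -
  define \<kappa> where "\<kappa> e = (\<Prod>u\<in>e. 1 + (cyl_par p (PosS u))\<^sup>2)" for e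
  have \<kappa>: "\<kappa> e \<noteq> 0" for e
    unfolding \<kappa>_def using one_plus_square_pos by (metis less_irrefl prod_pos)
  define F where "F x c = (\<Sum>e\<in>E. W (Inl e) * row_block p (Inl e) x $ c)" for x c
  have F: "F x c + (if x = v then 0 else W (Inr x) * vec_of_list [p x $ 0, p x $ 1, 0] $ c) = 0"
    if x: "x \<in> V" and c: "c < 3" for x c
  proof -
    have "(\<Sum>l\<in>Inl ` E \<union> Inr ` (V - {v}). W l * row_block p l x $ c) =
        F x c + (\<Sum>u\<in>V - {v}. W (Inr u) * row_block p (Inr u) x $ c)"
      unfolding F_def using assms(1,2)
      by (subst sum.union_disjoint) (auto simp: sum.reindex simp del: row_block.simps)
    also have "(\<Sum>u\<in>V - {v}. W (Inr u) * row_block p (Inr u) x $ c) =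
        (\<Sum>u\<in>V - {v}. if x = u then W (Inr u) * vec_of_list [p u $ 0, p u $ 1, 0] $ c else 0)"
      using c by (intro sum.cong) auto
    also have "\<dots> = (if x = v then 0 else W (Inr x) * vec_of_list [p x $ 0, p x $ 1, 0] $ c)"
      using assms(1) x by simp
    finally show ?thesis using stress[OF x c] by simp
  qed
  have inj: "inj_on bar_of E" using bar_of(3) edges by (metis inj_onI)
  \<comment> \<open>Division by \<open>\<kappa>\<close> compensates for the cleared
    denominators.\<close>
  define \<omega> where "\<omega> b = W (Inl (ends b)) / \<kappa> (ends b)" for b
  have \<omega>: "\<omega> (bar_of e) * (\<kappa> e * y) = W (Inl e) * y" if "e \<in> E" for e y
    using bar_of(3)[of e] edges[OF that] \<kappa>[of e] by (simp add: \<omega>_def)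
  have reindex: "(\<Sum>b\<in>bar_of ` E. \<omega> b * g b) = (\<Sum>e\<in>E. \<omega> (bar_of e) * g (bar_of e))" for g
    by (simp add: sum.reindex[OF inj])
  have cyl_e: "\<forall>u\<in>e. p u \<in> cylinder \<and> 1 + p u $ 0 \<noteq> 0" if "e \<in> E" for e
    using cyl edges that by blast
  have "(\<Sum>b\<in>bar_of ` E. \<omega> b * edge_row v (cyl_par p) b (x, j)) = 0" if x: "x \<in> V" and j: "j < 3" for x j
  proof -
    note F012 = F[OF x, of 0] F[OF x, of 1] F[OF x, of 2]
    have v0: "vec_of_list [p x $ 0, p x $ 1, 0] $ 0 = p x $ 0"
      "vec_of_list [p x $ 0, p x $ 1, 0] $ 1 = p x $ 1"
      "vec_of_list [p x $ 0, p x $ 1, 0] $ 2 = 0"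
      by (simp_all add: vec_of_list_index numeral_2_eq_2)
    consider "j = 0" | "j = 1" | "j = 2" "x = v" | "j = 2" "x \<noteq> v" using j by linarith
    then show ?thesis
    proof cases
      case 1
      have "(\<Sum>e\<in>E. \<omega> (bar_of e) * edge_row v (cyl_par p) (bar_of e) (x, 0)) =
          (\<Sum>e\<in>E. W (Inl e) * (row_block p (Inl e) x $ 1 * p x $ 0 - row_block p (Inl e) x $ 0 * p x $ 1))"
      proof (intro sum.cong refl)
        fix e assume e: "e \<in> E"
        show "\<omega> (bar_of e) * edge_row v (cyl_par p) (bar_of e) (x, 0) =
            W (Inl e) * (row_block p (Inl e) x $ 1 * p x $ 0 - row_block p (Inl e) x $ 0 * p x $ 1)"
        proof (cases "x \<in> e")
          case True
          show ?thesis
            unfolding row_block_bar(1)[OF conjunct2[OF edges[OF e]] True cyl_e[OF e] \<kappa>_def, symmetric]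
            using e by (rule \<omega>)
        next
          case False
          have "card e = 2" using edges[OF e] by blast
          then show ?thesis
            by (simp add: row_block_outside[OF False] del: edge_row.simps row_block.simps)
        qed
      qed
      also have "\<dots> = F x 1 * p x $ 0 - F x 0 * p x $ 1"
        unfolding F_def sum_distrib_right sum_subtractf[symmetric]
        by (intro sum.cong refl) (simp add: algebra_simps del: row_block.simps)
      also have "\<dots> = 0"
      proof -
        have "F x 0 = (if x = v then 0 else - W (Inr x) * p x $ 0)"
          "F x 1 = (if x = v then 0 else - W (Inr x) * p x $ 1)"
          using F012(1,2) unfolding v0 by (auto split: if_splits)
        then show ?thesis by simp
      qed
      finally show ?thesis unfolding reindex 1 .
    next
      case 2
      have "(\<Sum>e\<in>E. \<omega> (bar_of e) * edge_row v (cyl_par p) (bar_of e) (x, 1)) = F x 2"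
        unfolding F_def
      proof (intro sum.cong refl)
        fix e assume e: "e \<in> E"
        show "\<omega> (bar_of e) * edge_row v (cyl_par p) (bar_of e) (x, 1) = W (Inl e) * row_block p (Inl e) x $ 2"
        proof (cases "x \<in> e")
          case True
          show ?thesis
            unfolding row_block_bar(2)[OF conjunct2[OF edges[OF e]] True cyl_e[OF e] \<kappa>_def, symmetric]
            using e by (rule \<omega>)
        next
          case False
          have "card e = 2" using edges[OF e] by blast
          then show ?thesis
            by (simp add: row_block_outside[OF False] del: edge_row.simps row_block.simps)
        qed
      qed
      also have "\<dots> = 0" using F012(3) unfolding v0 by (simp split: if_splits)
      finally show ?thesis unfolding reindex 2 .
    next
      case 3
      have "(\<Sum>e\<in>E. \<omega> (bar_of e) * edge_row v (cyl_par p) (bar_of e) (x, 2)) =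
          (\<Sum>e\<in>E. W (Inl e) * (row_block p (Inl e) x $ 0 * p x $ 0 + row_block p (Inl e) x $ 1 * p x $ 1))"
      proof (intro sum.cong refl)
        fix e assume e: "e \<in> E"
        show "\<omega> (bar_of e) * edge_row v (cyl_par p) (bar_of e) (x, 2) =
            W (Inl e) * (row_block p (Inl e) x $ 0 * p x $ 0 + row_block p (Inl e) x $ 1 * p x $ 1)"
        proof (cases "x \<in> e")
          case True
          show ?thesis
            unfolding row_block_bar(3)[OF conjunct2[OF edges[OF e]] True cyl_e[OF e] \<kappa>_def 3(2), symmetric]
            using e by (rule \<omega>)
        next
          case False
          have "card e = 2" using edges[OF e] by blast
          then show ?thesis
            by (simp add: row_block_outside[OF False] del: edge_row.simps row_block.simps)
        qed
      qed
      also have "\<dots> = F x 0 * p x $ 0 + F x 1 * p x $ 1"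
        unfolding F_def sum_distrib_right sum.distrib[symmetric]
        by (intro sum.cong refl) (simp add: algebra_simps del: row_block.simps)
      also have "\<dots> = 0" using F012(1,2) 3(2) by simp
      finally show ?thesis unfolding reindex 3(1) .
    next
      case 4
      then show ?thesis by simp
    qed
  qed
  then have "\<forall>k\<in>V \<times> {..<3}. (\<Sum>b\<in>bar_of ` E. \<omega> b * edge_row v (cyl_par p) b k) = 0"
    by (auto simp del: edge_row.simps)
  then have "\<forall>b\<in>bar_of ` E. \<omega> b = 0" using indep unfolding rows_indep_def by blast
  then have WE: "W (Inl e) = 0" if "e \<in> E" for e
    using \<omega>[OF that, of 1] that by simp
  \<comment> \<open>Once the edges drop out, a multiple of the normal at \<open>x\<close> must
    vanish, and the normal has length 1.\<close>
  have "W (Inr x) = 0" if x: "x \<in> V - {v}" for x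
  proof -
    have F0: "F x c = 0" for c unfolding F_def using WE by simp
    have "W (Inr x) * p x $ 0 = 0" "W (Inr x) * p x $ 1 = 0"
      using F[of x 0] F[of x 1] x by (auto simp: F0)
    moreover have "(p x $ 0)\<^sup>2 + (p x $ 1)\<^sup>2 = 1" using cyl x by (auto simp: cylinder_def)
    ultimately show ?thesis by auto
  qed
  then show ?thesis using WE by blast
qed

theorem theorem6p1:
  fixes V :: "'a set" and E :: "'a set set" and p :: "'a \<Rightarrow> real vec" and v :: 'a
  assumes "M22_circuit V E"
    and "generic_on_cylinder V p"
    and "v \<in> V"
  shows "free_infinitesimally_rigid V E p v"
proof -
  let ?I = "par_set V"
  note sp = M22_circuit_sparse[OF assms(1,3)]
  note sp' = sparseD[OF sp]
  have edges: "\<And>e. e \<in> E \<Longrightarrow> e \<subseteq> V \<and> card e = 2" and cardE: "int (card E) = 2 * int (card V) - 1"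
    using assms(1) unfolding M22_circuit_def simple_graph_def by auto
  have finV: "finite V" and neV: "V \<noteq> {}" using sp'(1) assms(3) by auto
  have finE: "finite E" using finV edges by (intro finite_subset[of E "Pow V"]) auto
  have bars: "\<And>e. e \<in> E \<Longrightarrow> is_bar (bar_of e) \<and> ends (bar_of e) \<subseteq> V"
    using bar_of edges by metis
  obtain Q0 where Q0: "rows_indep (bar_of ` E) (V \<times> {..<3}) (edge_row v Q0)"
    using sparse_generically_indep[OF sp] by blast
  \<comment> \<open>Bars involve no coefficient variables, so the certificate of independence is a
    polynomial in the \<open>2 * card V\<close> position parameters alone, as genericity
    demands.\<close>
  have "rat_polyfun ?I (\<lambda>Q. edge_row v Q b k)" if "b \<in> bar_of ` E" for b k
  proof (rule rat_polyfun_row)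
    have "is_bar b" "ends b \<subseteq> V" using that bars by auto
    then show "case b of Bar x y \<Rightarrow> {PosS x, PosZ x, PosS y, PosZ y} \<subseteq> ?I
        | Free k x y \<Rightarrow> \<forall>j. Coef k j \<in> ?I"
      by (cases b) (auto simp: ends_def par_set_def)
  qed
  then obtain f where f: "rat_polyfun ?I f" "f Q0 \<noteq> 0"
    "\<And>Q. f Q \<noteq> 0 \<Longrightarrow> rows_indep (bar_of ` E) (V \<times> {..<3}) (edge_row v Q)"
    using rows_indep_open[of "bar_of ` E" "V \<times> {..<3}" ?I "edge_row v" Q0] sp'(2) finV Q0
    by (metis finite_SigmaI finite_lessThan)
  have indep: "rows_indep (bar_of ` E) (V \<times> {..<3}) (edge_row v (cyl_par p))"
    using generic_nonvanishing[OF assms(2) finV neV f(1,2)] by (rule f(3))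
  have cyl: "p u \<in> cylinder \<and> 1 + p u $ 0 \<noteq> 0" if u: "u \<in> V" for u
  proof -
    have "cyl_par p (PosS u) \<noteq> 0"
      using u by (intro generic_nonvanishing[OF assms(2) finV neV, where f = "\<lambda>Q. Q (PosS u)" and Q = "\<lambda>_. 1"])
        (auto intro: rpf simp: par_set_def)
    then show ?thesis
      using assms(2) u unfolding generic_on_cylinder_def framework_on_cylinder_def
      by (auto simp: cyl_par_def)
  qed
  show ?thesis unfolding free_infinitesimally_rigid_def
  proof (intro allI impI)
    fix vs es assume vs: "distinct vs" "set vs = V" and es: "distinct es" "set es = E"
    define ls where "ls = remove1 (Inr v) (row_indices vs es)"
    define A where "A = R_free p vs es v"
    have dist: "distinct (row_indices vs es)"
      using vs es by (auto simp: row_indices_def distinct_map)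
    then have ls: "distinct ls" "set ls = Inl ` E \<union> Inr ` (V - {v})"
      using vs es by (auto simp: ls_def row_indices_def set_remove1_eq)
    have "Inr v \<in> set (row_indices vs es)" using vs assms(3) by (simp add: row_indices_def)
    then have "length ls = length es + length vs - 1"
      by (simp add: ls_def length_remove1 row_indices_def)
    moreover have "length es = card E" "length vs = card V"
      using vs es by (auto simp: distinct_card[symmetric])
    moreover have "card V > 0" using finV neV by (simp add: card_gt_0_iff)
    ultimately have len: "length ls = 3 * card V - 2" using cardE by linarith
    have A: "A \<in> carrier_mat (length ls) (3 * length vs)"
      by (simp add: A_def R_free_def matrix_with_rows_def ls_def)
    have A_entry: "A $$ (i, j) = row_block p (ls ! i) (vs ! (j div 3)) $ (j mod 3)"
      if "i < length ls" "j < 3 * length vs" for i j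
      using that by (simp add: A_def R_free_def matrix_with_rows_def ls_def)
    have bij: "bij_betw (nth ls) {..<length ls} (set ls)"
      using ls(1) by (rule bij_betw_nth) auto
    have "rows_indep {..<length ls} {..<3 * length vs} (\<lambda>i j. A $$ (i, j))"
      unfolding rows_indep_def
    proof (intro allI impI)
      fix \<omega> assume \<omega>: "\<forall>j\<in>{..<3 * length vs}. (\<Sum>i<length ls. \<omega> i * A $$ (i, j)) = 0"
      define W where "W l = \<omega> (the_inv_into {..<length ls} (nth ls) l)" for l
      have W: "W (ls ! i) = \<omega> i" if "i < length ls" for i
        using bij that by (simp add: W_def the_inv_into_f_f bij_betw_def)
      have "(\<Sum>l\<in>set ls. W l * row_block p l x $ c) = 0" if x: "x \<in> V" and c: "c < 3" for x c
      proof -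
        obtain k where k: "k < length vs" "vs ! k = x" using x vs(2) by (metis in_set_conv_nth)
        have "(\<Sum>l\<in>set ls. W l * row_block p l x $ c) =
            (\<Sum>i<length ls. W (ls ! i) * row_block p (ls ! i) x $ c)"
          by (rule sum.reindex_bij_betw[OF bij, symmetric])
        also have "\<dots> = (\<Sum>i<length ls. \<omega> i * A $$ (i, 3 * k + c))"
          using k c by (intro sum.cong refl) (simp add: W A_entry del: row_block.simps)
        also have "\<dots> = 0" using \<omega> k c by auto
        finally show ?thesis .
      qed
      then have "\<forall>l\<in>set ls. W l = 0"
        unfolding ls(2) by (intro rigidity_stress_zero[OF finV finE edges cyl indep]) auto
      then show "\<forall>i\<in>{..<length ls}. \<omega> i = 0" using W by (metis lessThan_iff nth_mem)
    qed
    then have "vec_space.rank (length ls) A = length ls" by (rule full_row_rank[OF A])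
    then show "vec_space.rank (dim_row (R_free p vs es v)) (R_free p vs es v) = 3 * card V - 2"
      using A len unfolding A_def by simp
  qed
qed

end
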